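(* For every fixed $k$ and every fixed integer $i$, BICLIQUE $k$-COLORING is in $\mathsf{NP}$ when the input is restricted to $\{K_{i,i}, W_4, \text{dart}, \text{gem}\}$-free graphs.
   Context: All graphs are finite and simple. A biclique of $G$ is a set $W\subseteq V(G)$ with $G[W]$ complete bipartite $K_{n,m}$ ($n,m\ge1$); a maximal biclique is a biclique not properly contained in another biclique. A $k$-coloring is a map $\rho:V(G)\to\{1,\dots,k\}$; a set $W$ is monochromatic if $|\rho(W)|=1$. A biclique $k$-coloring has no monochromatic maximal biclique. BICLIQUE $k$-COLORING: given a connected graph $G$, decide whether $G$ admits a biclique $k$-coloring. The diamond is $K_4$ minus an edge; $W_4$ is the 4-cycle plus a vertex adjacent to all four cycle vertices; the gem is $P_4$ plus a vertex adjacent to all its vertices; the dart is a diamond plus an extra vertex adjacent only to one of the two degree-3 vertices of the diamond. $\mathcal F$-free means no induced subgraph isomorphic to a member of $\mathcal F$. *)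

theory Defs
  imports
    "Graph_Theory.Graph_Theory"
    "HOL-Computational_Algebra.Polynomial"
begin

section \<open>Graphs and biclique colorings\<close>

text \<open>
  A finite simple graph is a \<^locale>\<open>pair_graph\<close>: a finite, symmetric, loop-free digraph without
  parallel arcs. As for \<^const>\<open>connected\<close>, the null graph does not count as connected.
\<close>

definition biclique :: "'a pair_pre_digraph \<Rightarrow> 'a set \<Rightarrow> bool" where
  "biclique G W \<longleftrightarrow> W \<subseteq> pverts G \<and>
     (\<exists>n m. n \<ge> 1 \<and> m \<ge> 1 \<and> complete_bipartite_digraph n m (with_proj G \<restriction> W))"

definition maximal_biclique :: "'a pair_pre_digraph \<Rightarrow> 'a set \<Rightarrow> bool" where
  "maximal_biclique G W \<longleftrightarrow> biclique G W \<and> \<not> (\<exists>W'. biclique G W' \<and> W \<subset> W')"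

definition coloring :: "nat \<Rightarrow> 'a pair_pre_digraph \<Rightarrow> ('a \<Rightarrow> nat) \<Rightarrow> bool" where
  "coloring k G \<rho> \<longleftrightarrow> \<rho> ` pverts G \<subseteq> {1..k}"

definition monochromatic :: "('a \<Rightarrow> nat) \<Rightarrow> 'a set \<Rightarrow> bool" where
  "monochromatic \<rho> W \<longleftrightarrow> card (\<rho> ` W) = 1"

definition biclique_coloring :: "nat \<Rightarrow> 'a pair_pre_digraph \<Rightarrow> ('a \<Rightarrow> nat) \<Rightarrow> bool" where
  "biclique_coloring k G \<rho> \<longleftrightarrow> coloring k G \<rho> \<and>
     \<not> (\<exists>W. maximal_biclique G W \<and> monochromatic \<rho> W)"

definition family_free :: "'b pair_pre_digraph set \<Rightarrow> 'a pair_pre_digraph \<Rightarrow> bool" where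
  "family_free \<F> G \<longleftrightarrow>
     \<not> (\<exists>F\<in>\<F>. \<exists>H. induced_subgraph H (with_proj G) \<and> digraph_iso (with_proj F) H)"

definition edge_list_graph :: "nat \<Rightarrow> (nat \<times> nat) list \<Rightarrow> nat pair_pre_digraph" where
  "edge_list_graph n es = \<lparr> pverts = {..<n}, parcs = set es \<union> (set es)\<inverse> \<rparr>"

text \<open>In the wheel and the gem, vertex 4 is the universal vertex.\<close>

definition W4_graph :: "nat pair_pre_digraph" where
  "W4_graph = edge_list_graph 5 [(0,1), (1,2), (2,3), (3,0), (4,0), (4,1), (4,2), (4,3)]"

definition gem_graph :: "nat pair_pre_digraph" where
  "gem_graph = edge_list_graph 5 [(0,1), (1,2), (2,3), (4,0), (4,1), (4,2), (4,3)]"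

text \<open>The vertices 0, 1, 2, 3 induce a diamond whose degree-3 vertices are 0 and 1.\<close>

definition dart_graph :: "nat pair_pre_digraph" where
  "dart_graph = edge_list_graph 5 [(0,1), (0,2), (0,3), (1,2), (1,3), (0,4)]"

text \<open>All copies of \<open>K\<^sub>i\<^sub>,\<^sub>i\<close> with vertices in \<open>\<nat>\<close> are included.\<close>

definition forbidden_graphs :: "nat \<Rightarrow> nat pair_pre_digraph set" where
  "forbidden_graphs i =
     {H. complete_bipartite_digraph i i (with_proj H)} \<union> {W4_graph, dart_graph, gem_graph}"


section \<open>Turing machines and NP\<close>

text \<open>
  Deterministic Turing machines with finitely many two-way infinite tapes. States, tape symbols and
  tapes are natural numbers below the bounds given in the machine; symbol 0 is the blank. The
  transition function maps a state and the tuple of scanned symbols to a new state and, for every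
  tape, the symbol to be written and the head movement.
\<close>

datatype move = MoveLeft | Stay | MoveRight

record tm =
  num_tapes :: nat
  num_symbols :: nat
  num_states :: nat
  start_state :: nat
  accept_state :: nat
  reject_state :: nat
  transition :: "nat \<Rightarrow> (nat \<Rightarrow> nat) \<Rightarrow> nat \<times> (nat \<Rightarrow> nat \<times> move)"

text \<open>The symbols 1, 2 and 3 are needed for inputs.\<close>

definition wf_tm :: "tm \<Rightarrow> bool" where
  "wf_tm M \<longleftrightarrow> num_tapes M \<ge> 1 \<and> num_symbols M \<ge> 4 \<and>
     start_state M < num_states M \<and> accept_state M < num_states M \<and>
     reject_state M < num_states M \<and> accept_state M \<noteq> reject_state M \<and>
     (\<forall>q r. q < num_states M \<longrightarrow> (\<forall>j. r j < num_symbols M) \<longrightarrow>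
        fst (transition M q r) < num_states M \<and>
        (\<forall>j < num_tapes M. fst (snd (transition M q r) j) < num_symbols M))"

type_synonym tape = "(int \<Rightarrow> nat) \<times> int"

type_synonym config = "nat \<times> (nat \<Rightarrow> tape)"

fun head_shift :: "move \<Rightarrow> int" where
  "head_shift MoveLeft = -1"
| "head_shift Stay = 0"
| "head_shift MoveRight = 1"

definition write_move :: "nat \<times> move \<Rightarrow> tape \<Rightarrow> tape" where
  "write_move a t = ((fst t)(snd t := fst a), snd t + head_shift (snd a))"

text \<open>
  The scanned tuple is padded with blanks beyond the last tape, so that the control only depends on
  finitely many symbols.
\<close>

definition scanned :: "tm \<Rightarrow> (nat \<Rightarrow> tape) \<Rightarrow> nat \<Rightarrow> nat" where
  "scanned M ts j = (if j < num_tapes M then fst (ts j) (snd (ts j)) else 0)"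

definition halted :: "tm \<Rightarrow> config \<Rightarrow> bool" where
  "halted M c \<longleftrightarrow> fst c = accept_state M \<or> fst c = reject_state M"

definition tm_step :: "tm \<Rightarrow> config \<Rightarrow> config" where
  "tm_step M c =
     (if halted M c then c
      else let (q, act) = transition M (fst c) (scanned M (snd c))
           in (q, \<lambda>j. if j < num_tapes M then write_move (act j) (snd c j) else snd c j))"

definition word_tape :: "nat list \<Rightarrow> tape" where
  "word_tape w = ((\<lambda>p. if 0 \<le> p \<and> p < int (length w) then w ! nat p else 0), 0)"

definition initial_config :: "tm \<Rightarrow> nat list \<Rightarrow> config" where
  "initial_config M w = (start_state M, \<lambda>j. if j = 0 then word_tape w else word_tape [])"

definition tm_run :: "tm \<Rightarrow> nat list \<Rightarrow> nat \<Rightarrow> config" where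
  "tm_run M w t = (tm_step M ^^ t) (initial_config M w)"

definition halts_within :: "tm \<Rightarrow> nat list \<Rightarrow> nat \<Rightarrow> bool" where
  "halts_within M w t \<longleftrightarrow> halted M (tm_run M w t)"

definition accepts :: "tm \<Rightarrow> nat list \<Rightarrow> bool" where
  "accepts M w \<longleftrightarrow> (\<exists>t. fst (tm_run M w t) = accept_state M)"

definition bit_symbol :: "bool \<Rightarrow> nat" where
  "bit_symbol b = (if b then 2 else 1)"

text \<open>The input and the certificate are separated by symbol 3.\<close>

definition pair_word :: "bool list \<Rightarrow> bool list \<Rightarrow> nat list" where
  "pair_word x y = map bit_symbol x @ [3] @ map bit_symbol y"

text \<open>Languages with a polynomial-time verifier and certificates of polynomial length.\<close>

definition NP :: "bool list set set" where
  "NP = {L. \<exists>M (p :: nat poly) (q :: nat poly). wf_tm M \<and>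
     (\<forall>x y. halts_within M (pair_word x y) (poly p (length x + length y))) \<and>
     (\<forall>x. x \<in> L \<longleftrightarrow> (\<exists>y. length y \<le> poly q (length x) \<and> accepts M (pair_word x y)))}"


section \<open>The decision problem\<close>

text \<open>
  Instances are graphs with vertex set \<open>{0, \<dots>, n - 1}\<close>, given by \<open>n\<close> in unary, a zero bit, and the
  adjacency matrix row by row.
\<close>

definition encode_graph :: "nat pair_pre_digraph \<Rightarrow> bool list" where
  "encode_graph G =
     (let n = card (pverts G)
      in replicate n True @ [False] @
         concat (map (\<lambda>u. map (\<lambda>v. (u, v) \<in> parcs G) [0..<n]) [0..<n]))"

definition graph_instance :: "nat pair_pre_digraph \<Rightarrow> bool" where
  "graph_instance G \<longleftrightarrow> pair_graph G \<and> (\<exists>n. pverts G = {..<n})"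

definition biclique_coloring_problem :: "nat \<Rightarrow> nat pair_pre_digraph set \<Rightarrow> bool list set" where
  "biclique_coloring_problem k \<F> =
     {encode_graph G | G. graph_instance G \<and> connected (with_proj G) \<and> family_free \<F> G \<and>
        (\<exists>\<rho>. biclique_coloring k G \<rho>)}"

end

theory Submission
  imports Defs
begin

text \<open>
  Membership in \<open>NP\<close> is obtained from first-order logic: if the words of a language are unary numbers
  \<open>n\<close> followed by an adjacency matrix, and membership means that certain relations on \<open>{0, \<dots>, n - 1}\<close>
  exist for which a fixed first-order sentence holds, then the relations serve as a certificate and
  a multi-tape machine checks the sentence, using one tape as a counter for every bound variable.

  Connectivity becomes first-order when the certificate contains a strict order in which every vertex
  except the root has a smaller neighbour, and a \<open>k\<close>-coloring is given by the relation of having the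
  same color. It remains to find a monochromatic maximal biclique by looking at boundedly many
  vertices. Let \<open>A\<close> and \<open>B\<close> be its sides. As \<open>K\<^sub>i\<^sub>,\<^sub>i\<close> is excluded, one side, say \<open>A\<close>, has fewer than \<open>i\<close>
  vertices. The side \<open>B\<close> may be large, but at most \<open>2i\<close> of its vertices already prevent an extension of
  \<open>A\<close>: choose \<open>i\<close> vertices of \<open>B\<close>, take a maximal independent set \<open>I\<close> of vertices that are complete to
  them and anticomplete to \<open>A\<close> (it has fewer than \<open>i\<close> elements), and add for every \<open>w\<close> in \<open>I\<close> a
  non-neighbour of \<open>w\<close> in \<open>B\<close>; a vertex that could still be added to \<open>A\<close> would be the center of a dart.
  Conversely, given \<open>A\<close> and this part \<open>B\<^sub>0\<close> of \<open>B\<close>, the common neighbours of \<open>A\<close> without neighbours in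
  \<open>B\<^sub>0\<close> form disjoint cliques, again because there is no dart, and \<open>B\<^sub>0\<close> extends to a side of the
  right color if and only if each of these cliques contains a vertex of that color.
\<close>

section \<open>Structured programs for Turing machines\<close>

text \<open>
  A program is run as a stack of commands. Only finitely many stacks are reachable from a given
  program, and these are the states of the compiled Turing machine.
\<close>

datatype cmd =
    Move "nat set" move
  | Write "nat set" nat
  | Seq cmd cmd
  | Cond "(nat \<Rightarrow> nat) \<Rightarrow> bool" cmd cmd
  | While "(nat \<Rightarrow> nat) \<Rightarrow> bool" cmd

abbreviation Skip :: cmd where
  "Skip \<equiv> Move {} Stay"

abbreviation idle :: "(nat \<Rightarrow> nat) \<Rightarrow> nat \<Rightarrow> nat \<times> move" where
  "idle r \<equiv> \<lambda>j. (r j, Stay)"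

text \<open>Tests and rearrangements of the stack take a step of their own. A machine has to write
  in every step, so such a step rewrites the scanned symbols (\<open>idle\<close>).\<close>

fun next_cmd :: "(nat \<Rightarrow> nat) \<Rightarrow> cmd list \<Rightarrow> cmd list \<times> (nat \<Rightarrow> nat \<times> move)" where
  "next_cmd r [] = ([], idle r)"
| "next_cmd r (Move J d # k) = (k, \<lambda>j. (r j, if j \<in> J then d else Stay))"
| "next_cmd r (Write J a # k) = (k, \<lambda>j. (if j \<in> J then a else r j, Stay))"
| "next_cmd r (Seq c d # k) = (c # d # k, idle r)"
| "next_cmd r (Cond t c d # k) = ((if t r then c else d) # k, idle r)"
| "next_cmd r (While t c # k) = (if t r then c # While t c # k else k, idle r)"

definition scan :: "nat \<Rightarrow> (nat \<Rightarrow> tape) \<Rightarrow> nat \<Rightarrow> nat" where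
  "scan m ts j = (if j < m then fst (ts j) (snd (ts j)) else 0)"

definition act_on :: "nat \<Rightarrow> (nat \<Rightarrow> nat \<times> move) \<Rightarrow> (nat \<Rightarrow> tape) \<Rightarrow> nat \<Rightarrow> tape" where
  "act_on m a ts = (\<lambda>j. if j < m then write_move (a j) (ts j) else ts j)"

definition stack_step :: "nat \<Rightarrow> cmd list \<times> (nat \<Rightarrow> tape) \<Rightarrow> cmd list \<times> (nat \<Rightarrow> tape)" where
  "stack_step m s =
     (let (k, a) = next_cmd (scan m (snd s)) (fst s) in (k, act_on m a (snd s)))"

text \<open>The number of steps is fixed before the continuation \<open>k\<close>, so a run can be
  put in front of any remaining stack; \<open>T\<close> is only an upper bound.\<close>

definition runs :: "nat \<Rightarrow> cmd \<Rightarrow> (nat \<Rightarrow> tape) \<Rightarrow> nat \<Rightarrow> (nat \<Rightarrow> tape) \<Rightarrow> bool" where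
  "runs m c ts T ts' \<longleftrightarrow> (\<exists>t\<le>T. \<forall>k. (stack_step m ^^ t) (c # k, ts) = (k, ts'))"

section \<open>Execution rules with time bounds\<close>

lemma act_on_idle [simp]: "act_on m (idle (scan m ts)) ts = ts"
  by (auto simp: act_on_def write_move_def scan_def fun_eq_iff prod_eq_iff)

lemma runs_mono: "runs m c ts T ts' \<Longrightarrow> T \<le> T' \<Longrightarrow> runs m c ts T' ts'"
  unfolding runs_def by (meson order_trans)

lemma runs_Move:
  "runs m (Move J d) ts 1
     (\<lambda>j. if j < m \<and> j \<in> J then (fst (ts j), snd (ts j) + head_shift d) else ts j)"
  unfolding runs_def
  by (rule exI[of _ 1])
    (auto simp: stack_step_def act_on_def write_move_def scan_def fun_eq_iff prod_eq_iff)

lemma runs_Write: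
  "runs m (Write J a) ts 1
     (\<lambda>j. if j < m \<and> j \<in> J then ((fst (ts j))(snd (ts j) := a), snd (ts j)) else ts j)"
  unfolding runs_def
  by (rule exI[of _ 1])
    (auto simp: stack_step_def act_on_def write_move_def scan_def fun_eq_iff prod_eq_iff)

lemma funpow_add_Suc: "(f ^^ Suc (t + u)) x = (f ^^ t) ((f ^^ u) (f x))"
  by (simp only: funpow_Suc_right funpow_add o_apply)

lemma runs_Seq:
  assumes "runs m c ts T1 ts1" "runs m d ts1 T2 ts2"
  shows "runs m (Seq c d) ts (T1 + T2 + 1) ts2"
proof -
  obtain t1 t2 where t: "t1 \<le> T1" "t2 \<le> T2"
    and c: "\<And>k. (stack_step m ^^ t1) (c # k, ts) = (k, ts1)"
    and d: "\<And>k. (stack_step m ^^ t2) (d # k, ts1) = (k, ts2)"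
    using assms unfolding runs_def by blast
  have "(stack_step m ^^ Suc (t2 + t1)) (Seq c d # k, ts) = (k, ts2)" for k
    by (simp only: funpow_add_Suc) (simp add: stack_step_def c d)
  then show ?thesis
    unfolding runs_def using t by (intro exI[of _ "Suc (t2 + t1)"]) auto
qed

lemma runs_first_step:
  assumes "\<And>k. stack_step m (c # k, ts) = (d # k, ts)" "runs m d ts T ts'"
  shows "runs m c ts (T + 1) ts'"
proof -
  obtain t where t: "t \<le> T" and d: "\<And>k. (stack_step m ^^ t) (d # k, ts) = (k, ts')"
    using assms(2) unfolding runs_def by blast
  have "(stack_step m ^^ Suc t) (c # k, ts) = (k, ts')" for k
    by (simp only: funpow_Suc_right o_apply assms(1) d)
  then show ?thesis
    unfolding runs_def using t by (intro exI[of _ "Suc t"]) auto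
qed

lemma runs_Cond:
  assumes "runs m (if t (scan m ts) then c else d) ts T ts'"
  shows "runs m (Cond t c d) ts (T + 1) ts'"
  using assms by (intro runs_first_step[OF _ assms]) (auto simp: stack_step_def)

lemma runs_While_False:
  assumes "\<not> t (scan m ts)"
  shows "runs m (While t c) ts 1 ts"
  unfolding runs_def using assms
  by (intro exI[of _ 1]) (auto simp: stack_step_def)

lemma runs_While_True:
  assumes "t (scan m ts)" "runs m c ts T1 ts1" "runs m (While t c) ts1 T2 ts2"
  shows "runs m (While t c) ts (T1 + T2 + 1) ts2"
proof -
  obtain t1 t2 where t: "t1 \<le> T1" "t2 \<le> T2"
    and c: "\<And>k. (stack_step m ^^ t1) (c # k, ts) = (k, ts1)"
    and d: "\<And>k. (stack_step m ^^ t2) (While t c # k, ts1) = (k, ts2)"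
    using assms unfolding runs_def by blast
  have "(stack_step m ^^ Suc (t2 + t1)) (While t c # k, ts) = (k, ts2)" for k
    by (simp only: funpow_add_Suc) (simp add: stack_step_def c d assms(1))
  then show ?thesis
    unfolding runs_def using t by (intro exI[of _ "Suc (t2 + t1)"]) auto
qed

section \<open>Finite control and compilation to a Turing machine\<close>

fun stacks :: "cmd \<Rightarrow> cmd list set" where
  "stacks (Move J d) = {[Move J d]}"
| "stacks (Write J a) = {[Write J a]}"
| "stacks (Seq c d) = insert [Seq c d] ((\<lambda>s. s @ [d]) ` stacks c \<union> stacks d)"
| "stacks (Cond t c d) = insert [Cond t c d] (stacks c \<union> stacks d)"
| "stacks (While t c) = insert [While t c] ((\<lambda>s. s @ [While t c]) ` stacks c)"

fun symbols_below :: "nat \<Rightarrow> cmd \<Rightarrow> bool" where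
  "symbols_below s (Move J d) = True"
| "symbols_below s (Write J a) = (a < s)"
| "symbols_below s (Seq c d) = (symbols_below s c \<and> symbols_below s d)"
| "symbols_below s (Cond t c d) = (symbols_below s c \<and> symbols_below s d)"
| "symbols_below s (While t c) = symbols_below s c"

lemma finite_stacks: "finite (stacks c)"
  by (induction c) auto

lemma singleton_in_stacks: "[c] \<in> stacks c"
  by (cases c) auto

lemma Nil_notin_stacks: "[] \<notin> stacks c"
  by (induction c) auto

lemma next_cmd_append:
  "s \<noteq> [] \<Longrightarrow> fst (next_cmd r (s @ k)) = fst (next_cmd r s) @ k"
  by (induction r s rule: next_cmd.induct) auto

text \<open>A step touches only the top of the stack, so it commutes with appending the commands
  below. When the first part of \<open>Seq c d\<close> is used up, what remains is
  \<open>[d]\<close>, a member of \<open>stacks d\<close>; a finished loop body likewise leaves the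
  loop alone.\<close>

lemma stacks_closed:
  "s \<in> stacks c \<Longrightarrow> fst (next_cmd r s) \<in> insert [] (stacks c)"
proof (induction c arbitrary: s)
  case (Seq c d)
  consider "s = [Seq c d]" | s' where "s = s' @ [d]" "s' \<in> stacks c" | "s \<in> stacks d"
    using Seq.prems by auto
  then show ?case
  proof cases
    case 1
    then show ?thesis using singleton_in_stacks[of c]
      by (auto intro!: image_eqI[of _ _ "[c]"])
  next
    case 2
    then have "s' \<noteq> []" using Nil_notin_stacks by auto
    then show ?thesis using Seq.IH(1)[OF 2(2)] singleton_in_stacks[of d] 2(1)
      by (auto simp: next_cmd_append)
  qed (use Seq.IH(2) in auto)
next
  case (Cond t c d)
  then show ?case using singleton_in_stacks[of c] singleton_in_stacks[of d] by auto
next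
  case (While t c)
  consider "s = [While t c]" | s' where "s = s' @ [While t c]" "s' \<in> stacks c"
    using While.prems by auto
  then show ?case
  proof cases
    case 1
    then show ?thesis using singleton_in_stacks[of c]
      by (auto intro!: image_eqI[of _ _ "[c]"])
  next
    case 2
    then have "s' \<noteq> []" using Nil_notin_stacks by auto
    then show ?thesis using While.IH[OF 2(2)] 2(1)
      by (auto simp: next_cmd_append)
  qed
qed auto

lemma stacks_symbols_below:
  "s \<in> stacks c \<Longrightarrow> symbols_below b c \<Longrightarrow> list_all (symbols_below b) s"
  by (induction c arbitrary: s) auto

lemma next_cmd_symbols_below:
  assumes "list_all (symbols_below b) s" "\<And>j. r j < b"
  shows "fst (snd (next_cmd r s) j) < b"
  using assms by (induction r s rule: next_cmd.induct) auto

text \<open>The offset reserves the states 0 and 1 for acceptance and rejection.\<close>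

definition state_of :: "cmd \<Rightarrow> cmd list \<Rightarrow> nat" where
  "state_of c s = 2 + to_nat_on (insert [] (stacks c)) s"

definition stack_of :: "cmd \<Rightarrow> nat \<Rightarrow> cmd list" where
  "stack_of c q = from_nat_into (insert [] (stacks c)) (q - 2)"

text \<open>Once the stack is empty, the symbol under the head of tape 1 is the verdict.\<close>

definition compile_tm :: "nat \<Rightarrow> nat \<Rightarrow> cmd \<Rightarrow> tm" where
  "compile_tm m b c =
     \<lparr> num_tapes = m, num_symbols = b, num_states = 2 + card (insert [] (stacks c)),
       start_state = state_of c [c], accept_state = 0, reject_state = 1,
       transition = (\<lambda>q r.
         if stack_of c q = [] then (if r 1 = 1 then 0 else 1, idle r)
         else (state_of c (fst (next_cmd r (stack_of c q))), snd (next_cmd r (stack_of c q)))) \<rparr>"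

lemma stack_of_state_of [simp]:
  "s \<in> insert [] (stacks c) \<Longrightarrow> stack_of c (state_of c s) = s"
  unfolding stack_of_def state_of_def
  using finite_stacks[of c] by (simp add: countable_finite)

lemma state_of_less:
  assumes "s \<in> insert [] (stacks c)"
  shows "state_of c s < 2 + card (insert [] (stacks c))"
proof -
  have "to_nat_on (insert [] (stacks c)) s < card (insert [] (stacks c))"
    using to_nat_on_finite[of "insert [] (stacks c)"] finite_stacks[of c] assms
    by (auto dest!: bij_betwE)
  then show ?thesis by (simp add: state_of_def)
qed

lemma stack_of_in: "stack_of c q \<in> insert [] (stacks c)"
  unfolding stack_of_def by (rule from_nat_into) auto

lemma wf_compile_tm:
  assumes "m \<ge> 1" "b \<ge> 4" "symbols_below b c"
  shows "wf_tm (compile_tm m b c)"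
proof -
  have "fst (next_cmd r (stack_of c q)) \<in> insert [] (stacks c)" for r q
    using stack_of_in[of c q] stacks_closed[of "stack_of c q" c r] by auto
  moreover have "list_all (symbols_below b) (stack_of c q)" for q
    using stack_of_in[of c q] stacks_symbols_below[of "stack_of c q" c b] assms by auto
  moreover have "[c] \<in> insert [] (stacks c)"
    using singleton_in_stacks by auto
  ultimately show ?thesis
    using assms finite_stacks[of c]
    by (auto simp: wf_tm_def compile_tm_def state_of_less[simplified] next_cmd_symbols_below)
qed

text \<open>Unlike the stack machine, the Turing machine takes one more step after the empty stack.\<close>

definition simulates :: "nat \<Rightarrow> cmd \<Rightarrow> cmd list \<times> (nat \<Rightarrow> tape) \<Rightarrow> config \<Rightarrow> bool" where
  "simulates m c s cf \<longleftrightarrow> snd cf = snd s \<and> fst s \<in> insert [] (stacks c) \<and>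
     (fst cf = state_of c (fst s) \<or>
      fst s = [] \<and> fst cf = (if scan m (snd s) 1 = 1 then 0 else 1))"

lemma compile_tm_simps [simp]:
  "num_tapes (compile_tm m b c) = m"
  "accept_state (compile_tm m b c) = 0"
  "reject_state (compile_tm m b c) = 1"
  by (simp_all add: compile_tm_def)

lemma scanned_compile_tm: "scanned (compile_tm m b c) = scan m"
  by (auto simp: fun_eq_iff scanned_def scan_def)

lemma halted_compile_tm: "halted (compile_tm m b c) cf \<longleftrightarrow> fst cf < 2"
  by (auto simp: halted_def)

lemma transition_compile_tm:
  "transition (compile_tm m b c) q r =
     (if stack_of c q = [] then (if r 1 = 1 then 0 else 1, idle r)
      else (state_of c (fst (next_cmd r (stack_of c q))), snd (next_cmd r (stack_of c q))))"
  by (simp add: compile_tm_def)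

lemma tm_step_compile_tm:
  "tm_step (compile_tm m b c) (state_of c s, ts) =
     (let (q, a) = transition (compile_tm m b c) (state_of c s) (scan m ts) in (q, act_on m a ts))"
proof -
  have "\<not> halted (compile_tm m b c) (state_of c s, ts)"
    by (simp add: halted_compile_tm state_of_def)
  then show ?thesis
    by (simp add: tm_step_def scanned_compile_tm act_on_def cong: if_cong split: prod.splits)
qed

text \<open>The stack machine idles forever on the empty stack. This matches both the deciding step
  of the Turing machine and every step after it has halted.\<close>

lemma simulates_step:
  assumes "simulates m c s cf"
  shows "simulates m c (stack_step m s) (tm_step (compile_tm m b c) cf)"
proof -
  obtain k ts where s: "s = (k, ts)" by (cases s)
  obtain q where cf: "cf = (q, ts)" using assms by (cases cf) (simp add: simulates_def s)
  have k: "k \<in> insert [] (stacks c)" using assms by (simp add: simulates_def s)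
  show ?thesis
  proof (cases "q = state_of c k")
    case True
    show ?thesis
    proof (cases "k = []")
      case True
      then show ?thesis using \<open>q = state_of c k\<close>
        by (auto simp: cf s tm_step_compile_tm simulates_def stack_step_def transition_compile_tm)
    next
      case False
      then show ?thesis using \<open>q = state_of c k\<close> k stacks_closed[of k c "scan m ts"]
        by (auto simp: cf s tm_step_compile_tm simulates_def stack_step_def transition_compile_tm
            split: prod.splits)
    qed
  next
    case False
    then have "k = []" "q = (if scan m ts 1 = 1 then 0 else 1)"
      using assms by (auto simp: simulates_def s cf)
    moreover from this have "tm_step (compile_tm m b c) cf = cf"
      by (auto simp: tm_step_def halted_compile_tm cf)
    ultimately show ?thesis
      by (auto simp: cf s simulates_def stack_step_def)
  qed
qed

lemma tm_run_halted:
  assumes "halted M (tm_run M w t)" "t \<le> t'"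
  shows "tm_run M w t' = tm_run M w t"
proof -
  have "(tm_step M ^^ d) cf = cf" if "halted M cf" for d cf
    using that by (induction d) (auto simp: tm_step_def)
  moreover have "tm_run M w t' = (tm_step M ^^ (t' - t)) (tm_run M w t)"
    using assms(2) by (metis (no_types, lifting) funpow_add le_add_diff_inverse2 o_apply tm_run_def)
  ultimately show ?thesis using assms(1) by simp
qed

lemma compile_tm_run:
  fixes m b :: nat and c :: cmd and w :: "nat list"
  defines "M \<equiv> compile_tm m b c"
  defines "ts \<equiv> \<lambda>j. if j = 0 then word_tape w else word_tape []"
  assumes "runs m c ts T ts'"
  shows "halts_within M w (T + 1)" "accepts M w \<longleftrightarrow> scan m ts' 1 = 1"
proof -
  obtain t where t: "t \<le> T" "(stack_step m ^^ t) ([c], ts) = ([], ts')"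
    using assms(3) unfolding runs_def by blast
  have "simulates m c ((stack_step m ^^ t) ([c], ts)) (tm_run M w t)" for t
  proof (induction t)
    case 0
    then show ?case using singleton_in_stacks[of c]
      by (auto simp: simulates_def tm_run_def initial_config_def M_def ts_def compile_tm_def)
  next
    case (Suc t)
    then show ?case by (auto simp: tm_run_def M_def simulates_step)
  qed
  note sim = this
  have "simulates m c ([], ts') (tm_run M w t)" using sim[of t] t by simp
  \<comment> \<open>The stack may have become empty before step \<open>t\<close>. So at
    \<open>t\<close> the machine is either about to decide or has halted already, and at
    \<open>Suc t\<close> the verdict is there in both cases.\<close>
  then have "tm_run M w (Suc t) = (if scan m ts' 1 = 1 then 0 else 1, ts')"
  proof (cases "fst (tm_run M w t) = state_of c []")
    case True
    then have "tm_run M w t = (state_of c [], ts')"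
      using \<open>simulates m c ([], ts') (tm_run M w t)\<close> by (simp add: simulates_def prod_eq_iff)
    then have "tm_run M w (Suc t) = tm_step M (state_of c [], ts')"
      by (simp add: tm_run_def)
    then show ?thesis by (simp add: M_def tm_step_compile_tm transition_compile_tm)
  next
    case False
    then have q: "tm_run M w t = (if scan m ts' 1 = 1 then 0 else 1, ts')"
      using \<open>simulates m c ([], ts') (tm_run M w t)\<close> by (simp add: simulates_def prod_eq_iff)
    then have "halted M (tm_run M w t)" by (simp add: M_def halted_compile_tm)
    then show ?thesis using q tm_run_halted[of M w t "Suc t"] by simp
  qed
  note final = this
  have h: "halted M (tm_run M w (Suc t))" unfolding final by (simp add: M_def halted_compile_tm)
  from tm_run_halted[OF h, of "T + 1"] h t show "halts_within M w (T + 1)"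
    by (simp add: halts_within_def)
  \<comment> \<open>Acceptance allows any number of steps, but a halted configuration never changes,
    so the state at \<open>Suc t\<close> tells.\<close>
  have "fst (tm_run M w (Suc t)) = accept_state M" if "fst (tm_run M w t') = accept_state M" for t'
  proof -
    have "halted M (tm_run M w t')" using that by (simp add: halted_def)
    then show ?thesis
      using tm_run_halted[OF h, of t'] tm_run_halted[of M w t' "Suc t"] that
      by (cases "t' \<le> Suc t") auto
  qed
  then have "accepts M w \<longleftrightarrow> fst (tm_run M w (Suc t)) = accept_state M"
    unfolding accepts_def by blast
  also have "\<dots> \<longleftrightarrow> scan m ts' 1 = 1"
    by (simp only: final) (simp add: M_def)
  finally show "accepts M w \<longleftrightarrow> scan m ts' 1 = 1" .
qed

lemma runs_Seq_le:
  "runs m c ts T1 ts1 \<Longrightarrow> runs m d ts1 T2 ts2 \<Longrightarrow> T1 + T2 + 1 \<le> T \<Longrightarrow>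
    runs m (Seq c d) ts T ts2"
  by (rule runs_mono[OF runs_Seq])

lemma runs_Cond_le:
  "runs m (if t (scan m ts) then c else d) ts T1 ts' \<Longrightarrow> T1 + 1 \<le> T \<Longrightarrow> runs m (Cond t c d) ts T ts'"
  by (rule runs_mono[OF runs_Cond])

lemma runs_While_stop:
  "\<not> t (scan m ts) \<Longrightarrow> 1 \<le> T \<Longrightarrow> runs m (While t c) ts T ts"
  by (rule runs_mono[OF runs_While_False])

lemma runs_While_step:
  "t (scan m ts) \<Longrightarrow> runs m c ts T1 ts1 \<Longrightarrow> runs m (While t c) ts1 T2 ts2 \<Longrightarrow> T1 + T2 + 1 \<le> T \<Longrightarrow>
    runs m (While t c) ts T ts2"
  by (rule runs_mono[OF runs_While_True])

section \<open>Model checking first-order formulas\<close>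

text \<open>
  Variables are de Bruijn levels: a quantifier below \<open>d\<close> quantifiers binds the variable \<open>d\<close>. The atom
  \<open>Sym r i j a\<close> reads the entry \<open>(i, j)\<close> of the \<open>r\<close>-th matrix. Matrix 0 is the one of the input. Since
  the cell between input and certificate belongs to the entry \<open>(0, 0)\<close> of matrix 1, that entry can
  only be the separator 3.
\<close>

datatype fm =
    Sym nat nat nat nat
  | Eq nat nat
  | Neg fm
  | Conj fm fm
  | Exists fm

text \<open>The default 0 agrees with the machine, where the counter of a variable rests at 0 while
  the variable is unbound.\<close>

definition val :: "nat list \<Rightarrow> nat \<Rightarrow> nat" where
  "val xs i = (if i < length xs then xs ! i else 0)"

text \<open>For values \<open>u\<close> and \<open>v\<close> of the variables the position is
  \<open>n + 1 + r * n * n + u * n + v\<close>: the matrices of \<open>n * n\<close> cells follow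
  one another behind \<open>n\<close> ones and the zero bit.\<close>

fun sat :: "nat \<Rightarrow> (nat \<Rightarrow> nat) \<Rightarrow> fm \<Rightarrow> nat list \<Rightarrow> bool" where
  "sat n w (Sym r i j a) xs \<longleftrightarrow> w ((r * n + 1 + val xs i) * n + val xs j + 1) = a"
| "sat n w (Eq i j) xs \<longleftrightarrow> val xs i = val xs j"
| "sat n w (Neg \<phi>) xs \<longleftrightarrow> \<not> sat n w \<phi> xs"
| "sat n w (Conj \<phi> \<psi>) xs \<longleftrightarrow> sat n w \<phi> xs \<and> sat n w \<psi> xs"
| "sat n w (Exists \<phi>) xs \<longleftrightarrow> (\<exists>v<n. sat n w \<phi> (xs @ [v]))"

lemma sat_cong:
  assumes "\<And>p. p > 0 \<Longrightarrow> w p = w' p"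
  shows "sat n w \<phi> xs \<longleftrightarrow> sat n w' \<phi> xs"
  using assms by (induction \<phi> arbitrary: xs) auto

section \<open>Programs for the evaluation of formulas\<close>

text \<open>Performs \<open>c\<close> as often as the counter \<open>u\<close> says. The passes are
  counted on \<open>a\<close>, from which the second loop restores \<open>u\<close>.\<close>

definition loop :: "nat \<Rightarrow> nat \<Rightarrow> cmd \<Rightarrow> cmd" where
  "loop u a c =
     Seq (While (\<lambda>r. r u \<noteq> 1) (Seq (Move {u} MoveLeft) (Seq (Move {a} MoveRight) c)))
         (While (\<lambda>r. r a \<noteq> 1) (Seq (Move {a} MoveLeft) (Move {u} MoveRight)))"

definition right_n :: cmd where
  "right_n = loop 2 4 (Move {0} MoveRight)"

text \<open>The scratch counter 4 is occupied by the inner loop, hence 5 for the outer one.\<close>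

definition right_nn :: cmd where
  "right_nn = loop 3 5 right_n"

fun repeat :: "nat \<Rightarrow> cmd \<Rightarrow> cmd" where
  "repeat 0 c = Skip"
| "repeat (Suc r) c = Seq c (repeat r c)"

definition set_flag :: "((nat \<Rightarrow> nat) \<Rightarrow> bool) \<Rightarrow> cmd" where
  "set_flag t = Cond t (Write {1} 1) (Write {1} 0)"

text \<open>For \<open>Sym\<close>, the input head walks to the cell by counted loops and returns to
  the marker 4. For \<open>Eq\<close>, both counters are lowered together until one reaches 0; the
  values agree if and only if both are 0 then. For \<open>Exists\<close>, the counter stops at the
  first witness or at the mark at \<open>n\<close>. Every case brings all heads back.\<close>

fun eval_cmd :: "fm \<Rightarrow> nat \<Rightarrow> cmd" where
  "eval_cmd (Sym r i j a) d =
     Seq (Move {0} MoveRight) (Seq (repeat r right_nn) (Seq right_n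
       (Seq (loop (6 + i) 5 right_n) (Seq (loop (6 + j) 4 (Move {0} MoveRight))
       (Seq (set_flag (\<lambda>r. r 0 = a)) (While (\<lambda>r. r 0 \<noteq> 4) (Move {0} MoveLeft)))))))"
| "eval_cmd (Eq i j) d =
     Seq (While (\<lambda>r. r (6 + i) \<noteq> 1 \<and> r (6 + j) \<noteq> 1)
            (Seq (Move {6 + i, 6 + j} MoveLeft) (Move {4} MoveRight)))
       (Seq (set_flag (\<lambda>r. r (6 + i) = 1 \<and> r (6 + j) = 1))
            (While (\<lambda>r. r 4 \<noteq> 1) (Seq (Move {4} MoveLeft) (Move {6 + i, 6 + j} MoveRight))))"
| "eval_cmd (Neg \<phi>) d = Seq (eval_cmd \<phi> d) (set_flag (\<lambda>r. r 1 \<noteq> 1))"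
| "eval_cmd (Conj \<phi> \<psi>) d = Seq (eval_cmd \<phi> d) (Cond (\<lambda>r. r 1 = 1) (eval_cmd \<psi> d) Skip)"
| "eval_cmd (Exists \<phi>) d =
     Seq (Write {1} 0)
       (Seq (While (\<lambda>r. r 1 \<noteq> 1 \<and> r (6 + d) \<noteq> 2)
               (Seq (eval_cmd \<phi> (Suc d)) (Cond (\<lambda>r. r 1 = 1) Skip (Move {6 + d} MoveRight))))
            (While (\<lambda>r. r (6 + d) \<noteq> 1) (Move {6 + d} MoveLeft)))"

fun fits :: "nat \<Rightarrow> nat \<Rightarrow> fm \<Rightarrow> bool" where
  "fits m d (Sym r i j a) \<longleftrightarrow> 6 + i < m \<and> 6 + j < m"
| "fits m d (Eq i j) \<longleftrightarrow> 6 + i < m \<and> 6 + j < m"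
| "fits m d (Neg \<phi>) \<longleftrightarrow> fits m d \<phi>"
| "fits m d (Conj \<phi> \<psi>) \<longleftrightarrow> fits m d \<phi> \<and> fits m d \<psi>"
| "fits m d (Exists \<phi>) \<longleftrightarrow> 6 + d < m \<and> fits m (Suc d) \<phi>"

lemma fits_mono: "fits m d \<phi> \<Longrightarrow> m \<le> m' \<Longrightarrow> fits m' d \<phi>"
  by (induction \<phi> arbitrary: d) auto

lemma ex_fits: "\<exists>m\<ge>6. fits m d \<phi>"
proof (induction \<phi> arbitrary: d)
  case (Sym r i j a)
  show ?case by (rule exI[of _ "7 + i + j"]) auto
next
  case (Eq i j)
  show ?case by (rule exI[of _ "7 + i + j"]) auto
next
  case (Conj \<phi> \<psi>)
  obtain m1 m2 where "m1 \<ge> 6" "fits m1 d \<phi>" "fits m2 d \<psi>" using Conj by metis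
  then show ?case by (intro exI[of _ "max m1 m2"]) (auto intro: fits_mono)
next
  case (Exists \<phi>)
  obtain m where "fits m (Suc d) \<phi>" using Exists by metis
  then show ?case by (intro exI[of _ "max m (7 + d)"]) (auto intro: fits_mono)
qed auto

text \<open>The constants are generous. What matters is that a quantifier multiplies the time by
  about \<open>n\<close>, so that a fixed formula has a polynomial bound.\<close>

fun eval_time :: "fm \<Rightarrow> nat \<Rightarrow> nat" where
  "eval_time (Sym r i j a) n =
     (r + 5) * (n * (n * 50 + 50) + 50) + 2 * ((r * n + 1 + n) * n + n + 1)"
| "eval_time (Eq i j) n = n * 20 + 20"
| "eval_time (Neg \<phi>) n = eval_time \<phi> n + 5"
| "eval_time (Conj \<phi> \<psi>) n = eval_time \<phi> n + eval_time \<psi> n + 5"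
| "eval_time (Exists \<phi>) n = n * (eval_time \<phi> n + 10) + 20"

text \<open>The value \<open>n\<close> reaches the counters without arithmetic: all heads move right
  in step until the input head leaves the unary prefix at \<open>n\<close>, the mark 2 is written
  there, and all heads but those of tapes 2 and 3 move back in step. Symbol 4 marks the left end of
  the input.\<close>

definition setup_cmd :: cmd where
  "setup_cmd =
     Seq (Write {0} 4) (Seq (Write (- {0}) 1) (Seq (Move UNIV MoveRight)
       (Seq (While (\<lambda>r. r 0 = 2) (Move UNIV MoveRight))
       (Seq (Write (- {0}) 2) (While (\<lambda>r. r 0 \<noteq> 4) (Move (- {2, 3}) MoveLeft))))))"

text \<open>Without a leading one bit \<open>n\<close> is 0. Nothing is done then, and the blank
  left on tape 1 means rejection.\<close>

definition verify_cmd :: "fm \<Rightarrow> cmd" where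
  "verify_cmd \<phi> = Cond (\<lambda>r. r 0 = 2) (Seq setup_cmd (eval_cmd \<phi> 0)) Skip"

section \<open>Polynomial bounds\<close>

definition poly_bounded :: "(nat \<Rightarrow> nat) \<Rightarrow> bool" where
  "poly_bounded f \<longleftrightarrow> (\<exists>p :: nat poly. \<forall>n. f n \<le> poly p n)"

lemma poly_bounded_const: "poly_bounded (\<lambda>n. c)"
  unfolding poly_bounded_def by (rule exI[of _ "[:c:]"]) simp

lemma poly_bounded_id: "poly_bounded (\<lambda>n. n)"
  unfolding poly_bounded_def by (rule exI[of _ "[:0, 1:]"]) simp

lemma poly_bounded_add:
  assumes "poly_bounded f" "poly_bounded g" shows "poly_bounded (\<lambda>n. f n + g n)"
proof -
  obtain p q where "\<forall>n. f n \<le> poly p n" "\<forall>n. g n \<le> poly q n"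
    using assms unfolding poly_bounded_def by blast
  then have "\<forall>n. f n + g n \<le> poly (p + q) n" by (simp add: add_mono)
  then show ?thesis unfolding poly_bounded_def by blast
qed

lemma poly_bounded_mult:
  assumes "poly_bounded f" "poly_bounded g" shows "poly_bounded (\<lambda>n. f n * g n)"
proof -
  obtain p q where "\<forall>n. f n \<le> poly p n" "\<forall>n. g n \<le> poly q n"
    using assms unfolding poly_bounded_def by blast
  then have "\<forall>n. f n * g n \<le> poly (p * q) n" by (simp add: mult_mono)
  then show ?thesis unfolding poly_bounded_def by blast
qed

lemmas poly_bounded_intros =
  poly_bounded_const poly_bounded_id poly_bounded_add poly_bounded_mult

lemma poly_bounded_eval_time: "poly_bounded (eval_time \<phi>)"
  by (induction \<phi>) (unfold eval_time.simps, (intro poly_bounded_intros; assumption)+)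

lemma poly_nat_mono: "a \<le> b \<Longrightarrow> poly (p :: nat poly) a \<le> poly p b"
  by (induction p) (auto intro: add_mono mult_mono)

lemma symbols_below_repeat: "symbols_below s c \<Longrightarrow> symbols_below s (repeat r c)"
  by (induction r) auto

lemma symbols_below_eval_cmd: "symbols_below 5 (eval_cmd \<phi> d)"
  by (induction \<phi> arbitrary: d)
    (auto simp: symbols_below_repeat right_n_def right_nn_def loop_def set_flag_def)

lemma symbols_below_verify_cmd: "symbols_below 5 (verify_cmd \<phi>)"
  by (simp add: verify_cmd_def setup_cmd_def symbols_below_eval_cmd)

text \<open>
  Tape 0 holds the input and tape 1 the truth value of the last formula. All other heads are counters
  between 0 and \<open>n\<close>, on tapes with a mark 1 at position 0 and a mark 2 at position \<open>n\<close>. Tapes 2 and 3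
  rest at \<open>n\<close> and serve as the constant \<open>n\<close>, tapes 4 and 5 are scratch counters that rest at 0, and
  tape \<open>6 + i\<close> holds the variable \<open>i\<close>.
\<close>

locale evaluator =
  fixes m n :: nat and w :: "nat \<Rightarrow> nat"
  assumes m_ge: "6 \<le> m" and n_pos: "0 < n" and w_0: "w 0 = 4" and w_neq: "p > 0 \<Longrightarrow> w p \<noteq> 4"
begin

section \<open>Tape contents and counters\<close>

definition content :: "nat \<Rightarrow> nat \<Rightarrow> int \<Rightarrow> nat" where
  "content b j p =
     (if j = 0 then if p < 0 then 0 else w (nat p)
      else if j = 1 \<and> p = 0 then b
      else if p = int n then 2 else if p = 0 then 1 else 0)"

text \<open>After the setup only the flag and the head positions change, so \<open>b\<close> and
  \<open>h\<close> determine all tapes.\<close>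

definition tapes :: "nat \<Rightarrow> (nat \<Rightarrow> nat) \<Rightarrow> nat \<Rightarrow> tape" where
  "tapes b h j = (if j < m then (content b j, int (h j)) else word_tape [])"

lemma scan_0: "scan m (tapes b h) 0 = w (h 0)"
  using m_ge by (simp add: scan_def tapes_def content_def)

lemma scan_0_eq_4: "scan m (tapes b h) 0 = 4 \<longleftrightarrow> h 0 = 0"
  unfolding scan_0 using w_0 w_neq by (cases "h 0") auto

lemma scan_flag: "h 1 = 0 \<Longrightarrow> scan m (tapes b h) 1 = b"
  "h 1 = 0 \<Longrightarrow> scan m (tapes b h) (Suc 0) = b"
  using m_ge by (simp_all add: scan_def tapes_def content_def)

lemma scan_eq_1: "2 \<le> j \<Longrightarrow> j < m \<Longrightarrow> scan m (tapes b h) j = 1 \<longleftrightarrow> h j = 0"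
  "2 \<le> j \<Longrightarrow> j < m \<Longrightarrow> scan m (tapes b h) j = Suc 0 \<longleftrightarrow> h j = 0"
  using n_pos by (auto simp: scan_def tapes_def content_def)

lemma scan_eq_2: "2 \<le> j \<Longrightarrow> j < m \<Longrightarrow> scan m (tapes b h) j = 2 \<longleftrightarrow> h j = n"
  by (auto simp: scan_def tapes_def content_def)

lemma runs_right:
  "runs m (Move J MoveRight) (tapes b h) 1 (tapes b (\<lambda>j. if j \<in> J then h j + 1 else h j))"
proof -
  have "(\<lambda>j. if j < m \<and> j \<in> J then (fst (tapes b h j), snd (tapes b h j) + head_shift MoveRight)
         else tapes b h j) = tapes b (\<lambda>j. if j \<in> J then h j + 1 else h j)"
    by (auto simp: tapes_def fun_eq_iff)
  then show ?thesis using runs_Move[of m J MoveRight "tapes b h"] by simp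
qed

lemma runs_left:
  assumes "\<And>j. j \<in> J \<Longrightarrow> j < m \<Longrightarrow> 0 < h j"
  shows "runs m (Move J MoveLeft) (tapes b h) 1 (tapes b (\<lambda>j. if j \<in> J then h j - 1 else h j))"
proof -
  have "(\<lambda>j. if j < m \<and> j \<in> J then (fst (tapes b h j), snd (tapes b h j) + head_shift MoveLeft)
         else tapes b h j) = tapes b (\<lambda>j. if j \<in> J then h j - 1 else h j)"
    using assms by (fastforce simp: tapes_def fun_eq_iff)
  then show ?thesis using runs_Move[of m J MoveLeft "tapes b h"] by simp
qed

lemma runs_right1: "runs m (Move {u} MoveRight) (tapes b h) 1 (tapes b (h(u := h u + 1)))"
proof -
  have "(\<lambda>j. if j \<in> {u} then h j + 1 else h j) = h(u := h u + 1)" by auto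
  then show ?thesis using runs_right[of "{u}" b h] by (simp only:)
qed

lemma runs_left1:
  assumes "0 < h u"
  shows "runs m (Move {u} MoveLeft) (tapes b h) 1 (tapes b (h(u := h u - 1)))"
proof -
  have "(\<lambda>j. if j \<in> {u} then h j - 1 else h j) = h(u := h u - 1)" by auto
  then show ?thesis using runs_left[of "{u}" h b] assms by simp
qed

lemma runs_Skip: "runs m Skip (tapes b h) 1 (tapes b h)"
  using runs_Move[of m "{}" Stay "tapes b h"] by simp

lemma runs_write_flag: "h 1 = 0 \<Longrightarrow> runs m (Write {1} a) (tapes b h) 1 (tapes a h)"
proof -
  assume "h 1 = 0"
  then have "(\<lambda>j. if j < m \<and> j \<in> {1} then ((fst (tapes b h j))(snd (tapes b h j) := a), snd (tapes b h j))
         else tapes b h j) = tapes a h"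
    by (auto simp: tapes_def content_def fun_eq_iff)
  then show ?thesis using runs_Write[of m "{1}" a "tapes b h"] by simp
qed

lemma runs_set_flag:
  assumes "h 1 = 0"
  shows "runs m (set_flag t) (tapes b h) 2 (tapes (of_bool (t (scan m (tapes b h)))) h)"
  unfolding set_flag_def
  by (rule runs_Cond_le[where ?T1.0 = 1]) (use runs_write_flag[of h _ b] assms in auto)

text \<open>\<open>Q\<close> collects what \<open>c\<close> requires of the heads. It must be
  insensitive to \<open>u\<close>, \<open>a\<close> and the input head, which the loop itself
  moves.\<close>

lemma runs_loop_down:
  assumes u: "2 \<le> u" "u < m" and "u \<noteq> a" "a \<noteq> 0"
    and c: "\<And>h. Q h \<Longrightarrow> runs m c (tapes b h) T (tapes b (h(0 := h 0 + K)))"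
    and Q: "\<And>h x y z. Q h \<Longrightarrow> Q (h(u := x, a := y, 0 := z))"
  shows "Q h \<Longrightarrow>
    runs m (While (\<lambda>r. r u \<noteq> 1) (Seq (Move {u} MoveLeft) (Seq (Move {a} MoveRight) c)))
      (tapes b h) (h u * (T + 5) + 1) (tapes b (h(u := 0, a := h a + h u, 0 := h 0 + h u * K)))"
proof (induction "h u" arbitrary: h)
  case 0
  then have eq: "h(u := 0, a := h a + h u, 0 := h 0 + h u * K) = h" by auto
  show ?case
    unfolding eq using 0 u by (intro runs_While_stop) (auto simp: scan_eq_1)
next
  case (Suc k)
  let ?h1 = "h(u := h u - 1)" and ?h2 = "h(u := h u - 1, a := h a + 1)"
  let ?h3 = "h(u := h u - 1, a := h a + 1, 0 := h 0 + K)"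
  have "?h2 = h(u := h u - 1, a := h a + 1, 0 := h 0)" using assms by (auto simp: fun_eq_iff)
  then have "Q ?h2" using Q[OF Suc.prems] by metis
  then have "runs m c (tapes b ?h2) T (tapes b ?h3)"
    using c[of ?h2] assms by simp
  moreover have "runs m (Move {u} MoveLeft) (tapes b h) 1 (tapes b ?h1)"
    using Suc.hyps by (intro runs_left1) simp
  moreover have "runs m (Move {a} MoveRight) (tapes b ?h1) 1 (tapes b ?h2)"
    using runs_right1[of a b ?h1] assms by simp
  ultimately have body: "runs m (Seq (Move {u} MoveLeft) (Seq (Move {a} MoveRight) c))
      (tapes b h) (1 + (1 + T + 1) + 1) (tapes b ?h3)"
    by (blast intro: runs_Seq)
  have k: "k = ?h3 u" using Suc.hyps(2)[symmetric] assms by simp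
  have eq: "?h3(u := 0, a := ?h3 a + ?h3 u, 0 := ?h3 0 + ?h3 u * K) =
      h(u := 0, a := h a + h u, 0 := h 0 + h u * K)"
    using assms Suc.hyps(2)[symmetric] by (auto simp: fun_eq_iff)
  have "runs m (While (\<lambda>r. r u \<noteq> 1) (Seq (Move {u} MoveLeft) (Seq (Move {a} MoveRight) c)))
      (tapes b ?h3) (k * (T + 5) + 1) (tapes b (h(u := 0, a := h a + h u, 0 := h 0 + h u * K)))"
    using Suc.hyps(1)[OF k Q[OF Suc.prems]] unfolding eq unfolding k[symmetric] .
  moreover have "scan m (tapes b h) u \<noteq> 1" using u Suc.hyps(2) scan_eq_1[of u b h] by simp
  ultimately show ?case
    using Suc.hyps(2)[symmetric] by (intro runs_While_step[OF _ body]) auto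
qed

lemma runs_loop_up:
  assumes a: "2 \<le> a" "a < m" and "u \<noteq> a"
  shows "runs m (While (\<lambda>r. r a \<noteq> 1) (Seq (Move {a} MoveLeft) (Move {u} MoveRight)))
      (tapes b h) (h a * 5 + 1) (tapes b (h(a := 0, u := h u + h a)))"
proof (induction "h a" arbitrary: h)
  case 0
  then have eq: "h(a := 0, u := h u + h a) = h" by auto
  show ?case
    unfolding eq using 0 a by (intro runs_While_stop) (auto simp: scan_eq_1)
next
  case (Suc k)
  let ?h1 = "h(a := h a - 1)" and ?h2 = "h(a := h a - 1, u := h u + 1)"
  have "runs m (Move {a} MoveLeft) (tapes b h) 1 (tapes b ?h1)"
    using Suc.hyps by (intro runs_left1) simp
  moreover have "runs m (Move {u} MoveRight) (tapes b ?h1) 1 (tapes b ?h2)"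
    using runs_right1[of u b ?h1] assms by simp
  ultimately have body: "runs m (Seq (Move {a} MoveLeft) (Move {u} MoveRight))
      (tapes b h) (1 + 1 + 1) (tapes b ?h2)"
    by (blast intro: runs_Seq)
  have "runs m (While (\<lambda>r. r a \<noteq> 1) (Seq (Move {a} MoveLeft) (Move {u} MoveRight)))
      (tapes b ?h2) (k * 5 + 1) (tapes b (h(a := 0, u := h u + h a)))"
    using Suc.hyps(1)[of ?h2] assms Suc.hyps(2)[symmetric]
    by (simp add: fun_upd_twist)
  moreover have "scan m (tapes b h) a \<noteq> 1" using a Suc.hyps(2) scan_eq_1[of a b h] by simp
  ultimately show ?case
    using Suc.hyps(2)[symmetric] by (intro runs_While_step[OF _ body]) auto
qed

lemma runs_loop:
  assumes "2 \<le> u" "u < m" "2 \<le> a" "a < m" "u \<noteq> a"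
    and c: "\<And>h. Q h \<Longrightarrow> runs m c (tapes b h) T (tapes b (h(0 := h 0 + K)))"
    and Q: "\<And>h x y z. Q h \<Longrightarrow> Q (h(u := x, a := y, 0 := z))"
    and h: "Q h" "h a = 0" "h u \<le> n"
  shows "runs m (loop u a c) (tapes b h) (n * (T + 20) + 20) (tapes b (h(0 := h 0 + h u * K)))"
proof -
  let ?h = "h(u := 0, a := h u, 0 := h 0 + h u * K)"
  have "runs m (While (\<lambda>r. r u \<noteq> 1) (Seq (Move {u} MoveLeft) (Seq (Move {a} MoveRight) c)))
      (tapes b h) (h u * (T + 5) + 1) (tapes b ?h)"
    using runs_loop_down[of u a Q c b T K h] h assms c Q by simp
  moreover have "runs m (While (\<lambda>r. r a \<noteq> 1) (Seq (Move {a} MoveLeft) (Move {u} MoveRight)))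
      (tapes b ?h) (h u * 5 + 1) (tapes b (h(0 := h 0 + h u * K)))"
  proof -
    have "?h(a := 0, u := ?h u + ?h a) = h(0 := h 0 + h u * K)"
      using assms by (auto simp: fun_eq_iff)
    then show ?thesis
      using runs_loop_up[OF assms(3,4,5), of b ?h] assms(1,3) by simp
  qed
  ultimately have "runs m (loop u a c) (tapes b h)
      ((h u * (T + 5) + 1) + (h u * 5 + 1) + 1) (tapes b (h(0 := h 0 + h u * K)))"
    unfolding loop_def by (rule runs_Seq)
  moreover have "(h u * (T + 5) + 1) + (h u * 5 + 1) + 1 \<le> n * (T + 20) + 20"
  proof -
    have "h u * (T + 10) \<le> n * (T + 10)" using h by simp
    then show ?thesis by (simp add: algebra_simps)
  qed
  ultimately show ?thesis by (rule runs_mono)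
qed

lemma runs_right_n:
  assumes "h 2 = n" "h 4 = 0"
  shows "runs m right_n (tapes b h) (n * 21 + 20) (tapes b (h(0 := h 0 + n)))"
  using runs_loop[of 2 4 "\<lambda>_. True" "Move {0} MoveRight" b 1 1 h] runs_right1 assms m_ge
  unfolding right_n_def by simp

lemma runs_right_nn:
  assumes "h 2 = n" "h 3 = n" "h 4 = 0" "h 5 = 0"
  shows "runs m right_nn (tapes b h) (n * (40 + n * 21) + 20) (tapes b (h(0 := h 0 + n * n)))"
  using runs_loop[of 3 5 "\<lambda>h. h 2 = n \<and> h 4 = 0" right_n b "n * 21 + 20" n h] runs_right_n assms m_ge
  unfolding right_nn_def by simp

lemma runs_repeat_right_nn:
  assumes "h 2 = n" "h 3 = n" "h 4 = 0" "h 5 = 0"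
  shows "runs m (repeat r right_nn) (tapes b h) (r * (n * (40 + n * 21) + 21) + 1)
    (tapes b (h(0 := h 0 + r * (n * n))))"
  using assms
proof (induction r arbitrary: h)
  case 0
  then show ?case using runs_Skip by simp
next
  case (Suc r)
  let ?h = "h(0 := h 0 + n * n)"
  have eq: "?h(0 := ?h 0 + r * (n * n)) = h(0 := h 0 + Suc r * (n * n))"
    by (simp add: add.assoc)
  have "runs m (repeat r right_nn) (tapes b ?h) (r * (n * (40 + n * 21) + 21) + 1)
      (tapes b (h(0 := h 0 + Suc r * (n * n))))"
    by (rule Suc.IH[of ?h, unfolded eq]) (use Suc.prems in simp_all)
  from runs_Seq[OF runs_right_nn[OF Suc.prems] this]
  have "runs m (repeat (Suc r) right_nn) (tapes b h)
      ((n * (40 + n * 21) + 20) + (r * (n * (40 + n * 21) + 21) + 1) + 1)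
      (tapes b (h(0 := h 0 + Suc r * (n * n))))"
    unfolding repeat.simps .
  then show ?case by (rule runs_mono) simp
qed

lemma runs_rewind_0:
  "runs m (While (\<lambda>r. r 0 \<noteq> 4) (Move {0} MoveLeft)) (tapes b h) (h 0 * 2 + 1) (tapes b (h(0 := 0)))"
proof (induction "h 0" arbitrary: h)
  case 0
  then have eq: "h(0 := 0) = h" by auto
  show ?case
    unfolding eq using 0 by (intro runs_While_stop) (auto simp: scan_0_eq_4)
next
  case (Suc k)
  have "runs m (Move {0} MoveLeft) (tapes b h) 1 (tapes b (h(0 := h 0 - 1)))"
    using Suc.hyps by (intro runs_left1) simp
  moreover have "runs m (While (\<lambda>r. r 0 \<noteq> 4) (Move {0} MoveLeft)) (tapes b (h(0 := h 0 - 1)))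
      (k * 2 + 1) (tapes b (h(0 := 0)))"
    using Suc.hyps(1)[of "h(0 := h 0 - 1)"] Suc.hyps(2)[symmetric] by simp
  moreover have "scan m (tapes b h) 0 \<noteq> 4" using Suc.hyps(2) by (simp add: scan_0_eq_4)
  ultimately show ?case
    using Suc.hyps(2)[symmetric] by - (rule runs_While_step[rotated], assumption, assumption, auto)
qed

lemma runs_rewind:
  assumes "2 \<le> u" "u < m"
  shows "runs m (While (\<lambda>r. r u \<noteq> 1) (Move {u} MoveLeft)) (tapes b h) (h u * 2 + 1) (tapes b (h(u := 0)))"
proof (induction "h u" arbitrary: h)
  case 0
  then have eq: "h(u := 0) = h" by auto
  show ?case
    unfolding eq using 0 assms by (intro runs_While_stop) (auto simp: scan_eq_1)
next
  case (Suc k)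
  have "runs m (Move {u} MoveLeft) (tapes b h) 1 (tapes b (h(u := h u - 1)))"
    using Suc.hyps by (intro runs_left1) simp
  moreover have "runs m (While (\<lambda>r. r u \<noteq> 1) (Move {u} MoveLeft)) (tapes b (h(u := h u - 1)))
      (k * 2 + 1) (tapes b (h(u := 0)))"
    using Suc.hyps(1)[of "h(u := h u - 1)"] Suc.hyps(2)[symmetric] by simp
  moreover have "scan m (tapes b h) u \<noteq> 1" using Suc.hyps(2) assms scan_eq_1[of u b h] by simp
  ultimately show ?case
    using Suc.hyps(2)[symmetric] by - (rule runs_While_step[rotated], assumption, assumption, auto)
qed

definition home :: "nat list \<Rightarrow> nat \<Rightarrow> nat" where
  "home xs j = (if j = 2 \<or> j = 3 then n else if j < 6 then 0 else val xs (j - 6))"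

lemma home_simps [simp]:
  "home xs 0 = 0" "home xs (Suc 0) = 0" "home xs 2 = n" "home xs 3 = n" "home xs 4 = 0"
  "home xs 5 = 0" "home xs (6 + i) = val xs i"
  by (simp_all add: home_def)

lemma val_less: "set xs \<subseteq> {..<n} \<Longrightarrow> val xs i < n"
  using n_pos by (auto simp: val_def subset_iff)

text \<open>A variable bound to 0 and an unbound variable have the same head position, so a
  quantifier can start its search at 0 without preparation and is undone by rewinding.\<close>

lemma home_append_0: "home (xs @ [0]) = home xs"
  by (auto simp: home_def val_def fun_eq_iff nth_append)

lemma home_append_upd: "(home (xs @ [v]))(6 + length xs := u) = home (xs @ [u])"
  by (auto simp: home_def val_def fun_eq_iff nth_append)

section \<open>Correctness of the evaluation\<close>

lemma runs_Sym:
  assumes "6 + i < m" "6 + j < m" "set xs \<subseteq> {..<n}"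
  shows "runs m (eval_cmd (Sym r i j a) d) (tapes b (home xs)) (eval_time (Sym r i j a) n)
    (tapes (of_bool (sat n w (Sym r i j a) xs)) (home xs))"
proof -
  let ?h = "home xs"
  let ?p = "(r * n + 1 + val xs i) * n + val xs j + 1"
  have v: "val xs i < n" "val xs j < n" using assms(3) by (auto intro: val_less)
  have 1: "runs m (Move {0} MoveRight) (tapes b ?h) 1 (tapes b (?h(0 := 1)))"
    using runs_right1[of 0 b ?h] by simp
  have 2: "runs m (repeat r right_nn) (tapes b (?h(0 := 1))) (r * (n * (40 + n * 21) + 21) + 1)
      (tapes b (?h(0 := 1 + r * (n * n))))"
    using runs_repeat_right_nn[of "?h(0 := 1)" r b] by simp
  have 3: "runs m right_n (tapes b (?h(0 := 1 + r * (n * n)))) (n * 21 + 20)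
      (tapes b (?h(0 := 1 + r * (n * n) + n)))"
    using runs_right_n[of "?h(0 := 1 + r * (n * n))" b] by simp
  have 4: "runs m (loop (6 + i) 5 right_n) (tapes b (?h(0 := 1 + r * (n * n) + n)))
      (n * (n * 21 + 20 + 20) + 20) (tapes b (?h(0 := 1 + r * (n * n) + n + val xs i * n)))"
    using runs_loop[of "6 + i" 5 "\<lambda>h. h 2 = n \<and> h 4 = 0" right_n b "n * 21 + 20" n
        "?h(0 := 1 + r * (n * n) + n)"] runs_right_n assms m_ge v by simp
  have 5: "runs m (loop (6 + j) 4 (Move {0} MoveRight))
      (tapes b (?h(0 := 1 + r * (n * n) + n + val xs i * n))) (n * (1 + 20) + 20) (tapes b (?h(0 := ?p)))"
  proof -
    let ?g = "?h(0 := 1 + r * (n * n) + n + val xs i * n)"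
    have "?g(0 := ?g 0 + ?g (6 + j) * 1) = ?h(0 := ?p)"
      by (simp, simp add: algebra_simps)
    moreover have "runs m (loop (6 + j) 4 (Move {0} MoveRight)) (tapes b ?g) (n * (1 + 20) + 20)
        (tapes b (?g(0 := ?g 0 + ?g (6 + j) * 1)))"
      by (rule runs_loop[where Q = "\<lambda>_. True"]) (use assms m_ge v runs_right1 in auto)
    ultimately show ?thesis by (simp only:)
  qed
  have 6: "runs m (set_flag (\<lambda>r. r 0 = a)) (tapes b (?h(0 := ?p))) 2
      (tapes (of_bool (w ?p = a)) (?h(0 := ?p)))"
    using runs_set_flag[of "?h(0 := ?p)" "\<lambda>r. r 0 = a" b] by (simp add: scan_0)
  have 7: "runs m (While (\<lambda>r. r 0 \<noteq> 4) (Move {0} MoveLeft)) (tapes (of_bool (w ?p = a)) (?h(0 := ?p)))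
      (?p * 2 + 1) (tapes (of_bool (w ?p = a)) ?h)"
  proof -
    have "?h(0 := 0) = ?h" by (auto simp: fun_eq_iff)
    then show ?thesis
      using runs_rewind_0[of "of_bool (w ?p = a)" "?h(0 := ?p)"] by simp
  qed
  have "?p \<le> (r * n + 1 + n) * n + n + 1"
    using v by (intro add_mono mult_le_mono1) auto
  then show ?thesis
    unfolding eval_cmd.simps sat.simps
    by (intro runs_mono[OF runs_Seq[OF 1 runs_Seq[OF 2 runs_Seq[OF 3 runs_Seq[OF 4 runs_Seq[OF 5
          runs_Seq[OF 6 7]]]]]]]) (simp add: algebra_simps)
qed

lemma runs_Eq_down:
  assumes "6 \<le> x" "6 \<le> y" "x < m" "y < m" "k = min (h x) (h y)"
  shows "runs m (While (\<lambda>r. r x \<noteq> 1 \<and> r y \<noteq> 1) (Seq (Move {x, y} MoveLeft) (Move {4} MoveRight)))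
      (tapes b h) (k * 5 + 1) (tapes b (\<lambda>j. if j \<in> {x, y} then h j - k else if j = 4 then h j + k else h j))"
  using assms(5)
proof (induction k arbitrary: h)
  case 0
  then have eq: "(\<lambda>j. if j \<in> {x, y} then h j - 0 else if j = 4 then h j + 0 else h j) = h"
    by auto
  have "h x = 0 \<or> h y = 0" using 0 by (auto simp: min_def split: if_splits)
  then show ?case
    unfolding eq using assms(1-4) by (intro runs_While_stop) (auto simp: scan_eq_1)
next
  case (Suc k)
  let ?h1 = "\<lambda>j. if j \<in> {x, y} then h j - 1 else h j"
  let ?h2 = "?h1(4 := ?h1 4 + 1)"
  have pos: "0 < h x" "0 < h y" using Suc.prems by auto
  have "runs m (Move {x, y} MoveLeft) (tapes b h) 1 (tapes b ?h1)"
    by (rule runs_left) (use pos in auto)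
  from runs_Seq[OF this runs_right1[of 4 b ?h1]]
  have body: "runs m (Seq (Move {x, y} MoveLeft) (Move {4} MoveRight)) (tapes b h) (1 + 1 + 1) (tapes b ?h2)" .
  have eq: "(\<lambda>j. if j \<in> {x, y} then ?h2 j - k else if j = 4 then ?h2 j + k else ?h2 j) =
      (\<lambda>j. if j \<in> {x, y} then h j - Suc k else if j = 4 then h j + Suc k else h j)"
    using assms(1-4) by (auto simp: fun_eq_iff)
  have "k = min (?h2 x) (?h2 y)" using Suc.prems assms(1-4) pos by auto
  note ih = Suc.IH[OF this, unfolded eq]
  show ?case
    by (rule runs_While_step[OF _ body ih]) (use assms(1-4) pos scan_eq_1[of x b h] scan_eq_1[of y b h] in auto)
qed

lemma runs_Eq_up:
  assumes "6 \<le> x" "6 \<le> y"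
  shows "runs m (While (\<lambda>r. r 4 \<noteq> 1) (Seq (Move {4} MoveLeft) (Move {x, y} MoveRight)))
      (tapes b h) (h 4 * 5 + 1) (tapes b (\<lambda>j. if j \<in> {x, y} then h j + h 4 else if j = 4 then 0 else h j))"
proof (induction "h 4" arbitrary: h)
  case 0
  then have eq: "(\<lambda>j. if j \<in> {x, y} then h j + h 4 else if j = 4 then 0 else h j) = h"
    by auto
  show ?case
    unfolding eq using 0 m_ge by (intro runs_While_stop) (auto simp: scan_eq_1)
next
  case (Suc k)
  let ?h1 = "h(4 := h 4 - 1)"
  let ?h2 = "\<lambda>j. if j \<in> {x, y} then ?h1 j + 1 else ?h1 j"
  have "runs m (Move {4} MoveLeft) (tapes b h) 1 (tapes b ?h1)"
    by (rule runs_left1) (use Suc.hyps in simp)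
  from runs_Seq[OF this runs_right[of "{x, y}" b ?h1]]
  have body: "runs m (Seq (Move {4} MoveLeft) (Move {x, y} MoveRight)) (tapes b h) (1 + 1 + 1) (tapes b ?h2)" .
  have k: "k = ?h2 4" using Suc.hyps(2)[symmetric] assms by simp
  have eq: "(\<lambda>j. if j \<in> {x, y} then ?h2 j + ?h2 4 else if j = 4 then 0 else ?h2 j) =
      (\<lambda>j. if j \<in> {x, y} then h j + h 4 else if j = 4 then 0 else h j)"
    using assms Suc.hyps(2)[symmetric] by (auto simp: fun_eq_iff)
  note ih = Suc.hyps(1)[of ?h2, OF k, unfolded eq, folded k]
  show ?case
    by (rule runs_While_step[OF _ body ih])
      (use m_ge Suc.hyps(2)[symmetric] scan_eq_1[of 4 b h] in auto)
qed

lemma runs_Eq: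
  assumes "6 + i < m" "6 + j < m" "set xs \<subseteq> {..<n}"
  shows "runs m (eval_cmd (Eq i j) d) (tapes b (home xs)) (eval_time (Eq i j) n)
    (tapes (of_bool (sat n w (Eq i j) xs)) (home xs))"
proof -
  let ?h = "home xs" and ?x = "6 + i" and ?y = "6 + j"
  define k where "k = min (val xs i) (val xs j)"
  let ?h1 = "\<lambda>l. if l \<in> {?x, ?y} then ?h l - k else if l = 4 then ?h l + k else ?h l"
  have 1: "runs m (While (\<lambda>r. r ?x \<noteq> 1 \<and> r ?y \<noteq> 1) (Seq (Move {?x, ?y} MoveLeft) (Move {4} MoveRight)))
      (tapes b ?h) (k * 5 + 1) (tapes b ?h1)"
    by (rule runs_Eq_down) (use assms in \<open>auto simp: k_def\<close>)
  have "of_bool (scan m (tapes b ?h1) ?x = 1 \<and> scan m (tapes b ?h1) ?y = 1) =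
      (of_bool (val xs i = val xs j) :: nat)"
    using assms scan_eq_1(1)[of ?x b ?h1] scan_eq_1(1)[of ?y b ?h1] by (auto simp: k_def)
  then have 2: "runs m (set_flag (\<lambda>r. r ?x = 1 \<and> r ?y = 1)) (tapes b ?h1) 2
      (tapes (of_bool (val xs i = val xs j)) ?h1)"
    using runs_set_flag[of ?h1 "\<lambda>r. r ?x = 1 \<and> r ?y = 1" b] by simp
  have "(\<lambda>l. if l \<in> {?x, ?y} then ?h1 l + ?h1 4 else if l = 4 then 0 else ?h1 l) = ?h"
    by (auto simp: fun_eq_iff k_def)
  then have 3: "runs m (While (\<lambda>r. r 4 \<noteq> 1) (Seq (Move {4} MoveLeft) (Move {?x, ?y} MoveRight)))
      (tapes (of_bool (val xs i = val xs j)) ?h1) (k * 5 + 1) (tapes (of_bool (val xs i = val xs j)) ?h)"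
    using runs_Eq_up[of ?x ?y "of_bool (val xs i = val xs j)" ?h1] by simp
  have "k \<le> n" using val_less[OF assms(3), of i] by (simp add: k_def)
  then show ?thesis
    unfolding eval_cmd.simps sat.simps
    by (intro runs_mono[OF runs_Seq[OF 1 runs_Seq[OF 2 3]]]) simp
qed

text \<open>The flag \<open>b\<close> on entry is arbitrary, namely whatever the previous formula
  left behind. Restoring all heads lets the evaluations of subformulas be chained.\<close>

lemma runs_eval_cmd:
  "fits m d \<phi> \<Longrightarrow> length xs = d \<Longrightarrow> set xs \<subseteq> {..<n} \<Longrightarrow>
    runs m (eval_cmd \<phi> d) (tapes b (home xs)) (eval_time \<phi> n) (tapes (of_bool (sat n w \<phi> xs)) (home xs))"
proof (induction \<phi> arbitrary: d xs b)
  case (Sym r i j a)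
  then show ?case by (intro runs_Sym) auto
next
  case (Eq i j)
  then show ?case by (intro runs_Eq) auto
next
  case (Neg \<phi>)
  let ?s = "of_bool (sat n w \<phi> xs)"
  have "runs m (eval_cmd \<phi> d) (tapes b (home xs)) (eval_time \<phi> n) (tapes ?s (home xs))"
    using Neg by auto
  moreover have "runs m (set_flag (\<lambda>r. r 1 \<noteq> 1)) (tapes ?s (home xs)) 2
      (tapes (of_bool (sat n w (Neg \<phi>) xs)) (home xs))"
    using runs_set_flag[of "home xs" "\<lambda>r. r 1 \<noteq> 1" ?s]
    by (cases "sat n w \<phi> xs") (simp_all add: scan_flag)
  ultimately show ?case
    unfolding eval_cmd.simps by (rule runs_Seq_le) simp
next
  case (Conj \<phi> \<psi>)
  let ?s = "of_bool (sat n w \<phi> xs)"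
  have "runs m (eval_cmd \<phi> d) (tapes b (home xs)) (eval_time \<phi> n) (tapes ?s (home xs))"
    using Conj by auto
  moreover have "runs m (Cond (\<lambda>r. r 1 = 1) (eval_cmd \<psi> d) Skip) (tapes ?s (home xs))
      (eval_time \<psi> n + 2) (tapes (of_bool (sat n w (Conj \<phi> \<psi>) xs)) (home xs))"
  proof (cases "sat n w \<phi> xs")
    case True
    then show ?thesis
      by (intro runs_Cond_le[where ?T1.0 = "eval_time \<psi> n"])
        (use Conj in \<open>auto simp: scan_flag\<close>)
  next
    case False
    then show ?thesis
      by (intro runs_Cond_le[where ?T1.0 = 1])
        (use runs_Skip in \<open>auto simp: scan_flag\<close>)
  qed
  ultimately show ?case
    unfolding eval_cmd.simps by (rule runs_Seq_le) simp
next
  case (Exists \<phi>)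
  let ?x = "6 + d"
  let ?c = "Seq (eval_cmd \<phi> (Suc d)) (Cond (\<lambda>r. r 1 = 1) Skip (Move {?x} MoveRight))"
  let ?W = "While (\<lambda>r. r 1 \<noteq> 1 \<and> r ?x \<noteq> 2) ?c"
  let ?T = "eval_time \<phi> n"
  have x: "2 \<le> ?x" "?x < m" and d: "length xs = d" using Exists.prems by auto
  \<comment> \<open>Generalized over the value \<open>v\<close> at which the search starts. Where it
    stops, at a witness or at \<open>n\<close>, is left open, since the counter is rewound
    anyway.\<close>
  have "\<exists>v'\<le>n. runs m ?W (tapes 0 (home (xs @ [v]))) ((n - v) * (?T + 5) + 3)
      (tapes (of_bool (\<exists>u<n. v \<le> u \<and> sat n w \<phi> (xs @ [u]))) (home (xs @ [v'])))"
    if "v \<le> n" for v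
    using that
  proof (induction "n - v" arbitrary: v)
    case 0
    have "val (xs @ [v]) d = n" using 0 d by (auto simp: val_def nth_append)
    then have "runs m ?W (tapes 0 (home (xs @ [v]))) 1 (tapes 0 (home (xs @ [v])))"
      using x scan_eq_2[of ?x 0 "home (xs @ [v])"] by (intro runs_While_stop) auto
    moreover have "\<not> (\<exists>u<n. v \<le> u \<and> sat n w \<phi> (xs @ [u]))" using 0 by auto
    ultimately show ?case using 0 by (auto intro!: exI[of _ v] elim: runs_mono)
  next
    case (Suc k)
    have v: "v < n" using Suc.hyps by simp
    have val: "val (xs @ [v]) d = v" using d by (auto simp: val_def nth_append)
    have test: "scan m (tapes 0 (home (xs @ [v]))) 1 \<noteq> 1 \<and> scan m (tapes 0 (home (xs @ [v]))) ?x \<noteq> 2"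
      using x v val scan_eq_2[of ?x 0 "home (xs @ [v])"] by (auto simp: scan_flag)
    let ?s = "of_bool (sat n w \<phi> (xs @ [v]))"
    have 1: "runs m (eval_cmd \<phi> (Suc d)) (tapes 0 (home (xs @ [v]))) ?T (tapes ?s (home (xs @ [v])))"
      using Exists.prems v by (intro Exists.IH) auto
    show ?case
    proof (cases "sat n w \<phi> (xs @ [v])")
      case True
      have 2: "runs m (Cond (\<lambda>r. r 1 = 1) Skip (Move {?x} MoveRight)) (tapes ?s (home (xs @ [v]))) 2
          (tapes 1 (home (xs @ [v])))"
        by (intro runs_Cond_le[where ?T1.0 = 1]) (use runs_Skip True in \<open>auto simp: scan_flag\<close>)
      have 3: "runs m ?W (tapes 1 (home (xs @ [v]))) 1 (tapes 1 (home (xs @ [v])))"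
        by (intro runs_While_stop) (auto simp: scan_flag)
      have "runs m ?W (tapes 0 (home (xs @ [v]))) (?T + 2 + 1 + 1 + 1) (tapes 1 (home (xs @ [v])))"
        by (rule runs_While_True[where t = "\<lambda>r. r 1 \<noteq> 1 \<and> r ?x \<noteq> 2", OF test runs_Seq[OF 1 2] 3])
      moreover have "(of_bool (\<exists>u<n. v \<le> u \<and> sat n w \<phi> (xs @ [u])) :: nat) = 1"
        using True v by auto
      ultimately show ?thesis
        using v Suc.hyps(2)[symmetric] by (auto intro!: exI[of _ v] elim: runs_mono)
    next
      case False
      have "runs m (Move {?x} MoveRight) (tapes 0 (home (xs @ [v]))) 1 (tapes 0 (home (xs @ [Suc v])))"
        using runs_right1[of ?x 0 "home (xs @ [v])"] d home_append_upd[of xs v "Suc v"] val by simp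
      then have 2: "runs m (Cond (\<lambda>r. r 1 = 1) Skip (Move {?x} MoveRight)) (tapes ?s (home (xs @ [v]))) 2
          (tapes 0 (home (xs @ [Suc v])))"
        by (intro runs_Cond_le[where ?T1.0 = 1]) (use False in \<open>auto simp: scan_flag\<close>)
      have "k = n - Suc v" "Suc v \<le> n" using Suc.hyps(2) v by auto
      from Suc.hyps(1)[OF this] obtain v' where "v' \<le> n" and
        3: "runs m ?W (tapes 0 (home (xs @ [Suc v]))) ((n - Suc v) * (?T + 5) + 3)
          (tapes (of_bool (\<exists>u<n. Suc v \<le> u \<and> sat n w \<phi> (xs @ [u]))) (home (xs @ [v'])))"
        by blast
      have "(\<exists>u<n. Suc v \<le> u \<and> sat n w \<phi> (xs @ [u])) \<longleftrightarrow> (\<exists>u<n. v \<le> u \<and> sat n w \<phi> (xs @ [u]))"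
        using False by (metis Suc_leD Suc_leI le_neq_implies_less)
      moreover have "n - v = Suc (n - Suc v)" using v by simp
      then have "?T + 2 + 1 + ((n - Suc v) * (?T + 5) + 3) + 1 \<le> (n - v) * (?T + 5) + 3" by simp
      ultimately have "runs m ?W (tapes 0 (home (xs @ [v]))) ((n - v) * (?T + 5) + 3)
          (tapes (of_bool (\<exists>u<n. v \<le> u \<and> sat n w \<phi> (xs @ [u]))) (home (xs @ [v'])))"
        using runs_While_step[where t = "\<lambda>r. r 1 \<noteq> 1 \<and> r ?x \<noteq> 2", OF test runs_Seq[OF 1 2] 3] by simp
      then show ?thesis using \<open>v' \<le> n\<close> by blast
    qed
  qed
  from this[of 0] obtain v' where v': "v' \<le> n" and
    2: "runs m ?W (tapes 0 (home xs)) (n * (?T + 5) + 3)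
      (tapes (of_bool (sat n w (Exists \<phi>) xs)) (home (xs @ [v'])))"
    by (auto simp: home_append_0)
  have 1: "runs m (Write {1} 0) (tapes b (home xs)) 1 (tapes 0 (home xs))"
    by (rule runs_write_flag) simp
  have "val (xs @ [v']) d = v'" using d by (auto simp: val_def nth_append)
  then have 3: "runs m (While (\<lambda>r. r ?x \<noteq> 1) (Move {?x} MoveLeft))
      (tapes (of_bool (sat n w (Exists \<phi>) xs)) (home (xs @ [v']))) (v' * 2 + 1)
      (tapes (of_bool (sat n w (Exists \<phi>) xs)) (home xs))"
    using runs_rewind[OF x, of "of_bool (sat n w (Exists \<phi>) xs)" "home (xs @ [v'])"] d
      home_append_upd[of xs v' 0] by (simp add: home_append_0)
  show ?case
    unfolding eval_cmd.simps
    by (intro runs_mono[OF runs_Seq[OF 1 runs_Seq[OF 2 3]]]) (use v' in \<open>simp add: algebra_simps\<close>)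
qed

section \<open>Setting up the tapes\<close>

definition raw_tapes :: "nat \<Rightarrow> nat \<Rightarrow> tape" where
  "raw_tapes p j =
     (if j < m then (if j = 0 then \<lambda>q. if q < 0 then 0 else w (nat q) else (\<lambda>q. if q = 0 then 1 else 0), int p)
      else word_tape [])"

lemma runs_raw_right: "runs m (Move UNIV MoveRight) (raw_tapes p) 1 (raw_tapes (Suc p))"
proof -
  have "(\<lambda>j. if j < m \<and> j \<in> UNIV then (fst (raw_tapes p j), snd (raw_tapes p j) + head_shift MoveRight)
         else raw_tapes p j) = raw_tapes (Suc p)"
    by (auto simp: raw_tapes_def fun_eq_iff)
  then show ?thesis using runs_Move[of m UNIV MoveRight "raw_tapes p"] by simp
qed

lemma runs_scan_prefix:
  assumes "\<And>p. 0 < p \<Longrightarrow> p < n \<Longrightarrow> w p = 2" "w n \<noteq> 2"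
  shows "0 < p \<Longrightarrow> p \<le> n \<Longrightarrow>
    runs m (While (\<lambda>r. r 0 = 2) (Move UNIV MoveRight)) (raw_tapes p) ((n - p) * 2 + 1) (raw_tapes n)"
proof (induction "n - p" arbitrary: p)
  case 0
  then have p: "p = n" by simp
  show ?case unfolding p using assms(2) m_ge
    by (intro runs_While_stop) (auto simp: scan_def raw_tapes_def)
next
  case (Suc k)
  have "k = n - Suc p" "0 < Suc p" "Suc p \<le> n" using Suc.hyps(2) by auto
  note ih = Suc.hyps(1)[OF this]
  show ?case
    by (rule runs_While_step[OF _ runs_raw_right ih])
      (use Suc.hyps(2) Suc.prems m_ge assms(1) in \<open>auto simp: scan_def raw_tapes_def\<close>)
qed

lemma runs_rewind_all:
  "runs m (While (\<lambda>r. r 0 \<noteq> 4) (Move (- {2, 3}) MoveLeft))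
     (tapes 1 (\<lambda>j. if j \<in> {2, 3} then n else k)) (k * 2 + 1) (tapes 1 (home []))"
proof (induction k)
  case 0
  have eq: "(\<lambda>j. if j \<in> {2, 3} then n else 0) = home []"
    by (auto simp: home_def val_def fun_eq_iff)
  show ?case unfolding eq by (intro runs_While_stop) (auto simp: scan_0_eq_4)
next
  case (Suc k)
  let ?h = "\<lambda>k (j :: nat). if j \<in> {2, 3} then n else k"
  have eq: "(\<lambda>j. if j \<in> - {2, 3} then ?h (Suc k) j - 1 else ?h (Suc k) j) = ?h k"
    by auto
  have 1: "runs m (Move (- {2, 3}) MoveLeft) (tapes 1 (?h (Suc k))) 1 (tapes 1 (?h k))"
    by (rule runs_left[of "- {2, 3}" "?h (Suc k)" 1, unfolded eq]) auto
  show ?case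
    by (rule runs_While_step[OF _ 1 Suc.IH])
      (use scan_0_eq_4[of 1 "\<lambda>j. if j \<in> {2, 3} then n else Suc k"] in auto)
qed

lemma runs_setup:
  assumes u: "\<And>p. p > 0 \<Longrightarrow> w p = (if p < length u then u ! p else 0)"
    and prefix: "\<And>p. 0 < p \<Longrightarrow> p < n \<Longrightarrow> w p = 2" "w n \<noteq> 2"
  shows "runs m setup_cmd (\<lambda>j. if j = 0 then word_tape u else word_tape []) (n * 4 + 20) (tapes 1 (home []))"
proof -
  let ?ts = "\<lambda>j. if j = 0 then word_tape u else word_tape []"
  define ts1 where "ts1 j = (if j = 0 then (\<lambda>q. if q < 0 then 0 else w (nat q), 0) else word_tape [])" for j :: nat
  have "(\<lambda>j. if j < m \<and> j \<in> {0} then ((fst (?ts j))(snd (?ts j) := 4), snd (?ts j)) else ?ts j) = ts1"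
    using m_ge w_0 u by (auto simp: ts1_def word_tape_def fun_eq_iff)
  then have 1: "runs m (Write {0} 4) ?ts 1 ts1"
    using runs_Write[of m "{0}" 4 ?ts] by simp
  have "(\<lambda>j. if j < m \<and> j \<in> - {0} then ((fst (ts1 j))(snd (ts1 j) := 1), snd (ts1 j)) else ts1 j) =
      raw_tapes 0"
    using m_ge by (auto simp: ts1_def raw_tapes_def word_tape_def fun_eq_iff)
  then have 2: "runs m (Write (- {0}) 1) ts1 1 (raw_tapes 0)"
    using runs_Write[of m "- {0}" 1 ts1] by simp
  have 3: "runs m (Move UNIV MoveRight) (raw_tapes 0) 1 (raw_tapes 1)"
    using runs_raw_right[of 0] by simp
  have 4: "runs m (While (\<lambda>r. r 0 = 2) (Move UNIV MoveRight)) (raw_tapes 1) ((n - 1) * 2 + 1) (raw_tapes n)"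
    using runs_scan_prefix[OF prefix, of 1] n_pos by simp
  have "(\<lambda>j. if j < m \<and> j \<in> - {0} then ((fst (raw_tapes n j))(snd (raw_tapes n j) := 2), snd (raw_tapes n j))
      else raw_tapes n j) = tapes 1 (\<lambda>j. if j \<in> {2, 3} then n else n)"
    using m_ge n_pos by (auto simp: raw_tapes_def tapes_def content_def fun_eq_iff)
  then have 5: "runs m (Write (- {0}) 2) (raw_tapes n) 1 (tapes 1 (\<lambda>j. if j \<in> {2, 3} then n else n))"
    using runs_Write[of m "- {0}" 2 "raw_tapes n"] by simp
  show ?thesis
    unfolding setup_cmd_def
    by (intro runs_mono[OF runs_Seq[OF 1 runs_Seq[OF 2 runs_Seq[OF 3 runs_Seq[OF 4
          runs_Seq[OF 5 runs_rewind_all]]]]]]) simp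
qed

end

text \<open>The atoms of a formula never look at position 0, so the marker written there does no harm.\<close>

lemma runs_verify_cmd:
  assumes m: "m \<ge> 6" "fits m 0 \<phi>"
    and u: "\<And>p. p < length u \<Longrightarrow> u ! p \<noteq> 4" "n \<le> length u" "\<And>p. p < n \<Longrightarrow> u ! p = 2"
      "n < length u \<Longrightarrow> u ! n \<noteq> 2"
  shows "\<exists>ts. runs m (verify_cmd \<phi>) (\<lambda>j. if j = 0 then word_tape u else word_tape [])
           (n * 4 + eval_time \<phi> n + 30) ts \<and>
         (scan m ts 1 = 1 \<longleftrightarrow> 0 < n \<and> sat n (\<lambda>p. if p < length u then u ! p else 0) \<phi> [])"
proof -
  let ?ts = "\<lambda>j. if j = 0 then word_tape u else word_tape []"
  have scan0: "scan m ?ts 0 = 2 \<longleftrightarrow> 0 < n"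
    using m u(2,4) u(3)[of 0] by (cases "n = 0"; cases u) (auto simp: scan_def word_tape_def)
  show ?thesis
  proof (cases "n = 0")
    case True
    have "runs m (verify_cmd \<phi>) ?ts 30 ?ts"
      unfolding verify_cmd_def
      by (rule runs_Cond_le[where ?T1.0 = 1])
        (use scan0 True runs_Move[of m "{}" Stay ?ts] in simp_all)
    then show ?thesis
      using True m by (intro exI[of _ ?ts]) (auto simp: scan_def word_tape_def elim: runs_mono)
  next
    case False
    define w where "w p = (if p = 0 then 4 else if p < length u then u ! p else 0)" for p
    interpret evaluator m n w
      using m False u(1) by unfold_locales (auto simp: w_def)
    have "runs m setup_cmd ?ts (n * 4 + 20) (tapes 1 (home []))"
      by (rule runs_setup) (use u False in \<open>auto simp: w_def\<close>)
    moreover have "runs m (eval_cmd \<phi> 0) (tapes 1 (home [])) (eval_time \<phi> n)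
        (tapes (of_bool (sat n w \<phi> [])) (home []))"
      by (rule runs_eval_cmd) (use m in auto)
    ultimately have "runs m (Seq setup_cmd (eval_cmd \<phi> 0)) ?ts (n * 4 + 20 + eval_time \<phi> n + 1)
        (tapes (of_bool (sat n w \<phi> [])) (home []))"
      by (rule runs_Seq)
    then have "runs m (verify_cmd \<phi>) ?ts (n * 4 + eval_time \<phi> n + 30)
        (tapes (of_bool (sat n w \<phi> [])) (home []))"
      unfolding verify_cmd_def using scan0 False by (intro runs_Cond_le) auto
    moreover have "sat n w \<phi> [] \<longleftrightarrow> sat n (\<lambda>p. if p < length u then u ! p else 0) \<phi> []"
      by (rule sat_cong) (simp add: w_def)
    ultimately show ?thesis
      using False by (intro exI[of _ "tapes (of_bool (sat n w \<phi> [])) (home [])"]) (simp add: scan_flag)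
  qed
qed

text \<open>Keeps symbol 4 free as the mark of the left end.\<close>

lemma pair_word_nth_neq_4: "p < length (pair_word x y) \<Longrightarrow> pair_word x y ! p \<noteq> 4"
proof -
  have "4 \<notin> set (pair_word x y)" by (auto simp: pair_word_def bit_symbol_def)
  then show "p < length (pair_word x y) \<Longrightarrow> pair_word x y ! p \<noteq> 4" by (metis nth_mem)
qed

definition unary_prefix :: "bool list \<Rightarrow> nat" where
  "unary_prefix x = length (takeWhile id x)"

definition symbol_at :: "bool list \<Rightarrow> bool list \<Rightarrow> nat \<Rightarrow> nat" where
  "symbol_at x y p = (if p < length (pair_word x y) then pair_word x y ! p else 0)"

text \<open>The sentence is fixed and \<open>n\<close> is at most the length of the input, so the
  evaluation takes polynomial time. Malformed words have to be rejected by the sentence itself, as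
  the machine only tests that the unary prefix is nonempty.\<close>

theorem first_order_verifier_NP:
  assumes L: "\<And>x. x \<in> L \<longleftrightarrow>
      (\<exists>y. length y \<le> poly q (length x) \<and> 0 < unary_prefix x \<and> sat (unary_prefix x) (symbol_at x y) \<phi> [])"
  shows "L \<in> NP"
proof -
  obtain m where m: "m \<ge> 6" "fits m 0 \<phi>" using ex_fits by blast
  define M where "M = compile_tm m 5 (verify_cmd \<phi>)"
  have "poly_bounded (\<lambda>n. n * 4 + eval_time \<phi> n + 30 + 1)"
    by (intro poly_bounded_intros poly_bounded_eval_time)
  then obtain p :: "nat poly" where p: "\<And>n. n * 4 + eval_time \<phi> n + 30 + 1 \<le> poly p n"
    unfolding poly_bounded_def by blast
  have run: "halts_within M (pair_word x y) (poly p (length x + length y)) \<and>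
      (accepts M (pair_word x y) \<longleftrightarrow> 0 < unary_prefix x \<and> sat (unary_prefix x) (symbol_at x y) \<phi> [])" for x y
  proof -
    let ?n = "unary_prefix x"
    have len: "?n \<le> length x" by (simp add: unary_prefix_def length_takeWhile_le)
    have pre: "pair_word x y ! i = 2" if "i < ?n" for i
    proof -
      have "x ! i" using that set_takeWhileD[of "x ! i" id x] nth_mem[of i "takeWhile id x"]
        by (simp add: unary_prefix_def takeWhile_nth)
      then show ?thesis using that len by (simp add: pair_word_def nth_append bit_symbol_def)
    qed
    \<comment> \<open>The prefix is ended by a zero bit or, if \<open>x\<close> consists of ones
      only, by the separator.\<close>
    have stop: "pair_word x y ! ?n \<noteq> 2"
    proof (cases "?n < length x")
      case True
      then have "\<not> x ! ?n" using nth_length_takeWhile[of id x] by (simp add: unary_prefix_def)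
      then show ?thesis using True by (simp add: pair_word_def nth_append bit_symbol_def)
    next
      case False
      then show ?thesis using len by (simp add: pair_word_def nth_append)
    qed
    obtain ts where ts: "runs m (verify_cmd \<phi>) (\<lambda>j. if j = 0 then word_tape (pair_word x y) else word_tape [])
          (?n * 4 + eval_time \<phi> ?n + 30) ts"
        "scan m ts 1 = 1 \<longleftrightarrow> 0 < ?n \<and> sat ?n (symbol_at x y) \<phi> []"
      using runs_verify_cmd[OF m pair_word_nth_neq_4, of x y ?n] len pre stop
      unfolding symbol_at_def by (auto simp: pair_word_def)
    have "halts_within M (pair_word x y) (?n * 4 + eval_time \<phi> ?n + 30 + 1)"
      unfolding M_def by (rule compile_tm_run(1)[OF ts(1)])
    moreover have "?n * 4 + eval_time \<phi> ?n + 30 + 1 \<le> poly p (length x + length y)"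
      using p[of ?n] poly_nat_mono[of ?n "length x + length y" p] len by linarith
    ultimately have "halts_within M (pair_word x y) (poly p (length x + length y))"
      unfolding halts_within_def using tm_run_halted by metis
    then show ?thesis
      using compile_tm_run(2)[OF ts(1), of 5] ts(2) unfolding M_def by blast
  qed
  have "wf_tm M"
    unfolding M_def by (rule wf_compile_tm) (use m symbols_below_verify_cmd in auto)
  then show ?thesis
    unfolding NP_def mem_Collect_eq using run L
    by (intro exI[of _ M] exI[of _ p] exI[of _ q] conjI) auto
qed

section \<open>Monochromatic maximal bicliques\<close>

text \<open>Only vertices are mapped, whereas \<open>digraph_iso\<close> maps arcs as well. A tuple
  of vertices is what a first-order formula can quantify over.\<close>

definition induced_copy :: "'b pair_pre_digraph \<Rightarrow> 'a pair_pre_digraph \<Rightarrow> bool" where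
  "induced_copy F G \<longleftrightarrow>
     (\<exists>f. inj_on f (pverts F) \<and> f ` pverts F \<subseteq> pverts G \<and>
        (\<forall>u\<in>pverts F. \<forall>v\<in>pverts F. (f u, f v) \<in> parcs G \<longleftrightarrow> (u, v) \<in> parcs F))"

lemma induced_copyI_digraph_iso:
  assumes "induced_subgraph H (with_proj G)" "digraph_iso (with_proj F) H"
  shows "induced_copy F G"
proof -
  obtain h where h: "pre_digraph.digraph_isomorphism (with_proj F) h" "H = app_iso h (with_proj F)"
    using assms(2) by (auto simp: digraph_iso_def)
  interpret F: wf_digraph "with_proj F"
    using h(1) by (simp add: pre_digraph.digraph_isomorphism_def)
  let ?f = "iso_verts h"
  have inj: "inj_on ?f (pverts F)"
    using h(1) by (simp add: pre_digraph.digraph_isomorphism_def)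
  have H: "verts H = ?f ` pverts F" "arcs H = iso_arcs h ` parcs F" "tail H = fst" "head H = snd"
    using h(2) assms(1) by (auto simp: induced_subgraph_def subgraph_def compatible_def)
  \<comment> \<open>\<open>H\<close> inherits \<open>fst\<close> and \<open>snd\<close> as the ends
    of its arcs, so the arc map is determined by the vertex map.\<close>
  have ends: "iso_arcs h e = (?f (fst e), ?f (snd e))" if "e \<in> parcs F" for e
    using h that H by (auto simp: pre_digraph.digraph_isomorphism_def prod_eq_iff)
  have arcs: "arcs H = {e \<in> parcs G. fst e \<in> ?f ` pverts F \<and> snd e \<in> ?f ` pverts F}"
    using assms(1) H(1,3,4) by (simp add: induced_subgraph_def)
  have "(?f u, ?f v) \<in> parcs G \<longleftrightarrow> (u, v) \<in> parcs F" if "u \<in> pverts F" "v \<in> pverts F" for u v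
  proof
    assume "(?f u, ?f v) \<in> parcs G"
    then have "(?f u, ?f v) \<in> iso_arcs h ` parcs F" using arcs H(2) that by auto
    then obtain e where e: "e \<in> parcs F" "?f u = ?f (fst e)" "?f v = ?f (snd e)" using ends by auto
    have "fst e \<in> pverts F" "snd e \<in> pverts F"
      using F.tail_in_verts[of e] F.head_in_verts[of e] e(1) by auto
    then have "u = fst e" "v = snd e" using e that inj by (auto dest: inj_onD)
    then show "(u, v) \<in> parcs F" using e by simp
  next
    assume "(u, v) \<in> parcs F"
    then show "(?f u, ?f v) \<in> parcs G" using arcs H(2) ends by force
  qed
  moreover have "?f ` pverts F \<subseteq> pverts G"
    using assms(1) H(1) by (auto simp: induced_subgraph_def subgraph_def)
  ultimately show ?thesis using inj unfolding induced_copy_def by blast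
qed

lemma induced_copy_digraph_iso:
  assumes "pair_wf_digraph F" "pair_wf_digraph G" "induced_copy F G"
  shows "\<exists>H. induced_subgraph H (with_proj G) \<and> digraph_iso (with_proj F) H"
proof -
  interpret F: pair_wf_digraph F by fact
  interpret G: pair_wf_digraph G by fact
  obtain f where f: "inj_on f (pverts F)" "f ` pverts F \<subseteq> pverts G"
    "\<And>u v. u \<in> pverts F \<Longrightarrow> v \<in> pverts F \<Longrightarrow> (f u, f v) \<in> parcs G \<longleftrightarrow> (u, v) \<in> parcs F"
    using assms(3) unfolding induced_copy_def by blast
  define h where "h = \<lparr>iso_verts = f, iso_arcs = map_prod f f, iso_head = snd, iso_tail = fst\<rparr>"
  have "inj_on (map_prod f f) (parcs F)"
    using f(1) by (intro inj_on_subset[OF map_prod_inj_on[OF f(1) f(1)]]) (auto dest: F.wellformed')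
  then have "pre_digraph.digraph_isomorphism (with_proj F) h"
    using f(1) F.wf_digraph by (auto simp: pre_digraph.digraph_isomorphism_def h_def)
  moreover have "induced_subgraph (app_iso h (with_proj F)) (with_proj G)"
  proof -
    have arcs: "map_prod f f ` parcs F = {e \<in> parcs G. fst e \<in> f ` pverts F \<and> snd e \<in> f ` pverts F}"
    proof (intro set_eqI iffI)
      fix e assume "e \<in> map_prod f f ` parcs F"
      then obtain u v where "(u, v) \<in> parcs F" "e = (f u, f v)" by auto
      then show "e \<in> {e \<in> parcs G. fst e \<in> f ` pverts F \<and> snd e \<in> f ` pverts F}"
        using f(3)[of u v] F.wellformed'[of u v] by simp
    next
      fix e assume "e \<in> {e \<in> parcs G. fst e \<in> f ` pverts F \<and> snd e \<in> f ` pverts F}"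
      then obtain u v where uv: "u \<in> pverts F" "v \<in> pverts F" "e = (f u, f v)" "e \<in> parcs G"
        by (cases e) auto
      then have "(u, v) \<in> parcs F" using f(3) by simp
      then show "e \<in> map_prod f f ` parcs F" using uv(3) by force
    qed
    have "wf_digraph (app_iso h (with_proj F))"
      by unfold_locales (auto simp: h_def dest: F.wellformed')
    then show ?thesis
      using arcs f(2) G.wf_digraph
      by (auto simp: induced_subgraph_def subgraph_def compatible_def h_def)
  qed
  ultimately show ?thesis by (auto simp: digraph_iso_def)
qed

lemma family_free_iff:
  assumes "\<And>F. F \<in> \<F> \<Longrightarrow> pair_wf_digraph F" "pair_wf_digraph G"
  shows "family_free \<F> G \<longleftrightarrow> \<not> (\<exists>F\<in>\<F>. induced_copy F G)"
  unfolding family_free_def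
  using assms induced_copyI_digraph_iso induced_copy_digraph_iso by metis

section \<open>Bicliques as pairs of joined sides\<close>

definition independent :: "'a pair_pre_digraph \<Rightarrow> 'a set \<Rightarrow> bool" where
  "independent G A \<longleftrightarrow> (\<forall>u\<in>A. \<forall>v\<in>A. (u, v) \<notin> parcs G)"

text \<open>The sides are disjoint automatically: a common vertex would be adjacent to itself. They
  may be empty.\<close>

definition joined :: "'a pair_pre_digraph \<Rightarrow> 'a set \<Rightarrow> 'a set \<Rightarrow> bool" where
  "joined G A B \<longleftrightarrow> independent G A \<and> independent G B \<and> A \<times> B \<subseteq> parcs G"

lemma joined_mono: "joined G A B \<Longrightarrow> A' \<subseteq> A \<Longrightarrow> B' \<subseteq> B \<Longrightarrow> joined G A' B'"
  unfolding joined_def independent_def by blast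

definition Kii :: "nat \<Rightarrow> nat pair_pre_digraph" where
  "Kii i = edge_list_graph (2 * i) (List.product [0..<i] [i..<2 * i])"

lemma Kii_simps:
  "pverts (Kii i) = {..<2 * i}"
  "(u, v) \<in> parcs (Kii i) \<longleftrightarrow> u < i \<and> i \<le> v \<and> v < 2 * i \<or> v < i \<and> i \<le> u \<and> u < 2 * i"
  by (auto simp: Kii_def edge_list_graph_def)

lemma complete_bipartite_Kii: "complete_bipartite_digraph i i (with_proj (Kii i))"
  unfolding complete_bipartite_digraph_pair_def
proof (intro conjI exI)
  show "finite (pverts (Kii i))" by (simp add: Kii_simps)
  show "pverts (Kii i) = {..<i} \<union> {i..<2 * i}" by (auto simp: Kii_simps)
  show "parcs (Kii i) = {..<i} \<times> {i..<2 * i} \<union> {i..<2 * i} \<times> {..<i}"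
    by (auto simp: Kii_simps)
qed auto

lemma (in pair_graph) induced_copy_KiiI:
  assumes "joined G A B" "A \<subseteq> pverts G" "B \<subseteq> pverts G" "card A = i" "card B = i"
  shows "induced_copy (Kii i) G"
proof -
  have fin: "finite A" "finite B" using assms(2,3) pair_finite_verts by (auto intro: finite_subset)
  obtain f where f: "bij_betw f {..<i} A"
    using ex_bij_betw_nat_finite[OF fin(1)] assms(4) by (auto simp: atLeast0LessThan)
  obtain g where g: "bij_betw g {..<i} B"
    using ex_bij_betw_nat_finite[OF fin(2)] assms(5) by (auto simp: atLeast0LessThan)
  define h where "h p = (if p < i then f p else g (p - i))" for p
  have hA: "h p \<in> A" if "p < i" for p
    using f that by (auto simp: h_def bij_betw_def)
  have hB: "h p \<in> B" if "i \<le> p" "p < 2 * i" for p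
    using g that by (auto simp: h_def bij_betw_def)
  have adj: "(a, b) \<in> parcs G" "(b, a) \<in> parcs G" if "a \<in> A" "b \<in> B" for a b
    using assms(1) that arcs_symmetric by (auto simp: joined_def)
  have nadj: "(a, b) \<notin> parcs G" if "a \<in> A \<and> b \<in> A \<or> a \<in> B \<and> b \<in> B" for a b
    using assms(1) that by (auto simp: joined_def independent_def)
  have disj: "A \<inter> B = {}" using adj(1) nadj by blast
  have "inj_on h {..<2 * i}"
  proof (rule inj_onI)
    fix p q assume p: "p \<in> {..<2 * i}" and q: "q \<in> {..<2 * i}" and eq: "h p = h q"
    have "p < i \<longleftrightarrow> q < i"
      using hA[of p] hA[of q] hB[of p] hB[of q] p q eq disj
      by (metis disjoint_iff lessThan_iff not_le)
    moreover have "p - i = q - i" if "\<not> p < i" "\<not> q < i"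
      by (rule inj_onD[OF bij_betw_imp_inj_on[OF g]]) (use eq p q that in \<open>auto simp: h_def\<close>)
    ultimately show "p = q"
      using eq p q inj_onD[OF bij_betw_imp_inj_on[OF f], of p q]
      by (cases "p < i") (auto simp: h_def)
  qed
  moreover have "h ` {..<2 * i} \<subseteq> pverts G"
    using hA hB assms(2,3) by (auto simp: subset_iff) (metis not_le)
  moreover have "(h u, h v) \<in> parcs G \<longleftrightarrow> (u, v) \<in> parcs (Kii i)" if "u < 2 * i" "v < 2 * i" for u v
    using that hA[of u] hA[of v] hB[of u] hB[of v] adj[of "h u" "h v"] adj[of "h v" "h u"]
      nadj[of "h u" "h v"]
    by (cases "u < i"; cases "v < i") (auto simp: Kii_simps)
  ultimately show ?thesis
    unfolding induced_copy_def by (auto simp: Kii_simps(1) intro!: exI[of _ h])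
qed

text \<open>One representative stands for all copies of the complete bipartite graph, so that the
  excluded graphs form a finite list and lead to a finite conjunction.\<close>

definition forbidden_list :: "nat \<Rightarrow> nat pair_pre_digraph list" where
  "forbidden_list i = [Kii i, W4_graph, dart_graph, gem_graph]"

lemma pverts_forbidden_list:
  "F \<in> set (forbidden_list i) \<Longrightarrow> \<exists>p. pverts F = {..<p}"
  by (auto simp: forbidden_list_def Kii_simps W4_graph_def dart_graph_def gem_graph_def
      edge_list_graph_def)

lemma pair_wf_digraph_edge_list_graph:
  "set es \<subseteq> {..<n} \<times> {..<n} \<Longrightarrow> pair_wf_digraph (edge_list_graph n es)"
  by unfold_locales (auto simp: edge_list_graph_def)

lemma (in pair_graph) family_free_forbidden_graphs_iff:
  "family_free (forbidden_graphs i) G \<longleftrightarrow> (\<forall>F\<in>set (forbidden_list i). \<not> induced_copy F G)"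
proof -
  have "pair_wf_digraph F" if "complete_bipartite_digraph i i (with_proj F)" for F :: "nat pair_pre_digraph"
    using pair_graphI_complete_bipartite[OF that] by (simp add: pair_graph_def pair_digraph.pair_wf_digraph)
  moreover have "pair_wf_digraph W4_graph" "pair_wf_digraph dart_graph" "pair_wf_digraph gem_graph"
    unfolding W4_graph_def dart_graph_def gem_graph_def
    by (intro pair_wf_digraph_edge_list_graph; simp)+
  ultimately have wf: "pair_wf_digraph F" if "F \<in> forbidden_graphs i" for F
    using that by (auto simp: forbidden_graphs_def)
  \<comment> \<open>The images of the two sides of any copy are joined sets of size
    \<open>i\<close>, which carry the chosen representative as well.\<close>
  have "induced_copy (Kii i) G"
    if H: "complete_bipartite_digraph i i (with_proj H)" "induced_copy H G" for H :: "nat pair_pre_digraph"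
  proof -
    obtain U V where UV: "pverts H = U \<union> V" "U \<inter> V = {}" "card U = i" "card V = i"
      "parcs H = U \<times> V \<union> V \<times> U"
      using H(1) unfolding complete_bipartite_digraph_pair_def by blast
    obtain f where f: "inj_on f (pverts H)" "f ` pverts H \<subseteq> pverts G"
      "\<And>u v. u \<in> pverts H \<Longrightarrow> v \<in> pverts H \<Longrightarrow> (f u, f v) \<in> parcs G \<longleftrightarrow> (u, v) \<in> parcs H"
      using H(2) unfolding induced_copy_def by blast
    have "card (f ` U) = i" "card (f ` V) = i"
      using f(1) UV by (auto simp: card_image inj_on_Un)
    moreover have "joined G (f ` U) (f ` V)"
      using f(3) UV by (auto simp: joined_def independent_def)
    ultimately show ?thesis
      using f(2) UV(1) by (intro induced_copy_KiiI[of "f ` U" "f ` V"]) auto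
  qed
  then have "(\<exists>F\<in>forbidden_graphs i. induced_copy F G) \<longleftrightarrow> (\<exists>F\<in>set (forbidden_list i). induced_copy F G)"
    using complete_bipartite_Kii[of i] by (auto simp: forbidden_graphs_def forbidden_list_def)
  then show ?thesis
    using family_free_iff[OF wf] pair_wf_digraph by blast
qed

lemma biclique_iff:
  assumes "pair_graph G"
  shows "biclique G W \<longleftrightarrow> (\<exists>A B. W = A \<union> B \<and> A \<noteq> {} \<and> B \<noteq> {} \<and> joined G A B)"
proof -
  interpret pair_graph G by fact
  have proj: "with_proj G \<restriction> W = with_proj \<lparr>pverts = W, parcs = parcs G \<inter> W \<times> W\<rparr>"
    by (auto simp: induce_subgraph_def with_proj_def)
  show ?thesis
  proof
    assume "biclique G W"
    then obtain n m U V where "n \<ge> 1" "m \<ge> 1" "W = U \<union> V" "U \<inter> V = {}" "card U = n" "card V = m"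
      "parcs G \<inter> W \<times> W = U \<times> V \<union> V \<times> U"
      unfolding biclique_def proj complete_bipartite_digraph_pair_def by auto
    moreover from this have "joined G U V"
      unfolding joined_def independent_def by (auto simp: set_eq_iff) blast+
    moreover from calculation have "U \<noteq> {}" "V \<noteq> {}" by auto
    ultimately show "\<exists>A B. W = A \<union> B \<and> A \<noteq> {} \<and> B \<noteq> {} \<and> joined G A B" by blast
  next
    assume "\<exists>A B. W = A \<union> B \<and> A \<noteq> {} \<and> B \<noteq> {} \<and> joined G A B"
    then obtain A B where AB: "W = A \<union> B" "A \<noteq> {}" "B \<noteq> {}" "joined G A B" by blast
    have adj: "(a, b) \<in> parcs G" "(b, a) \<in> parcs G" if "a \<in> A" "b \<in> B" for a b
      using AB(4) that arcs_symmetric by (auto simp: joined_def)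
    have W: "W \<subseteq> pverts G" using adj AB(1-3) by (auto dest: wellformed')
    then have fin: "finite A" "finite B" using AB(1) pair_finite_verts by (auto intro: finite_subset)
    have "A \<inter> B = {}" using adj AB(4) by (auto simp: joined_def independent_def)
    moreover have "parcs G \<inter> W \<times> W = A \<times> B \<union> B \<times> A"
      using adj AB(1,4) by (auto simp: joined_def independent_def)
    ultimately have "complete_bipartite_digraph (card A) (card B) (with_proj G \<restriction> W)"
      unfolding proj complete_bipartite_digraph_pair_def using fin AB(1) by auto
    moreover have "card A \<ge> 1" "card B \<ge> 1" using fin AB(2,3) by (auto simp: Suc_le_eq card_gt_0_iff)
    ultimately show "biclique G W" unfolding biclique_def using W by blast
  qed
qed

lemma (in pair_graph) joined_commute: "joined G A B \<longleftrightarrow> joined G B A"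
  using arcs_symmetric by (auto simp: joined_def)

text \<open>Single vertices decide maximality. The sides of a biclique are determined up to
  exchange, so a larger biclique has sides containing \<open>A\<close> and \<open>B\<close>, and
  each of its additional vertices could be added to one of them alone.\<close>

lemma (in pair_graph) maximal_biclique_iff:
  assumes "joined G A B" "A \<noteq> {}" "B \<noteq> {}"
  shows "maximal_biclique G (A \<union> B) \<longleftrightarrow>
    (\<forall>v. (\<forall>a\<in>A. (a, v) \<in> parcs G) \<longrightarrow> v \<in> B \<or> (\<exists>b\<in>B. (b, v) \<in> parcs G)) \<and>
    (\<forall>v. (\<forall>b\<in>B. (b, v) \<in> parcs G) \<longrightarrow> v \<in> A \<or> (\<exists>a\<in>A. (a, v) \<in> parcs G))"
    (is "_ \<longleftrightarrow> ?ext A B \<and> ?ext B A")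
proof
  assume max: "maximal_biclique G (A \<union> B)"
  have ext: "?ext A B" if AB: "joined G A B" "A \<noteq> {}" "B \<noteq> {}" "maximal_biclique G (A \<union> B)" for A B
  proof (rule ccontr)
    assume "\<not> ?ext A B"
    then obtain v where v: "\<forall>a\<in>A. (a, v) \<in> parcs G" "v \<notin> B" "\<forall>b\<in>B. (b, v) \<notin> parcs G" by blast
    have "(v, v) \<notin> parcs G" using no_loops' by blast
    then have "v \<notin> A" using v(1) by blast
    moreover have "joined G A (insert v B)"
      using AB(1) v(1,3) \<open>(v, v) \<notin> parcs G\<close> arcs_symmetric[of v]
      unfolding joined_def independent_def by blast
    ultimately have "joined G A (insert v B)" "v \<notin> A" by blast+
    then have "biclique G (A \<union> insert v B)" "A \<union> B \<subset> A \<union> insert v B"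
      unfolding biclique_iff[OF pair_graph] using AB(2) v(2) by blast+
    then show False using AB(4) unfolding maximal_biclique_def by blast
  qed
  show "?ext A B \<and> ?ext B A"
    using ext[OF assms max] ext[of B A] assms max joined_commute by (simp add: Un_commute)
next
  assume ext: "?ext A B \<and> ?ext B A"
  have "\<not> A \<union> B \<subset> A' \<union> B'" if AB': "joined G A' B'" for A' B'
  proof
    assume sub: "A \<union> B \<subset> A' \<union> B'"
    \<comment> \<open>Once a vertex of \<open>A\<close> lies on the side \<open>A'\<close>, its
      neighbours \<open>B\<close> must lie in \<open>B'\<close>, and then all of \<open>A\<close> in
      \<open>A'\<close>. The other placement follows by exchanging \<open>A'\<close> and
      \<open>B'\<close>.\<close>
    have aux: False if J: "joined G A' B'" "A \<union> B \<subset> A' \<union> B'" and a0: "a0 \<in> A" "a0 \<in> A'" for A' B' a0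
    proof -
      obtain b0 where b0: "b0 \<in> B" using assms(3) by blast
      have adj: "(a, b) \<in> parcs G" "(b, a) \<in> parcs G" if "a \<in> A" "b \<in> B" for a b
        using assms(1) that arcs_symmetric by (auto simp: joined_def)
      have B: "B \<subseteq> B'"
        using adj(1)[OF a0(1)] J a0(2) unfolding joined_def independent_def by blast
      have A: "A \<subseteq> A'"
        using adj(2)[OF _ b0] J b0 B unfolding joined_def independent_def by blast
      obtain v where v: "v \<in> A' \<union> B'" "v \<notin> A" "v \<notin> B" using J(2) by blast
      show False
      proof (cases "v \<in> A'")
        case True
        then have "\<forall>b\<in>B. (b, v) \<in> parcs G" "\<forall>a\<in>A. (a, v) \<notin> parcs G"
          using J(1) A B arcs_symmetric unfolding joined_def independent_def by blast+
        then show False using ext v by blast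
      next
        case False
        then have "\<forall>a\<in>A. (a, v) \<in> parcs G" "\<forall>b\<in>B. (b, v) \<notin> parcs G"
          using J(1) A B v(1) by (auto simp: joined_def independent_def)
        then show False using ext v by blast
      qed
    qed
    obtain a0 where a0: "a0 \<in> A" using assms(2) by blast
    then consider "a0 \<in> A'" | "a0 \<in> B'" using sub by blast
    then show False
    proof cases
      case 1
      then show ?thesis using aux[OF AB' sub a0] by blast
    next
      case 2
      then show ?thesis using aux[of B' A' a0] AB' sub a0 joined_commute by (simp add: Un_commute)
    qed
  qed
  then show "maximal_biclique G (A \<union> B)"
    using assms unfolding maximal_biclique_def biclique_iff[OF pair_graph] by blast
qed

lemma monochromatic_iff: "monochromatic \<rho> W \<longleftrightarrow> W \<noteq> {} \<and> (\<forall>x\<in>W. \<forall>y\<in>W. \<rho> x = \<rho> y)"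
proof
  assume "monochromatic \<rho> W"
  then obtain c where c: "\<rho> ` W = {c}" unfolding monochromatic_def by (auto simp: card_1_singleton_iff)
  then have "\<rho> x = c" if "x \<in> W" for x using that by blast
  then show "W \<noteq> {} \<and> (\<forall>x\<in>W. \<forall>y\<in>W. \<rho> x = \<rho> y)" using c by auto
next
  assume W: "W \<noteq> {} \<and> (\<forall>x\<in>W. \<forall>y\<in>W. \<rho> x = \<rho> y)"
  then obtain x where "x \<in> W" by blast
  then have "\<rho> ` W = {\<rho> x}" using W by blast
  then show "monochromatic \<rho> W" by (simp add: monochromatic_def)
qed

section \<open>Bounded cores of monochromatic maximal bicliques\<close>

lemma (in pair_graph) ex_maximal_independent:
  "finite S \<Longrightarrow> \<exists>I\<subseteq>S. independent G I \<and> (\<forall>z\<in>S. z \<in> I \<or> (\<exists>y\<in>I. (y, z) \<in> parcs G))"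
proof (induction S rule: finite_induct)
  case empty
  then show ?case by (auto simp: independent_def)
next
  case (insert x S)
  then obtain I where I: "I \<subseteq> S" "independent G I" "\<forall>z\<in>S. z \<in> I \<or> (\<exists>y\<in>I. (y, z) \<in> parcs G)"
    by blast
  show ?case
  proof (cases "\<exists>y\<in>I. (y, x) \<in> parcs G")
    case True
    then show ?thesis using I by (intro exI[of _ I]) auto
  next
    case False
    have "(x, x) \<notin> parcs G" using no_loops' by blast
    then have "independent G (insert x I)"
      using I(2) False arcs_symmetric[of x] unfolding independent_def by blast
    then show ?thesis using I by (intro exI[of _ "insert x I"]) auto
  qed
qed

text \<open>The vertices \<open>a\<close>, \<open>y\<close>, \<open>x\<close>, \<open>z\<close> form
  a diamond whose missing edge joins \<open>x\<close> and \<open>z\<close>, and \<open>b\<close> is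
  the extra vertex attached to \<open>a\<close>.\<close>

lemma dart_copyI:
  assumes "pair_graph G"
    and "(a, y) \<in> parcs G" "(a, x) \<in> parcs G" "(a, z) \<in> parcs G" "(a, b) \<in> parcs G"
    and "(y, x) \<in> parcs G" "(y, z) \<in> parcs G" "x \<noteq> z" "(x, z) \<notin> parcs G"
    and "(b, y) \<notin> parcs G" "(b, x) \<notin> parcs G" "(b, z) \<notin> parcs G"
  shows "induced_copy dart_graph G"
proof -
  interpret pair_graph G by fact
  have loop: "(u, u) \<notin> parcs G" for u using no_loops' by blast
  have "(z, x) \<notin> parcs G" "(y, b) \<notin> parcs G" "(x, b) \<notin> parcs G" "(z, b) \<notin> parcs G"
    using assms arcs_symmetric by blast+
  note adj = this assms(2-) assms(2-7)[THEN arcs_symmetric]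
  have five: "{..<5} = {0, 1, 2, 3, 4 :: nat}" by auto
  define f where "f p = [a, y, x, z, b] ! p" for p
  have f: "f 0 = a" "f 1 = y" "f (Suc 0) = y" "f 2 = x" "f 3 = z" "f 4 = b"
    by (simp_all add: f_def numeral_eq_Suc)
  have "distinct [a, y, x, z, b]" using adj loop by auto
  then have "inj_on f {..<5}" by (auto simp: five f)
  moreover have "f ` {..<5} \<subseteq> pverts G" using adj by (auto simp: five f dest: wellformed')
  moreover have "\<forall>u\<in>{..<5}. \<forall>v\<in>{..<5}. (f u, f v) \<in> parcs G \<longleftrightarrow> (u, v) \<in> parcs dart_graph"
    unfolding five using adj loop by (simp add: f dart_graph_def edge_list_graph_def)
  ultimately show ?thesis
    unfolding induced_copy_def by (intro exI[of _ f]) (simp add: dart_graph_def edge_list_graph_def)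
qed

text \<open>The vertices by which the side \<open>B\<close> could grow while \<open>A\<close> stays;
  exchanging the two sets gives those for \<open>A\<close>.\<close>

definition extendable :: "'a pair_pre_digraph \<Rightarrow> 'a set \<Rightarrow> 'a set \<Rightarrow> 'a \<Rightarrow> bool" where
  "extendable G A B z \<longleftrightarrow> (\<forall>a\<in>A. (a, z) \<in> parcs G) \<and> (\<forall>b\<in>B. z \<noteq> b \<and> (b, z) \<notin> parcs G)"

text \<open>Asymmetric: \<open>A\<close> is meant as a whole side, \<open>B\<close> as a part of the
  other. Hence \<open>A\<close> must admit no extension, while a vertex addable to \<open>B\<close>
  is harmless if it equals or neighbours an addable vertex of the right colour. A relation
  \<open>S\<close> replaces the colouring because the certificate supplies only this
  relation.\<close>

definition mono_core ::
    "'a pair_pre_digraph \<Rightarrow> ('a \<Rightarrow> 'a \<Rightarrow> bool) \<Rightarrow> 'a set \<Rightarrow> 'a set \<Rightarrow> bool" where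
  "mono_core G S A B \<longleftrightarrow>
     joined G A B \<and> (\<forall>u\<in>A \<union> B. \<forall>v\<in>A \<union> B. S u v) \<and>
     (\<forall>z\<in>pverts G. extendable G A B z \<longrightarrow>
        (\<exists>z'\<in>pverts G. extendable G A B z' \<and> (z' = z \<or> (z', z) \<in> parcs G) \<and> (\<forall>a\<in>A. S a z'))) \<and>
     \<not> (\<exists>w\<in>pverts G. extendable G B A w)"

text \<open>The side \<open>B\<close> is completed by a maximal independent set \<open>I\<close> of
  addable vertices of the right colour. By the third clause of \<open>mono_core\<close> and the
  absence of darts, \<open>I\<close> blocks every other addable vertex, whatever its colour.\<close>

lemma (in pair_graph) mono_core_imp_maximal_biclique:
  assumes dart: "\<not> induced_copy dart_graph G"
    and core: "mono_core G (\<lambda>u v. \<rho> u = \<rho> v) A B" and ne: "A \<noteq> {}" "B \<noteq> {}"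
  shows "\<exists>W. maximal_biclique G W \<and> monochromatic \<rho> W"
proof -
  obtain a b where ab: "a \<in> A" "b \<in> B" using ne by blast
  define C where "C = {z. extendable G A B z \<and> \<rho> a = \<rho> z}"
  have in_V: "z \<in> pverts G" if "extendable G A B z" for z
    using that ab by (auto simp: extendable_def dest: wellformed')
  have "C \<subseteq> pverts G" using in_V by (auto simp: C_def)
  then have "finite C" using pair_finite_verts by (rule finite_subset)
  then obtain I where I: "I \<subseteq> C" "independent G I" "\<forall>z\<in>C. z \<in> I \<or> (\<exists>y\<in>I. (y, z) \<in> parcs G)"
    using ex_maximal_independent by blast
  let ?B = "B \<union> I"
  have J: "joined G A B" using core by (simp add: mono_core_def)
  have ext_I: "extendable G A B y" if "y \<in> I" for y
    using I(1) that by (auto simp: C_def)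
  then have "(b, y) \<notin> parcs G" "(y, b) \<notin> parcs G" if "b \<in> B" "y \<in> I" for b y
    using that arcs_symmetric unfolding extendable_def by blast+
  then have J': "joined G A ?B"
    using J I(2) ext_I unfolding joined_def independent_def extendable_def by blast
  \<comment> \<open>Adjacency of distinct addable vertices is transitive: otherwise
    \<open>a\<close>, \<open>y\<close>, \<open>x\<close>, \<open>z\<close> would form a diamond and
    \<open>b\<close>, adjacent to \<open>a\<close> only, would complete a dart.\<close>
  have cliques: "(x, z) \<in> parcs G"
    if "extendable G A B x" "extendable G A B y" "extendable G A B z"
      "(y, x) \<in> parcs G" "(y, z) \<in> parcs G" "x \<noteq> z" for x y z
  proof (rule ccontr)
    assume "(x, z) \<notin> parcs G"
    then have "induced_copy dart_graph G"
      using that ab J by (intro dart_copyI[OF pair_graph, of a y x z b])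
        (auto simp: extendable_def joined_def)
    then show False using dart by simp
  qed
  have "v \<in> ?B \<or> (\<exists>b\<in>?B. (b, v) \<in> parcs G)" if v: "\<forall>a\<in>A. (a, v) \<in> parcs G" for v
  proof (rule ccontr)
    assume contra: "\<not> ?thesis"
    then have free: "extendable G A B v" using v by (auto simp: extendable_def)
    then obtain z where z: "extendable G A B z" "z = v \<or> (z, v) \<in> parcs G" "\<forall>a\<in>A. \<rho> a = \<rho> z"
      using core in_V unfolding mono_core_def by metis
    then have "z \<in> C" using ab by (simp add: C_def)
    then obtain y where y: "y \<in> I" "y = z \<or> (y, z) \<in> parcs G" using I(3) by blast
    \<comment> \<open>\<open>v\<close> equals or neighbours \<open>z\<close>, and \<open>z\<close>
      equals or neighbours \<open>y\<close>, so by transitivity \<open>y\<close> in \<open>I\<close>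
      blocks \<open>v\<close>.\<close>
    show False
      using contra y z cliques[of y z v] ext_I[OF y(1)] free arcs_symmetric by blast
  qed
  moreover have "v \<in> A \<or> (\<exists>a\<in>A. (a, v) \<in> parcs G)" if v: "\<forall>b\<in>?B. (b, v) \<in> parcs G" for v
  proof (rule ccontr)
    assume "\<not> ?thesis"
    then have "extendable G B A v" using v by (auto simp: extendable_def)
    moreover have "v \<in> pverts G" using v ab by (auto dest: wellformed')
    ultimately show False using core by (auto simp: mono_core_def)
  qed
  ultimately have "maximal_biclique G (A \<union> ?B)"
    using maximal_biclique_iff[OF J'] ne by auto
  moreover have "\<rho> u = \<rho> a" if "u \<in> A \<union> ?B" for u
    using that core ab I(1) by (auto simp: mono_core_def C_def)
  then have "\<rho> u = \<rho> v" if "u \<in> A \<union> ?B" "v \<in> A \<union> ?B" for u v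
    using that by metis
  then have "monochromatic \<rho> (A \<union> ?B)"
    unfolding monochromatic_iff using ab by blast
  ultimately show ?thesis by blast
qed

text \<open>\<open>A\<close> is a whole side of the biclique, and \<open>B\<close> a part of the
  other side that still blocks every extension of \<open>A\<close>. The clause on addable vertices
  is met because the full side blocks each of them.\<close>

lemma (in pair_graph) maximal_biclique_imp_mono_core:
  assumes dart: "\<not> induced_copy dart_graph G" and Kii: "\<not> induced_copy (Kii i) G"
    and max: "maximal_biclique G W" and mono: "monochromatic \<rho> W"
  shows "\<exists>A B. A \<noteq> {} \<and> B \<noteq> {} \<and> card A \<le> i \<and> card B \<le> 2 * i \<and>
    A \<subseteq> pverts G \<and> B \<subseteq> pverts G \<and> mono_core G (\<lambda>u v. \<rho> u = \<rho> v) A B"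
proof -
  have small: "card X < i \<or> card Y < i" if XY: "joined G X Y" "X \<subseteq> pverts G" "Y \<subseteq> pverts G" for X Y
  proof (rule ccontr)
    assume "\<not> ?thesis"
    then obtain X' Y' where "X' \<subseteq> X" "card X' = i" "Y' \<subseteq> Y" "card Y' = i"
      using obtain_subset_with_card_n by (metis not_less)
    moreover from this have "joined G X' Y'" using XY(1) joined_mono by blast
    ultimately have "induced_copy (Kii i) G"
      using XY(2,3) by (intro induced_copy_KiiI[of X' Y']) auto
    then show False using Kii by simp
  qed
  have W: "W \<subseteq> pverts G" using max by (simp add: maximal_biclique_def biclique_def)
  obtain A B where AB: "W = A \<union> B" "A \<noteq> {}" "B \<noteq> {}" "joined G A B" "card A < i"
  proof -
    obtain A B where AB: "W = A \<union> B" "A \<noteq> {}" "B \<noteq> {}" "joined G A B"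
      using max unfolding maximal_biclique_def biclique_iff[OF pair_graph] by blast
    then consider "card A < i" | "card B < i" using small[of A B] W by auto
    then show ?thesis
      using that[of A B] that[of B A] AB joined_commute by cases auto
  qed
  have V: "A \<subseteq> pverts G" "B \<subseteq> pverts G" using AB W by auto
  have fin: "finite A" "finite B" using V pair_finite_verts by (auto intro: finite_subset)
  \<comment> \<open>A nonempty \<open>A\<close> with fewer than \<open>i\<close> vertices forces
    this; below it yields two distinct vertices of \<open>B1\<close>.\<close>
  have i: "2 \<le> i" using AB(2,5) fin(1) by (cases "card A") auto
  have ext: "v \<in> B \<or> (\<exists>b\<in>B. (b, v) \<in> parcs G)" if "\<forall>a\<in>A. (a, v) \<in> parcs G" for v
    using max that maximal_biclique_iff[OF AB(4,2,3)] AB(1) by blast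
  have ext': "\<not> extendable G B A w" for w
    using max maximal_biclique_iff[OF AB(4,2,3)] AB(1) unfolding extendable_def by blast
  obtain B0 where B0: "B0 \<noteq> {}" "B0 \<subseteq> B" "card B0 \<le> 2 * i" "\<And>w. \<not> extendable G B0 A w"
  proof (cases "card B \<le> 2 * i")
    case True
    then show ?thesis using that[of B] AB(3) ext' by blast
  next
    case False
    then obtain B1 where B1: "B1 \<subseteq> B" "card B1 = i"
      using obtain_subset_with_card_n[of i B] by (metis le_trans mult_2 le_add1 nat_le_linear)
    have fin1: "finite B1" using B1 fin by (auto intro: finite_subset)
    obtain b b' where b: "b \<in> B1" "b' \<in> B1" "b \<noteq> b'"
      using i B1(2) by (metis One_nat_def card_le_Suc0_iff_eq fin1 not_less_eq_eq numeral_2_eq_2)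
    let ?Z = "{w. extendable G B1 A w}"
    have "?Z \<subseteq> pverts G" using b(1) by (auto simp: extendable_def dest: wellformed')
    then have "finite ?Z" using pair_finite_verts by (auto intro: finite_subset)
    then obtain I where I: "I \<subseteq> ?Z" "independent G I" "\<forall>z\<in>?Z. z \<in> I \<or> (\<exists>y\<in>I. (y, z) \<in> parcs G)"
      using ex_maximal_independent by blast
    have finI: "finite I" using I(1) \<open>finite ?Z\<close> by (auto intro: finite_subset)
    have "joined G B1 I"
      using I(1,2) B1(1) AB(4) unfolding joined_def independent_def extendable_def by blast
    \<comment> \<open>\<open>B1\<close> already has \<open>i\<close> vertices, so its partner
      \<open>I\<close> must be small.\<close>
    then have cardI: "card I < i"
      using small[of B1 I] B1 V I(1) \<open>?Z \<subseteq> pverts G\<close> by auto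
    \<comment> \<open>By maximality \<open>w\<close> cannot be added to \<open>A\<close>, although
      it is outside \<open>A\<close> and has no neighbour there; so it misses a vertex of
      \<open>B\<close>.\<close>
    have "\<forall>w\<in>I. \<exists>b\<in>B. (b, w) \<notin> parcs G"
      using ext' I(1) unfolding extendable_def by blast
    then obtain h where h: "\<And>w. w \<in> I \<Longrightarrow> h w \<in> B \<and> (h w, w) \<notin> parcs G" by metis
    let ?B = "B1 \<union> h ` I"
    have "\<not> extendable G ?B A w" for w
    proof
      assume w: "extendable G ?B A w"
      then have "extendable G B1 A w" by (auto simp: extendable_def)
      then consider "w \<in> I" | y where "y \<in> I" "(y, w) \<in> parcs G" using I(3) by blast
      then show False
      proof cases
        case 1
        then show ?thesis using w h by (auto simp: extendable_def)
      next
        case 2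
        have y: "extendable G B1 A y" using 2 I(1) by blast
        have B: "(u, v) \<notin> parcs G" if "u \<in> B" "v \<in> B" for u v
          using AB(4) that by (auto simp: joined_def independent_def)
        \<comment> \<open>The center is \<open>w\<close>: it forms a diamond with \<open>y\<close>,
          \<open>b\<close> and \<open>b'\<close>, and \<open>h y\<close> is adjacent to
          \<open>w\<close> but to none of the other three.\<close>
        have "induced_copy dart_graph G"
          using 2 w y b h[OF 2(1)] B B1(1) arcs_symmetric
          by (intro dart_copyI[OF pair_graph, of w y b b' "h y"])
            (auto simp: extendable_def subset_iff)
        then show ?thesis using dart by simp
      qed
    qed
    moreover have "card ?B \<le> 2 * i"
      using card_Un_le[of B1 "h ` I"] card_image_le[OF finI, of h] B1(2) cardI by linarith
    moreover have "?B \<subseteq> B" "?B \<noteq> {}" using B1(1) b(1) h by auto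
    ultimately show ?thesis by (intro that[of ?B])
  qed
  have same: "\<rho> u = \<rho> v" if "u \<in> A \<union> B" "v \<in> A \<union> B" for u v
    by (rule bspec[OF bspec[OF conjunct2[OF mono[unfolded monochromatic_iff AB(1)]]]]) (fact that)+
  \<comment> \<open>The vertex of the full side that blocks \<open>z\<close> lies outside
    \<open>B0\<close>, is addable itself, and has the common colour.\<close>
  have free: "\<exists>z'\<in>pverts G. extendable G A B0 z' \<and> (z' = z \<or> (z', z) \<in> parcs G) \<and> (\<forall>a\<in>A. \<rho> a = \<rho> z')"
    if z: "extendable G A B0 z" for z
  proof -
    obtain b where b: "b \<in> B" "b = z \<or> (b, z) \<in> parcs G"
      using ext z unfolding extendable_def by blast
    have "b \<notin> B0" using b z by (auto simp: extendable_def)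
    then have "extendable G A B0 b"
      using b(1) AB(4) B0(2) by (auto simp: extendable_def joined_def independent_def)
    then show ?thesis using b V same by blast
  qed
  have "mono_core G (\<lambda>u v. \<rho> u = \<rho> v) A B0"
    unfolding mono_core_def
  proof (intro conjI)
    show "joined G A B0" using AB(4) B0(2) joined_mono by blast
    show "\<forall>u\<in>A \<union> B0. \<forall>v\<in>A \<union> B0. \<rho> u = \<rho> v"
      by (intro ballI same) (use B0(2) in auto)
    show "\<not> (\<exists>w\<in>pverts G. extendable G B0 A w)" using B0(4) by blast
  qed (intro ballI impI free)
  then show ?thesis using AB(2,5) B0(1-3) V by (intro exI[of _ A] exI[of _ B0]) auto
qed

section \<open>A first-order description of the problem\<close>

definition Forall :: "fm \<Rightarrow> fm" where
  "Forall \<phi> = Neg (Exists (Neg \<phi>))"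

definition Disj :: "fm \<Rightarrow> fm \<Rightarrow> fm" where
  "Disj \<phi> \<psi> = Neg (Conj (Neg \<phi>) (Neg \<psi>))"

definition Imp :: "fm \<Rightarrow> fm \<Rightarrow> fm" where
  "Imp \<phi> \<psi> = Neg (Conj \<phi> (Neg \<psi>))"

fun conjs :: "fm list \<Rightarrow> fm" where
  "conjs [] = Eq 0 0"
| "conjs (\<phi> # \<phi>s) = Conj \<phi> (conjs \<phi>s)"

fun exs :: "nat \<Rightarrow> fm \<Rightarrow> fm" where
  "exs 0 \<phi> = \<phi>"
| "exs (Suc m) \<phi> = Exists (exs m \<phi>)"

lemma sat_All [simp]: "sat n w (Forall \<phi>) xs \<longleftrightarrow> (\<forall>v<n. sat n w \<phi> (xs @ [v]))"
  by (simp add: Forall_def)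

lemma sat_Disj [simp]: "sat n w (Disj \<phi> \<psi>) xs \<longleftrightarrow> sat n w \<phi> xs \<or> sat n w \<psi> xs"
  by (simp add: Disj_def)

lemma sat_Imp [simp]: "sat n w (Imp \<phi> \<psi>) xs \<longleftrightarrow> (sat n w \<phi> xs \<longrightarrow> sat n w \<psi> xs)"
  by (simp add: Imp_def)

lemma sat_conjs [simp]: "sat n w (conjs \<phi>s) xs \<longleftrightarrow> (\<forall>\<phi>\<in>set \<phi>s. sat n w \<phi> xs)"
  by (induction \<phi>s) auto

lemma sat_exs [simp]:
  "sat n w (exs m \<phi>) xs \<longleftrightarrow> (\<exists>ys. length ys = m \<and> set ys \<subseteq> {..<n} \<and> sat n w \<phi> (xs @ ys))"
proof (induction m arbitrary: xs)
  case (Suc m)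
  have "sat n w (exs (Suc m) \<phi>) xs \<longleftrightarrow>
      (\<exists>v<n. \<exists>ys. length ys = m \<and> set ys \<subseteq> {..<n} \<and> sat n w \<phi> (xs @ v # ys))"
    by (simp add: Suc.IH)
  also have "\<dots> \<longleftrightarrow> (\<exists>ys. length ys = Suc m \<and> set ys \<subseteq> {..<n} \<and> sat n w \<phi> (xs @ ys))"
  proof
    assume "\<exists>v<n. \<exists>ys. length ys = m \<and> set ys \<subseteq> {..<n} \<and> sat n w \<phi> (xs @ v # ys)"
    then obtain v ys where "v < n" "length ys = m" "set ys \<subseteq> {..<n}" "sat n w \<phi> (xs @ v # ys)" by blast
    then show "\<exists>ys. length ys = Suc m \<and> set ys \<subseteq> {..<n} \<and> sat n w \<phi> (xs @ ys)"
      by (intro exI[of _ "v # ys"]) auto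
  next
    assume "\<exists>ys. length ys = Suc m \<and> set ys \<subseteq> {..<n} \<and> sat n w \<phi> (xs @ ys)"
    then obtain ys where ys: "length ys = Suc m" "set ys \<subseteq> {..<n}" "sat n w \<phi> (xs @ ys)" by blast
    then obtain v zs where "ys = v # zs" by (cases ys) auto
    then show "\<exists>v<n. \<exists>ys. length ys = m \<and> set ys \<subseteq> {..<n} \<and> sat n w \<phi> (xs @ v # ys)"
      using ys by auto
  qed
  finally show ?case .
qed auto

section \<open>Relations and graphs coded in a word\<close>

text \<open>Symbol 2 is the bit \<open>True\<close>. The separator and the blanks behind the word
  count as false.\<close>

definition rel :: "nat \<Rightarrow> (nat \<Rightarrow> nat) \<Rightarrow> nat \<Rightarrow> nat \<Rightarrow> nat \<Rightarrow> bool" where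
  "rel n w r u v \<longleftrightarrow> w ((r * n + 1 + u) * n + v + 1) = 2"

definition Rel :: "nat \<Rightarrow> nat \<Rightarrow> nat \<Rightarrow> fm" where
  "Rel r i j = Sym r i j 2"

lemma sat_Rel [simp]: "sat n w (Rel r i j) xs \<longleftrightarrow> rel n w r (val xs i) (val xs j)"
  by (simp add: Rel_def rel_def)

definition word_graph :: "nat \<Rightarrow> (nat \<Rightarrow> nat) \<Rightarrow> nat pair_pre_digraph" where
  "word_graph n w = \<lparr>pverts = {..<n}, parcs = {(u, v). u < n \<and> v < n \<and> rel n w 0 u v}\<rparr>"

lemma pverts_word_graph [simp]: "pverts (word_graph n w) = {..<n}"
  by (simp add: word_graph_def)

lemma parcs_word_graph [simp]: "(u, v) \<in> parcs (word_graph n w) \<longleftrightarrow> u < n \<and> v < n \<and> rel n w 0 u v"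
  by (simp add: word_graph_def)

section \<open>Graph axioms and connectivity\<close>

definition graph_fm :: fm where
  "graph_fm = Conj (Forall (Neg (Rel 0 0 0))) (Forall (Forall (Imp (Rel 0 0 1) (Rel 0 1 0))))"

lemma sat_graph_fm: "sat n w graph_fm [] \<longleftrightarrow> pair_graph (word_graph n w)"
proof
  assume "sat n w graph_fm []"
  then have *: "\<And>u. u < n \<Longrightarrow> \<not> rel n w 0 u u"
    "\<And>u v. u < n \<Longrightarrow> v < n \<Longrightarrow> rel n w 0 u v \<Longrightarrow> rel n w 0 v u"
    by (auto simp: graph_fm_def val_def)
  have "parcs (word_graph n w) \<subseteq> {..<n} \<times> {..<n}" by auto
  then have "finite (parcs (word_graph n w))" by (rule finite_subset) simp
  then show "pair_graph (word_graph n w)"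
    using * by unfold_locales (auto simp: symmetric_def intro!: symI)
next
  assume "pair_graph (word_graph n w)"
  then interpret pair_graph "word_graph n w" .
  have "\<not> rel n w 0 u u" if "u < n" for u
    using no_loops'[of u u] that by auto
  moreover have "rel n w 0 v u" if "u < n" "v < n" "rel n w 0 u v" for u v
    using arcs_symmetric[of u v] that by simp
  ultimately show "sat n w graph_fm []"
    by (auto simp: graph_fm_def val_def)
qed

text \<open>An index beyond the list of bound variables denotes vertex 0, here the root of the search order.\<close>

definition connected_fm :: fm where
  "connected_fm = conjs
     [Forall (Neg (Rel 1 0 0)),
      Forall (Forall (Forall (Imp (Conj (Rel 1 0 1) (Rel 1 1 2)) (Rel 1 0 2)))),
      Forall (Disj (Eq 0 1) (Exists (Conj (Rel 0 1 0) (Rel 1 1 0))))]"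

definition search_order :: "'a pair_pre_digraph \<Rightarrow> 'a \<Rightarrow> ('a \<Rightarrow> 'a \<Rightarrow> bool) \<Rightarrow> bool" where
  "search_order G r D \<longleftrightarrow>
     (\<forall>u\<in>pverts G. \<not> D u u) \<and>
     (\<forall>u\<in>pverts G. \<forall>v\<in>pverts G. \<forall>x\<in>pverts G. D u v \<and> D v x \<longrightarrow> D u x) \<and>
     (\<forall>v\<in>pverts G. v = r \<or> (\<exists>u\<in>pverts G. (u, v) \<in> parcs G \<and> D u v))"

lemma search_order_cong:
  assumes "\<And>u v. u \<in> pverts G \<Longrightarrow> v \<in> pverts G \<Longrightarrow> D u v \<longleftrightarrow> D' u v"
  shows "search_order G r D \<longleftrightarrow> search_order G r D'"
  unfolding search_order_def by (simp add: assms cong: ball_cong bex_cong)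

lemma sat_connected_fm:
  "sat n w connected_fm [] \<longleftrightarrow> search_order (word_graph n w) 0 (rel n w 1)"
proof -
  have "sat n w (Forall (Neg (Rel 1 0 0))) [] \<longleftrightarrow> (\<forall>u\<in>{..<n}. \<not> rel n w 1 u u)"
    "sat n w (Forall (Forall (Forall (Imp (Conj (Rel 1 0 1) (Rel 1 1 2)) (Rel 1 0 2))))) [] \<longleftrightarrow>
      (\<forall>u\<in>{..<n}. \<forall>v\<in>{..<n}. \<forall>x\<in>{..<n}. rel n w 1 u v \<and> rel n w 1 v x \<longrightarrow> rel n w 1 u x)"
    by (simp_all add: val_def nth_append Ball_def)
  moreover have "sat n w (Forall (Disj (Eq 0 1) (Exists (Conj (Rel 0 1 0) (Rel 1 1 0))))) [] \<longleftrightarrow>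
      (\<forall>v\<in>{..<n}. v = 0 \<or> (\<exists>u\<in>{..<n}. (u, v) \<in> parcs (word_graph n w) \<and> rel n w 1 u v))"
    by (auto simp: val_def nth_append)
  ultimately show ?thesis
    unfolding connected_fm_def search_order_def conjs.simps sat.simps(2,4) pverts_word_graph
    by (simp only: simp_thms)
qed

lemma (in pair_graph) mk_symmetric_id: "mk_symmetric (with_proj G) = G"
proof -
  have "(\<Union>e\<in>parcs G. {(fst e, snd e), (snd e, fst e)}) = parcs G"
    using arcs_symmetric by auto
  then show ?thesis by (simp add: mk_symmetric_def)
qed

lemma (in pair_graph) connected_iff:
  "connected (with_proj G) \<longleftrightarrow> pverts G \<noteq> {} \<and> (\<forall>u\<in>pverts G. \<forall>v\<in>pverts G. u \<rightarrow>\<^sup>*\<^bsub>with_proj G\<^esub> v)"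
  by (simp add: connected_def mk_symmetric_id strongly_connected_def)

text \<open>A strict order on finitely many vertices is well founded, so moving to smaller
  neighbours ends, and it can end only at \<open>r\<close>.\<close>

lemma (in pair_graph) search_order_imp_connected:
  assumes r: "r \<in> pverts G" and D: "search_order G r D"
  shows "connected (with_proj G)"
proof -
  define R where "R = {(u, v). u \<in> pverts G \<and> v \<in> pverts G \<and> D u v}"
  have "R \<subseteq> pverts G \<times> pverts G" by (auto simp: R_def)
  then have "finite R" using pair_finite_verts by (meson finite_SigmaI finite_subset)
  moreover have "trans R" "irrefl R"
    using D by (auto simp: R_def search_order_def irrefl_def intro!: transI)
  then have "acyclic R" by (simp add: acyclic_irrefl trancl_id)
  ultimately have wf: "wf R" by (rule finite_acyclic_wf)
  have reach: "v \<in> pverts G \<longrightarrow> r \<rightarrow>\<^sup>*\<^bsub>with_proj G\<^esub> v" for v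
    using wf
  proof (induction v rule: wf_induct_rule)
    case (less v)
    show ?case
    proof
      assume v: "v \<in> pverts G"
      show "r \<rightarrow>\<^sup>*\<^bsub>with_proj G\<^esub> v"
      proof (cases "v = r")
        case True
        then show ?thesis using reachable_refl[OF r] by simp
      next
        case False
        then obtain u where u: "u \<in> pverts G" "(u, v) \<in> parcs G" "D u v"
          using D v unfolding search_order_def by blast
        then have "r \<rightarrow>\<^sup>*\<^bsub>with_proj G\<^esub> u" using less[of u] v by (simp add: R_def)
        then show ?thesis by (rule reachable_adj_trans) (simp add: u(2))
      qed
    qed
  qed
  show ?thesis
    unfolding connected_iff
  proof (intro conjI ballI)
    show "pverts G \<noteq> {}" using r by blast
    fix u v assume "u \<in> pverts G" "v \<in> pverts G"
    then have "r \<rightarrow>\<^sup>*\<^bsub>with_proj G\<^esub> u" "r \<rightarrow>\<^sup>*\<^bsub>with_proj G\<^esub> v"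
      using reach by simp_all
    then show "u \<rightarrow>\<^sup>*\<^bsub>with_proj G\<^esub> v"
      using symmetric_reachable[OF sym_arcs] reachable_trans by metis
  qed
qed

text \<open>Vertices are compared by their distance from \<open>r\<close>; the last but one vertex
  of a shortest walk is a smaller neighbour.\<close>

lemma (in pair_graph) connected_imp_search_order:
  assumes r: "r \<in> pverts G" and conn: "connected (with_proj G)"
  shows "\<exists>D. search_order G r D"
proof -
  define d where "d v = (LEAST l. (r, v) \<in> parcs G ^^ l)" for v
  have path: "(r, v) \<in> parcs G ^^ d v" if "v \<in> pverts G" for v
  proof -
    have "(r, v) \<in> (parcs G)\<^sup>*"
      using conn r that reachable_rtranclI[of "with_proj G" r v] by (auto simp: connected_iff)
    then obtain l where "(r, v) \<in> parcs G ^^ l" by (auto simp: rtrancl_power)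
    then show ?thesis unfolding d_def by (rule LeastI)
  qed
  have "\<exists>u\<in>pverts G. (u, v) \<in> parcs G \<and> d u < d v" if v: "v \<in> pverts G" "v \<noteq> r" for v
  proof (cases "d v")
    case 0
    then show ?thesis using path[OF v(1)] v(2) by simp
  next
    case (Suc l)
    then obtain u where u: "(r, u) \<in> parcs G ^^ l" "(u, v) \<in> parcs G"
      using path[OF v(1)] by auto
    have "d u \<le> l" unfolding d_def by (rule Least_le) (rule u(1))
    then show ?thesis using u(2) Suc wellformed' by auto
  qed
  then have "search_order G r (\<lambda>u v. d u < d v)"
    unfolding search_order_def by auto
  then show ?thesis by blast
qed

section \<open>Colorings as equivalence relations\<close>

text \<open>The last conjunct bounds the number of colour classes: no \<open>k + 1\<close> vertices
  have pairwise different colours. Pairs \<open>a < b\<close> suffice by symmetry.\<close>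

definition colour_fm :: "nat \<Rightarrow> fm" where
  "colour_fm k = conjs
     [Forall (Rel 2 0 0),
      Forall (Forall (Imp (Rel 2 0 1) (Rel 2 1 0))),
      Forall (Forall (Forall (Imp (Conj (Rel 2 0 1) (Rel 2 1 2)) (Rel 2 0 2)))),
      Neg (exs (Suc k) (conjs (concat (map (\<lambda>b. map (\<lambda>a. Neg (Rel 2 a b)) [0..<b]) [0..<Suc k]))))]"

definition same_colour :: "nat \<Rightarrow> 'a set \<Rightarrow> ('a \<Rightarrow> 'a \<Rightarrow> bool) \<Rightarrow> bool" where
  "same_colour k V S \<longleftrightarrow> (\<exists>\<rho>. \<rho> ` V \<subseteq> {1..k} \<and> (\<forall>u\<in>V. \<forall>v\<in>V. S u v \<longleftrightarrow> \<rho> u = \<rho> v))"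

lemma same_colour_iff:
  assumes "finite V"
  shows "same_colour k V S \<longleftrightarrow>
    (\<forall>u\<in>V. S u u) \<and> (\<forall>u\<in>V. \<forall>v\<in>V. S u v \<longrightarrow> S v u) \<and>
    (\<forall>u\<in>V. \<forall>v\<in>V. \<forall>x\<in>V. S u v \<and> S v x \<longrightarrow> S u x) \<and>
    \<not> (\<exists>ys. length ys = Suc k \<and> set ys \<subseteq> V \<and> (\<forall>b<Suc k. \<forall>a<b. \<not> S (ys ! a) (ys ! b)))"
    (is "_ \<longleftrightarrow> ?refl \<and> ?sym \<and> ?trans \<and> ?bound")
proof
  assume "same_colour k V S"
  then obtain \<rho> where \<rho>: "\<rho> ` V \<subseteq> {1..k}" "\<forall>u\<in>V. \<forall>v\<in>V. S u v \<longleftrightarrow> \<rho> u = \<rho> v"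
    unfolding same_colour_def by blast
  have ?bound
  proof
    assume "\<exists>ys. length ys = Suc k \<and> set ys \<subseteq> V \<and> (\<forall>b<Suc k. \<forall>a<b. \<not> S (ys ! a) (ys ! b))"
    then obtain ys where ys: "length ys = Suc k" "set ys \<subseteq> V"
      "\<forall>b<Suc k. \<forall>a<b. \<not> S (ys ! a) (ys ! b)" by blast
    have V: "ys ! a \<in> V" if "a < Suc k" for a using ys(1,2) that nth_mem by fastforce
    have neq: "\<rho> (ys ! a) \<noteq> \<rho> (ys ! b)" if "a < b" "b < Suc k" for a b
      using that ys(3) \<rho>(2) V[of a] V[of b] by auto
    have "distinct (map \<rho> ys)"
      unfolding distinct_conv_nth
    proof (intro allI impI)
      fix a b assume "a < length (map \<rho> ys)" "b < length (map \<rho> ys)" "a \<noteq> b"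
      then show "map \<rho> ys ! a \<noteq> map \<rho> ys ! b"
        using neq[of a b] neq[of b a] ys(1) by (cases "a < b") auto
    qed
    then have "card (set (map \<rho> ys)) = Suc k" using ys(1) by (simp only: distinct_card length_map)
    moreover have "card (set (map \<rho> ys)) \<le> card {1..k}"
      using \<rho>(1) ys(2) by (intro card_mono) auto
    ultimately show False by simp
  qed
  moreover have "?refl \<and> ?sym \<and> ?trans" using \<rho>(2) by simp
  ultimately show "?refl \<and> ?sym \<and> ?trans \<and> ?bound" by blast
next
  assume "?refl \<and> ?sym \<and> ?trans \<and> ?bound"
  then have R: ?refl and S: ?sym and T: ?trans and B: ?bound by blast+
  \<comment> \<open>\<open>c u\<close> is the equivalence class of \<open>u\<close>; the colour of
    \<open>u\<close> will be the number of this class, counted from 1.\<close>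
  define c where "c u = {v \<in> V. S u v}" for u
  have c: "c u = c v \<longleftrightarrow> S u v" if "u \<in> V" "v \<in> V" for u v
  proof
    assume "c u = c v"
    then have "v \<in> c u" using R that by (simp add: c_def)
    then show "S u v" by (simp add: c_def)
  next
    assume "S u v"
    then show "c u = c v" using that S T unfolding c_def by blast
  qed
  \<comment> \<open>Representatives of \<open>k + 1\<close> classes would be pairwise
    unrelated.\<close>
  have "card (c ` V) \<le> k"
  proof (rule ccontr)
    assume "\<not> ?thesis"
    then have "Suc k \<le> card (c ` V)" by simp
    from obtain_subset_with_card_n[OF this] obtain X where X: "X \<subseteq> c ` V" "card X = Suc k"
      by metis
    obtain U where U: "U \<subseteq> V" "inj_on c U" "c ` U = X"
      using X(1) unfolding subset_image_inj by blast
    then have "card U = Suc k" using X(2) card_image by metis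
    moreover from U(1) assms have "finite U" by (rule finite_subset)
    moreover from finite_distinct_list[OF this] obtain ys where "set ys = U" "distinct ys"
      by blast
    ultimately have ys: "set ys = U" "distinct ys" "length ys = Suc k"
      using distinct_card[of ys] by auto
    have "\<not> S (ys ! a) (ys ! b)" if "a < b" "b < Suc k" for a b
    proof -
      have "ys ! a \<in> U" "ys ! b \<in> U" using that ys by auto
      moreover have "ys ! a \<noteq> ys ! b" using that ys by (simp add: nth_eq_iff_index_eq)
      ultimately show ?thesis using U(1,2) c[of "ys ! a" "ys ! b"] by (auto dest: inj_onD)
    qed
    then show False using B ys(1,3) U(1) by blast
  qed
  obtain h where h: "bij_betw h (c ` V) {0..<card (c ` V)}"
    using ex_bij_betw_finite_nat assms by blast
  define \<rho> where "\<rho> u = Suc (h (c u))" for u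
  have "\<rho> ` V \<subseteq> {1..k}"
  proof
    fix x assume "x \<in> \<rho> ` V"
    then obtain u where "u \<in> V" "x = Suc (h (c u))" by (auto simp: \<rho>_def)
    then show "x \<in> {1..k}"
      using bij_betwE[OF h, rule_format, of "c u"] \<open>card (c ` V) \<le> k\<close> by auto
  qed
  moreover have "S u v \<longleftrightarrow> \<rho> u = \<rho> v" if "u \<in> V" "v \<in> V" for u v
    using c[OF that] inj_on_eq_iff[OF bij_betw_imp_inj_on[OF h], of "c u" "c v"] that
    by (simp add: \<rho>_def)
  ultimately show "same_colour k V S" unfolding same_colour_def by blast
qed

lemma val_append: "a < length ys \<Longrightarrow> val (ys @ zs) a = ys ! a"
  by (simp add: val_def nth_append)

lemma val_nth: "a < length ys \<Longrightarrow> val ys a = ys ! a"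
  by (simp add: val_def)

lemma sat_colour_fm: "sat n w (colour_fm k) [] \<longleftrightarrow> same_colour k {..<n} (rel n w 2)"
proof -
  have "(\<exists>ys. length ys = Suc k \<and> set ys \<subseteq> {..<n} \<and>
        (\<forall>b<Suc k. \<forall>a<b. \<not> rel n w 2 (val ys a) (val ys b))) \<longleftrightarrow>
      (\<exists>ys. length ys = Suc k \<and> set ys \<subseteq> {..<n} \<and>
        (\<forall>b<Suc k. \<forall>a<b. \<not> rel n w 2 (ys ! a) (ys ! b)))"
    by (intro ex_cong conj_cong refl) (auto simp: val_nth)
  moreover have "sat n w (exs (Suc k) (conjs (concat (map (\<lambda>b. map (\<lambda>a. Neg (Rel 2 a b)) [0..<b]) [0..<Suc k])))) []
      \<longleftrightarrow> (\<exists>ys. length ys = Suc k \<and> set ys \<subseteq> {..<n} \<and>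
        (\<forall>b<Suc k. \<forall>a<b. \<not> rel n w 2 (val ys a) (val ys b)))"
    unfolding sat_exs sat_conjs by (auto simp del: upt_Suc)
  moreover have "sat n w (Forall (Rel 2 0 0)) [] \<longleftrightarrow> (\<forall>u\<in>{..<n}. rel n w 2 u u)"
    "sat n w (Forall (Forall (Imp (Rel 2 0 1) (Rel 2 1 0)))) [] \<longleftrightarrow>
      (\<forall>u\<in>{..<n}. \<forall>v\<in>{..<n}. rel n w 2 u v \<longrightarrow> rel n w 2 v u)"
    "sat n w (Forall (Forall (Forall (Imp (Conj (Rel 2 0 1) (Rel 2 1 2)) (Rel 2 0 2))))) [] \<longleftrightarrow>
      (\<forall>u\<in>{..<n}. \<forall>v\<in>{..<n}. \<forall>x\<in>{..<n}. rel n w 2 u v \<and> rel n w 2 v x \<longrightarrow> rel n w 2 u x)"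
    by (simp_all add: val_def nth_append Ball_def)
  ultimately show ?thesis
    unfolding same_colour_iff[OF finite_lessThan] colour_fm_def conjs.simps sat.simps(2,3,4)
    by (simp only: simp_thms)
qed

section \<open>Excluding induced subgraphs\<close>

text \<open>The vertices of \<open>F\<close> are numbers below \<open>p\<close> and serve directly
  as variables. The equality atoms make the embedding injective.\<close>

definition no_copy_fm :: "nat pair_pre_digraph \<Rightarrow> fm" where
  "no_copy_fm F =
     (let p = card (pverts F) in
      Neg (exs p (conjs (concat (map (\<lambda>u. map (\<lambda>v.
        Conj (if (u, v) \<in> parcs F then Rel 0 u v else Neg (Rel 0 u v))
             (if u = v then Eq u v else Neg (Eq u v))) [0..<p]) [0..<p])))))"

lemma sat_no_copy_fm:
  assumes "pverts F = {..<p}"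
  shows "sat n w (no_copy_fm F) [] \<longleftrightarrow> \<not> induced_copy F (word_graph n w)"
proof -
  have "sat n w (no_copy_fm F) [] \<longleftrightarrow>
      \<not> (\<exists>ys. length ys = p \<and> set ys \<subseteq> {..<n} \<and> (\<forall>u<p. \<forall>v<p.
          (rel n w 0 (val ys u) (val ys v) \<longleftrightarrow> (u, v) \<in> parcs F) \<and> (val ys u = val ys v \<longleftrightarrow> u = v)))"
  proof -
    have atom: "sat n w (Conj (if (u, v) \<in> parcs F then Rel 0 u v else Neg (Rel 0 u v))
          (if u = v then Eq u v else Neg (Eq u v))) ys \<longleftrightarrow>
        (rel n w 0 (val ys u) (val ys v) \<longleftrightarrow> (u, v) \<in> parcs F) \<and> (val ys u = val ys v \<longleftrightarrow> u = v)"
      for u v ys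
      by simp
    have matrix: "(\<forall>\<phi>\<in>set (concat (map (\<lambda>u. map (P u) [0..<p]) [0..<p])). sat n w \<phi> ys) \<longleftrightarrow>
        (\<forall>u<p. \<forall>v<p. sat n w (P u v) ys)" for P ys
      by auto
    show ?thesis
      unfolding no_copy_fm_def Let_def assms card_lessThan sat.simps(3) sat_exs sat_conjs matrix atom
        append_Nil ..
  qed
  also have "\<dots> \<longleftrightarrow> \<not> induced_copy F (word_graph n w)"
  proof -
    have "(\<exists>ys. length ys = p \<and> set ys \<subseteq> {..<n} \<and> (\<forall>u<p. \<forall>v<p.
          (rel n w 0 (val ys u) (val ys v) \<longleftrightarrow> (u, v) \<in> parcs F) \<and> (val ys u = val ys v \<longleftrightarrow> u = v)))
        \<longleftrightarrow> induced_copy F (word_graph n w)" (is "?L \<longleftrightarrow> _")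
    proof
      assume ?L
      then obtain ys where ys: "length ys = p" "set ys \<subseteq> {..<n}"
        "\<And>u v. u < p \<Longrightarrow> v < p \<Longrightarrow> rel n w 0 (val ys u) (val ys v) \<longleftrightarrow> (u, v) \<in> parcs F"
        "\<And>u v. u < p \<Longrightarrow> v < p \<Longrightarrow> val ys u = val ys v \<longleftrightarrow> u = v" by blast
      have "val ys u < n" if "u < p" for u
        using subsetD[OF ys(2) nth_mem[of u ys]] ys(1) that by (simp add: val_nth)
      then show "induced_copy F (word_graph n w)"
        unfolding induced_copy_def assms using ys(3,4)
        by (intro exI[of _ "val ys"]) (auto simp: inj_on_def)
    next
      assume "induced_copy F (word_graph n w)"
      then obtain f where f: "inj_on f {..<p}" "f ` {..<p} \<subseteq> {..<n}"
        "\<forall>u<p. \<forall>v<p. (f u, f v) \<in> parcs (word_graph n w) \<longleftrightarrow> (u, v) \<in> parcs F"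
        unfolding induced_copy_def assms by auto
      have "val (map f [0..<p]) u = f u" if "u < p" for u
        using that by (simp add: val_nth)
      moreover have "f u < n" if "u < p" for u using f(2) that by auto
      ultimately show ?L
        using f(1,3) by (intro exI[of _ "map f [0..<p]"]) (auto simp: inj_on_eq_iff)
    qed
    then show ?thesis by simp
  qed
  finally show ?thesis .
qed

section \<open>Cores in the first-order language\<close>

definition extendable_fm :: "nat list \<Rightarrow> nat list \<Rightarrow> nat \<Rightarrow> fm" where
  "extendable_fm I J z =
     Conj (conjs (map (\<lambda>a. Rel 0 a z) I)) (conjs (map (\<lambda>b. Conj (Neg (Eq z b)) (Neg (Rel 0 b z))) J))"

definition all_pairs_fm :: "(nat \<Rightarrow> nat \<Rightarrow> fm) \<Rightarrow> nat list \<Rightarrow> nat list \<Rightarrow> fm" where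
  "all_pairs_fm P I J = conjs (concat (map (\<lambda>a. map (P a) J) I))"

text \<open>As variables are levels, the next quantifier below \<open>z\<close> others binds
  \<open>z\<close>, and the one inside it \<open>Suc z\<close>.\<close>

definition core_fm :: "nat list \<Rightarrow> nat list \<Rightarrow> nat \<Rightarrow> fm" where
  "core_fm I J z = conjs
     [all_pairs_fm (\<lambda>a b. Neg (Rel 0 a b)) I I, all_pairs_fm (\<lambda>a b. Neg (Rel 0 a b)) J J,
      all_pairs_fm (Rel 0) I J, all_pairs_fm (Rel 2) (I @ J) (I @ J),
      Forall (Imp (extendable_fm I J z)
        (Exists (conjs [extendable_fm I J (Suc z), Disj (Eq (Suc z) z) (Rel 0 (Suc z) z),
           conjs (map (\<lambda>a. Rel 2 a (Suc z)) I)]))),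
      Neg (Exists (extendable_fm J I z))]"

text \<open>The \<open>i\<close> variables for \<open>A\<close> and \<open>2 * i\<close> for
  \<open>B\<close> match the bounds of \<open>maximal_biclique_imp_mono_core\<close>; smaller sets
  arise from repeated values.\<close>

definition no_core_fm :: "nat \<Rightarrow> fm" where
  "no_core_fm i = Neg (exs (3 * i) (core_fm [0..<i] [i..<3 * i] (3 * i)))"

lemma sat_extendable_fm:
  assumes "val xs ` set I = A" "val xs ` set J = B" "val xs z = v" "A \<subseteq> {..<n}" "B \<subseteq> {..<n}" "v < n"
  shows "sat n w (extendable_fm I J z) xs \<longleftrightarrow> extendable (word_graph n w) A B v"
  using assms by (auto simp: extendable_fm_def extendable_def)

lemma sat_all_pairs_fm:
  assumes "\<And>a b. sat n w (P a b) xs \<longleftrightarrow> Q (val xs a) (val xs b)"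
  shows "sat n w (all_pairs_fm P I J) xs \<longleftrightarrow> (\<forall>u\<in>val xs ` set I. \<forall>v\<in>val xs ` set J. Q u v)"
  using assms by (auto simp: all_pairs_fm_def)

lemma joined_word_graph_iff:
  assumes "A \<subseteq> {..<n}" "B \<subseteq> {..<n}"
  shows "joined (word_graph n w) A B \<longleftrightarrow>
    (\<forall>u\<in>A. \<forall>v\<in>A. \<not> rel n w 0 u v) \<and> (\<forall>u\<in>B. \<forall>v\<in>B. \<not> rel n w 0 u v) \<and>
    (\<forall>u\<in>A. \<forall>v\<in>B. rel n w 0 u v)"
proof -
  have "u < n" if "u \<in> A \<or> u \<in> B" for u using that assms by auto
  then show ?thesis unfolding joined_def independent_def by (auto simp: word_graph_def)
qed

lemma sat_core_fm:
  assumes len: "length xs = z" and I: "set I \<subseteq> {..<z}" and J: "set J \<subseteq> {..<z}" and xs: "set xs \<subseteq> {..<n}"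
  shows "sat n w (core_fm I J z) xs \<longleftrightarrow>
    mono_core (word_graph n w) (rel n w 2) (val xs ` set I) (val xs ` set J)"
proof -
  let ?A = "val xs ` set I" and ?B = "val xs ` set J"
  let ?G = "word_graph n w"
  have less: "val xs a < n" if "a < z" for a
    using subsetD[OF xs nth_mem[of a xs]] len that by (simp add: val_nth)
  have AB: "?A \<subseteq> {..<n}" "?B \<subseteq> {..<n}" using I J less by auto
  \<comment> \<open>Binding further variables does not change the values of those below
    \<open>z\<close>.\<close>
  have im: "val (xs @ ys) ` set I = ?A" "val (xs @ ys) ` set J = ?B" for ys
    using I J len by (auto simp: val_append val_nth subset_iff intro!: image_cong)
  have v: "val (xs @ [v]) z = v" "val (xs @ [v, v']) z = v" "val (xs @ [v, v']) (Suc z) = v'" for v v'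
    using len by (auto simp: val_def nth_append)
  have e1: "sat n w (extendable_fm I J z) (xs @ [v]) \<longleftrightarrow> extendable ?G ?A ?B v" if "v < n" for v
    by (rule sat_extendable_fm) (use im[of "[v]"] AB v that in auto)
  have e2: "sat n w (extendable_fm I J (Suc z)) (xs @ [v, v']) \<longleftrightarrow> extendable ?G ?A ?B v'"
    if "v' < n" for v v'
    by (rule sat_extendable_fm) (use im[of "[v, v']"] AB v that in auto)
  have e3: "sat n w (extendable_fm J I z) (xs @ [v]) \<longleftrightarrow> extendable ?G ?B ?A v" if "v < n" for v
    by (rule sat_extendable_fm) (use im[of "[v]"] AB v that in auto)
  have e4: "(\<forall>a\<in>set I. rel n w 2 (val (xs @ [v, v']) a) v') \<longleftrightarrow> (\<forall>a\<in>?A. rel n w 2 a v')" for v v'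
    unfolding im(1)[of "[v, v']", symmetric] by simp
  have joined: "joined ?G ?A ?B \<longleftrightarrow>
      (\<forall>u\<in>?A. \<forall>v\<in>?A. \<not> rel n w 0 u v) \<and> (\<forall>u\<in>?B. \<forall>v\<in>?B. \<not> rel n w 0 u v) \<and>
      (\<forall>u\<in>?A. \<forall>v\<in>?B. rel n w 0 u v)"
    by (rule joined_word_graph_iff) (fact AB)+
  have pairs: "sat n w (all_pairs_fm (\<lambda>a b. Neg (Rel 0 a b)) I I) xs \<longleftrightarrow> (\<forall>u\<in>?A. \<forall>v\<in>?A. \<not> rel n w 0 u v)"
    "sat n w (all_pairs_fm (\<lambda>a b. Neg (Rel 0 a b)) J J) xs \<longleftrightarrow> (\<forall>u\<in>?B. \<forall>v\<in>?B. \<not> rel n w 0 u v)"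
    "sat n w (all_pairs_fm (Rel 0) I J) xs \<longleftrightarrow> (\<forall>u\<in>?A. \<forall>v\<in>?B. rel n w 0 u v)"
    "sat n w (all_pairs_fm (Rel 2) (I @ J) (I @ J)) xs \<longleftrightarrow> (\<forall>u\<in>?A \<union> ?B. \<forall>v\<in>?A \<union> ?B. rel n w 2 u v)"
    by (subst sat_all_pairs_fm; simp add: image_Un)+
  have "sat n w (core_fm I J z) xs \<longleftrightarrow>
      joined ?G ?A ?B \<and> (\<forall>u\<in>?A \<union> ?B. \<forall>v\<in>?A \<union> ?B. rel n w 2 u v) \<and>
      (\<forall>v<n. extendable ?G ?A ?B v \<longrightarrow>
        (\<exists>v'<n. extendable ?G ?A ?B v' \<and> (v' = v \<or> rel n w 0 v' v) \<and> (\<forall>a\<in>?A. rel n w 2 a v'))) \<and>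
      \<not> (\<exists>v<n. extendable ?G ?B ?A v)"
    unfolding core_fm_def joined
    by (simp add: pairs e1 e2 e3 e4 v conj_ac cong: conj_cong)
  also have "\<dots> \<longleftrightarrow> mono_core ?G (rel n w 2) ?A ?B"
    unfolding mono_core_def by (auto simp: Bex_def Ball_def)
  finally show ?thesis .
qed

lemma sat_no_core_fm:
  "sat n w (no_core_fm i) [] \<longleftrightarrow>
    \<not> (\<exists>as bs. length as = i \<and> length bs = 2 * i \<and> set as \<subseteq> {..<n} \<and> set bs \<subseteq> {..<n} \<and>
        mono_core (word_graph n w) (rel n w 2) (set as) (set bs))"
proof -
  have sat: "sat n w (core_fm [0..<i] [i..<3 * i] (3 * i)) (as @ bs) \<longleftrightarrow>
      mono_core (word_graph n w) (rel n w 2) (set as) (set bs)"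
    if len: "length as = i" "length bs = 2 * i" and sub: "set as \<subseteq> {..<n}" "set bs \<subseteq> {..<n}" for as bs
  proof -
    have "val (as @ bs) ` {0..<i} = (\<lambda>a. as ! a) ` {0..<i}"
      using len by (intro image_cong) (auto simp: val_append)
    then have A: "val (as @ bs) ` set [0..<i] = set as"
      using len by (simp add: nth_image)
    have "val (as @ bs) ` {i..<3 * i} = (\<lambda>b. bs ! (b - i)) ` {i..<3 * i}"
      using len by (intro image_cong) (auto simp: val_def nth_append)
    also have "{i..<3 * i} = (\<lambda>b. b + i) ` {0..<2 * i}" by (simp add: image_add_atLeastLessThan')
    also have "(\<lambda>b. bs ! (b - i)) ` (\<lambda>b. b + i) ` {0..<2 * i} = (\<lambda>b. bs ! b) ` {0..<2 * i}"
      by (simp only: image_image add_diff_cancel_right')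
    also have "\<dots> = set bs" using len by (simp add: nth_image)
    finally have B: "val (as @ bs) ` set [i..<3 * i] = set bs" by simp
    show ?thesis
      by (subst sat_core_fm) (use len sub A B in auto)
  qed
  have "sat n w (exs (3 * i) (core_fm [0..<i] [i..<3 * i] (3 * i))) [] \<longleftrightarrow>
      (\<exists>xs. length xs = 3 * i \<and> set xs \<subseteq> {..<n} \<and> sat n w (core_fm [0..<i] [i..<3 * i] (3 * i)) xs)"
    by simp
  also have "\<dots> \<longleftrightarrow> (\<exists>as bs. length as = i \<and> length bs = 2 * i \<and> set as \<subseteq> {..<n} \<and> set bs \<subseteq> {..<n} \<and>
        mono_core (word_graph n w) (rel n w 2) (set as) (set bs))"
  proof
    assume "\<exists>xs. length xs = 3 * i \<and> set xs \<subseteq> {..<n} \<and> sat n w (core_fm [0..<i] [i..<3 * i] (3 * i)) xs"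
    then obtain xs where xs: "length xs = 3 * i" "set xs \<subseteq> {..<n}"
      "sat n w (core_fm [0..<i] [i..<3 * i] (3 * i)) xs" by blast
    have "set (take i xs) \<subseteq> {..<n}" "set (drop i xs) \<subseteq> {..<n}"
      using xs(2) set_take_subset[of i xs] set_drop_subset[of i xs] by auto
    then show "\<exists>as bs. length as = i \<and> length bs = 2 * i \<and> set as \<subseteq> {..<n} \<and> set bs \<subseteq> {..<n} \<and>
        mono_core (word_graph n w) (rel n w 2) (set as) (set bs)"
      using sat[of "take i xs" "drop i xs"] xs
      by (intro exI[of _ "take i xs"] exI[of _ "drop i xs"]) auto
  next
    assume "\<exists>as bs. length as = i \<and> length bs = 2 * i \<and> set as \<subseteq> {..<n} \<and> set bs \<subseteq> {..<n} \<and>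
        mono_core (word_graph n w) (rel n w 2) (set as) (set bs)"
    then obtain as bs where *: "length as = i" "length bs = 2 * i" "set as \<subseteq> {..<n}" "set bs \<subseteq> {..<n}"
      "mono_core (word_graph n w) (rel n w 2) (set as) (set bs)" by blast
    then show "\<exists>xs. length xs = 3 * i \<and> set xs \<subseteq> {..<n} \<and> sat n w (core_fm [0..<i] [i..<3 * i] (3 * i)) xs"
      using sat[of as bs] by (intro exI[of _ "as @ bs"]) auto
  qed
  finally show ?thesis by (simp add: no_core_fm_def)
qed

lemma mono_core_cong:
  assumes "pair_graph G" "\<And>u v. u \<in> pverts G \<Longrightarrow> v \<in> pverts G \<Longrightarrow> S u v \<longleftrightarrow> S' u v"
    and "A \<subseteq> pverts G" "B \<subseteq> pverts G"
  shows "mono_core G S A B \<longleftrightarrow> mono_core G S' A B"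
proof -
  have "(\<forall>u\<in>A \<union> B. \<forall>v\<in>A \<union> B. S u v) \<longleftrightarrow> (\<forall>u\<in>A \<union> B. \<forall>v\<in>A \<union> B. S' u v)"
    by (intro ball_cong refl) (use assms in auto)
  moreover have "(\<forall>a\<in>A. S a z) \<longleftrightarrow> (\<forall>a\<in>A. S' a z)" if "z \<in> pverts G" for z
    by (intro ball_cong refl) (use assms that in auto)
  ultimately show ?thesis unfolding mono_core_def by (simp cong: bex_cong)
qed

text \<open>Repeating an element pads an enumeration, so a fixed number of variables covers all
  smaller nonempty sets.\<close>

lemma ex_list_of_set:
  assumes "finite A" "A \<noteq> {}" "card A \<le> l"
  shows "\<exists>xs. set xs = A \<and> length xs = l"
proof -
  obtain ys where ys: "set ys = A" "distinct ys" using finite_distinct_list[OF assms(1)] by blast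
  then have "length ys \<le> l" using distinct_card[of ys] assms(3) by simp
  then show ?thesis
    using ys(1) assms(2) by (intro exI[of _ "ys @ replicate (l - length ys) (hd ys)"]) auto
qed

lemma (in pair_graph) ex_core_iff:
  assumes free: "\<forall>F\<in>set (forbidden_list i). \<not> induced_copy F G"
    and S: "\<And>u v. u \<in> pverts G \<Longrightarrow> v \<in> pverts G \<Longrightarrow> S u v \<longleftrightarrow> \<rho> u = \<rho> v"
  shows "(\<exists>as bs. length as = i \<and> length bs = 2 * i \<and> set as \<subseteq> pverts G \<and> set bs \<subseteq> pverts G \<and>
      mono_core G S (set as) (set bs)) \<longleftrightarrow> (\<exists>W. maximal_biclique G W \<and> monochromatic \<rho> W)"
    (is "?L \<longleftrightarrow> ?R")
proof -
  have dart: "\<not> induced_copy dart_graph G" and Kii: "\<not> induced_copy (Kii i) G"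
    using free by (auto simp: forbidden_list_def)
  \<comment> \<open>For \<open>i = 0\<close> the excluded graph is empty and occurs in every graph.
    With \<open>i\<close> positive, the lists below denote nonempty sides.\<close>
  have "induced_copy (Kii 0) G"
    by (rule induced_copy_KiiI[of "{}" "{}"]) (auto simp: joined_def independent_def)
  then have "i \<noteq> 0" using Kii by metis
  have ?R if ?L
  proof -
    from that obtain as bs where *: "length as = i" "length bs = 2 * i" "set as \<subseteq> pverts G" "set bs \<subseteq> pverts G"
      "mono_core G S (set as) (set bs)" by blast
    then have "mono_core G (\<lambda>u v. \<rho> u = \<rho> v) (set as) (set bs)"
      using mono_core_cong[OF pair_graph S, where A = "set as" and B = "set bs"] by simp
    moreover have "set as \<noteq> {}" "set bs \<noteq> {}" using * \<open>i \<noteq> 0\<close> by auto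
    ultimately show ?R by (rule mono_core_imp_maximal_biclique[OF dart])
  qed
  moreover have ?L if ?R
  proof -
    from that obtain W where "maximal_biclique G W" "monochromatic \<rho> W" by blast
    from maximal_biclique_imp_mono_core[OF dart Kii this]
    obtain A B where AB: "A \<noteq> {}" "B \<noteq> {}" "card A \<le> i" "card B \<le> 2 * i" "A \<subseteq> pverts G" "B \<subseteq> pverts G"
      "mono_core G (\<lambda>u v. \<rho> u = \<rho> v) A B" by blast
    have "finite A" "finite B" using AB(5,6) pair_finite_verts by (auto intro: finite_subset)
    then obtain as bs where "set as = A" "length as = i" "set bs = B" "length bs = 2 * i"
      using ex_list_of_set AB(1-4) by metis
    moreover have "mono_core G S A B"
      using mono_core_cong[OF pair_graph S AB(5,6)] AB(7) by simp
    ultimately show ?L using AB(5,6) by blast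
  qed
  ultimately show ?thesis by blast
qed

section \<open>The sentence for the problem\<close>

definition problem_fm :: "nat \<Rightarrow> nat \<Rightarrow> fm" where
  "problem_fm k i = conjs
     [Sym 1 0 0 3, graph_fm, connected_fm, colour_fm k,
      conjs (map no_copy_fm (forbidden_list i)), no_core_fm i]"

text \<open>
  A certificate consists of a search order and the relation of having the same colour. The atom
  \<open>Sym 1 0 0 3\<close> checks that the separator follows immediately after an \<open>n\<close> by \<open>n\<close> matrix.
\<close>

lemma sat_problem_fm:
  assumes "0 < n"
  shows "sat n w (problem_fm k i) [] \<longleftrightarrow>
    w (n * n + n + 1) = 3 \<and> pair_graph (word_graph n w) \<and>
    search_order (word_graph n w) 0 (rel n w 1) \<and> family_free (forbidden_graphs i) (word_graph n w) \<and>
    (\<exists>\<rho>. biclique_coloring k (word_graph n w) \<rho> \<and> (\<forall>u<n. \<forall>v<n. rel n w 2 u v \<longleftrightarrow> \<rho> u = \<rho> v))"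
proof (cases "pair_graph (word_graph n w)")
  case True
  then interpret pair_graph "word_graph n w" .
  let ?G = "word_graph n w"
  have sep: "sat n w (Sym 1 0 0 3) [] \<longleftrightarrow> w (n * n + n + 1) = 3"
    by (simp add: val_def algebra_simps)
  have free: "sat n w (conjs (map no_copy_fm (forbidden_list i))) [] \<longleftrightarrow> family_free (forbidden_graphs i) ?G"
    unfolding family_free_forbidden_graphs_iff sat_conjs
    using pverts_forbidden_list sat_no_copy_fm by fastforce
  have "sat n w (problem_fm k i) [] \<longleftrightarrow>
      w (n * n + n + 1) = 3 \<and> search_order ?G 0 (rel n w 1) \<and> family_free (forbidden_graphs i) ?G \<and>
      same_colour k {..<n} (rel n w 2) \<and> sat n w (no_core_fm i) []"
    unfolding problem_fm_def conjs.simps sat.simps(2,4) sep free sat_graph_fm sat_connected_fm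
      sat_colour_fm using True by blast
  moreover have "same_colour k {..<n} (rel n w 2) \<and> sat n w (no_core_fm i) [] \<longleftrightarrow>
      (\<exists>\<rho>. biclique_coloring k ?G \<rho> \<and> (\<forall>u<n. \<forall>v<n. rel n w 2 u v \<longleftrightarrow> \<rho> u = \<rho> v))"
    if "family_free (forbidden_graphs i) ?G"
  proof -
    \<comment> \<open>The formula sees colours only through \<open>rel n w 2\<close>, so any
      coloring that induces this relation may be used.\<close>
    have no_core: "sat n w (no_core_fm i) [] \<longleftrightarrow> \<not> (\<exists>W. maximal_biclique ?G W \<and> monochromatic \<rho> W)"
      if "\<forall>u<n. \<forall>v<n. rel n w 2 u v \<longleftrightarrow> \<rho> u = \<rho> v" for \<rho>
      using ex_core_iff[of i "rel n w 2" \<rho>] that \<open>family_free (forbidden_graphs i) ?G\<close>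
      unfolding family_free_forbidden_graphs_iff sat_no_core_fm by simp
    show ?thesis
      unfolding same_colour_def biclique_coloring_def coloring_def pverts_word_graph
      using no_core by (auto simp: Ball_def)
  qed
  ultimately show ?thesis using True by blast
next
  case False
  then show ?thesis
    by (simp add: problem_fm_def sat_graph_fm)
qed

section \<open>Words and certificates\<close>

lemma length_matrix: "length (concat (map (\<lambda>u. map (f u) [0..<n]) [0..<m])) = m * n"
  by (induction m) auto

lemma nth_matrix:
  "u < m \<Longrightarrow> v < n \<Longrightarrow> concat (map (\<lambda>u. map (f u) [0..<n]) [0..<m]) ! (u * n + v) = f u v"
proof (induction m)
  case (Suc m)
  show ?case
  proof (cases "u < m")
    case True
    have "u * n + v < Suc u * n" using Suc.prems by simp
    also have "\<dots> \<le> m * n" using True by (intro mult_le_mono1) simp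
    finally show ?thesis using Suc True by (simp add: nth_append length_matrix)
  next
    case False
    then have "u = m" using Suc.prems by simp
    then show ?thesis using Suc.prems by (simp add: nth_append length_matrix)
  qed
qed simp

lemma unary_prefix_encode:
  "unary_prefix (replicate n True @ False # zs) = n"
  by (induction n) (simp_all add: unary_prefix_def)

text \<open>Only the separator carries symbol 3, so the atom \<open>Sym 1 0 0 3\<close> forces
  \<open>x\<close> to have length \<open>n * n + n + 1\<close>.\<close>

lemma symbol_at_eq_3: "symbol_at x y p = 3 \<longleftrightarrow> p = length x"
proof -
  consider "p < length x" | "p = length x" | t where "p = length x + Suc t"
    by (metis add_Suc_right less_imp_Suc_add linorder_neqE_nat)
  then show ?thesis
    by cases (auto simp: symbol_at_def pair_word_def nth_append bit_symbol_def)
qed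

lemma symbol_at_less: "p < length x \<Longrightarrow> symbol_at x y p = bit_symbol (x ! p)"
  by (simp add: symbol_at_def pair_word_def nth_append)

lemma symbol_at_certificate:
  "symbol_at x y (length x + Suc t) = (if t < length y then bit_symbol (y ! t) else 0)"
  by (simp add: symbol_at_def pair_word_def nth_append)

lemma rel_0_encode:
  assumes "x = replicate n True @ [False] @ concat (map (\<lambda>u. map (f u) [0..<n]) [0..<n])" "u < n" "v < n"
  shows "rel n (symbol_at x y) 0 u v \<longleftrightarrow> f u v"
proof -
  let ?ms = "concat (map (\<lambda>u. map (f u) [0..<n]) [0..<n])"
  have "u * n + v < Suc u * n" using assms(3) by simp
  also have "\<dots> \<le> n * n" using assms(2) by (intro mult_le_mono1) simp
  finally have "u * n + v < length ?ms" by (simp add: length_matrix)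
  then have "(0 * n + 1 + u) * n + v + 1 < length x"
    "x ! ((0 * n + 1 + u) * n + v + 1) = ?ms ! (u * n + v)"
    using assms(1) by (auto simp: nth_append)
  then show ?thesis
    using assms(2,3) by (simp add: rel_def symbol_at_less bit_symbol_def nth_matrix)
qed

text \<open>Once prefix and length are right, every remaining bit is an entry of the matrix, and
  each value of it is possible. So no further check is needed to recognize a code; symmetry and the
  absence of loops are left to \<open>graph_fm\<close>.\<close>

lemma encode_graph_word_graph:
  assumes n: "unary_prefix x = n" "length x = n * n + n + 1"
  shows "encode_graph (word_graph n (symbol_at x y)) = x"
proof (rule nth_equalityI)
  let ?G = "word_graph n (symbol_at x y)"
  let ?ms = "concat (map (\<lambda>u. map (\<lambda>v. (u, v) \<in> parcs ?G) [0..<n]) [0..<n])"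
  have enc: "encode_graph ?G = replicate n True @ [False] @ ?ms"
    by (simp add: encode_graph_def Let_def)
  show len: "length (encode_graph ?G) = length x"
    using n by (simp only: enc length_append length_matrix) simp
  fix p assume p: "p < length (encode_graph ?G)"
  consider "p < n" | "p = n" | q where "p = n + 1 + q" "q < n * n"
  proof -
    assume *: "p < n \<Longrightarrow> thesis" "p = n \<Longrightarrow> thesis" "\<And>q. p = n + 1 + q \<Longrightarrow> q < n * n \<Longrightarrow> thesis"
    have "p = n + 1 + (p - n - 1)" "p - n - 1 < n * n" if "n < p"
      using that p unfolding len n(2) by linarith+
    then show thesis using * by (meson linorder_neqE_nat)
  qed
  then show "encode_graph ?G ! p = x ! p"
  proof cases
    case 1
    then have "x ! p"
      using n(1) nth_mem[of p "takeWhile id x"] set_takeWhileD[of "x ! p" id x]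
      by (simp add: unary_prefix_def takeWhile_nth)
    then show ?thesis using 1 by (simp add: enc nth_append)
  next
    case 2
    \<comment> \<open>The length exceeds \<open>n\<close>, so the run of ones ends with a zero bit
      inside \<open>x\<close>.\<close>
    have "\<not> x ! n" using n nth_length_takeWhile[of id x] by (simp add: unary_prefix_def)
    then show ?thesis using 2 by (simp add: enc nth_append)
  next
    case 3
    define u v where "u = q div n" and "v = q mod n"
    have uv: "q = u * n + v" "u < n" "v < n"
      using 3(2) by (auto simp: u_def v_def less_mult_imp_div_less) (metis gr_zeroI mod_less_divisor mult_0 not_less0)
    have "encode_graph ?G ! p = ?ms ! q" using 3(1) by (simp add: enc nth_append)
    also have "\<dots> = ((u, v) \<in> parcs ?G)" using uv by (simp only: uv(1) nth_matrix)
    also have "\<dots> = x ! p"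
    proof -
      have p': "(0 * n + 1 + u) * n + v + 1 = p" using 3(1) uv(1) by simp
      have "p < length x" using p len by simp
      then show ?thesis
        using uv(2,3) unfolding parcs_word_graph rel_def p' by (simp add: symbol_at_less bit_symbol_def)
    qed
    finally show ?thesis .
  qed
qed

definition certificate :: "nat \<Rightarrow> (nat \<Rightarrow> nat \<Rightarrow> bool) \<Rightarrow> (nat \<Rightarrow> nat \<Rightarrow> bool) \<Rightarrow> bool list" where
  "certificate n D S =
     tl (concat (map (\<lambda>u. map (D u) [0..<n]) [0..<n]) @ concat (map (\<lambda>u. map (S u) [0..<n]) [0..<n]))"

text \<open>The first entry \<open>D 0 0\<close> is dropped because the separator occupies its cell.\<close>

lemma rel_certificate:
  assumes x: "length x = n * n + n + 1" and uv: "u < n" "v < n" and D: "\<not> D 0 0"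
  shows "rel n (symbol_at x (certificate n D S)) 1 u v \<longleftrightarrow> D u v"
    and "rel n (symbol_at x (certificate n D S)) 2 u v \<longleftrightarrow> S u v"
proof -
  let ?D = "concat (map (\<lambda>u. map (D u) [0..<n]) [0..<n])"
  let ?S = "concat (map (\<lambda>u. map (S u) [0..<n]) [0..<n])"
  let ?y = "certificate n D S"
  have q: "u * n + v < n * n"
  proof -
    have "u * n + v < Suc u * n" using uv(2) by simp
    also have "\<dots> \<le> n * n" using uv(1) by (intro mult_le_mono1) simp
    finally show ?thesis .
  qed
  have sym: "symbol_at x ?y (length x + t) = 2 \<longleftrightarrow> (?D @ ?S) ! t" if t: "0 < t" "t < n * n + n * n" for t
  proof -
    obtain t' where t': "t = Suc t'" using t(1) by (cases t) auto
    have "t' < length ?y"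
      using t(2) unfolding certificate_def length_tl length_append length_matrix t' by simp
    then show ?thesis
      unfolding t' symbol_at_certificate by (simp add: certificate_def nth_tl bit_symbol_def)
  qed
  have pos1: "(1 * n + 1 + u) * n + v + 1 = length x + (u * n + v)"
    and pos2: "(2 * n + 1 + u) * n + v + 1 = length x + (n * n + (u * n + v))"
    using x by (simp_all add: algebra_simps)
  show "rel n (symbol_at x ?y) 1 u v \<longleftrightarrow> D u v"
  proof (cases "u * n + v = 0")
    \<comment> \<open>This cell holds the separator, which reads as false, just like
      \<open>D 0 0\<close>.\<close>
    case True
    then have "u = 0" "v = 0" using uv by auto
    moreover have "symbol_at x ?y (length x) = 3" by (simp add: symbol_at_eq_3)
    ultimately show ?thesis unfolding rel_def pos1 using D by simp
  next
    case False
    then show ?thesis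
      unfolding rel_def pos1 using sym[of "u * n + v"] q uv
      by (simp add: nth_append length_matrix nth_matrix)
  qed
  have "n * n > 0" using uv by simp
  then show "rel n (symbol_at x ?y) 2 u v \<longleftrightarrow> S u v"
    unfolding rel_def pos2 using sym[of "n * n + (u * n + v)"] q uv
    by (simp add: nth_append length_matrix nth_matrix)
qed

text \<open>The polynomial is twice the square of the length, which leaves room for two
  \<open>n\<close> by \<open>n\<close> matrices. Conversely, the graph read off from an accepted
  word is itself the required instance, with code \<open>x\<close>.\<close>

lemma problem_iff:
  "x \<in> biclique_coloring_problem k (forbidden_graphs i) \<longleftrightarrow>
    (\<exists>y. length y \<le> poly [:0, 0, 2:] (length x) \<and> 0 < unary_prefix x \<and>
      sat (unary_prefix x) (symbol_at x y) (problem_fm k i) [])"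
proof
  assume "x \<in> biclique_coloring_problem k (forbidden_graphs i)"
  then obtain G \<rho> where G: "x = encode_graph G" "graph_instance G" "connected (with_proj G)"
    "family_free (forbidden_graphs i) G" "biclique_coloring k G \<rho>"
    unfolding biclique_coloring_problem_def by blast
  then obtain n where n: "pverts G = {..<n}" by (auto simp: graph_instance_def)
  interpret pair_graph G using G(2) by (simp add: graph_instance_def)
  have "pverts G \<noteq> {}" using G(3) by (simp add: connected_iff)
  then have "0 < n" using n by auto
  then have "0 \<in> pverts G" using n by simp
  then obtain D where D: "search_order G 0 D"
    using connected_imp_search_order G(3) by blast
  define y where "y = certificate n D (\<lambda>u v. \<rho> u = \<rho> v)"
  let ?w = "symbol_at x y"
  have x: "x = replicate n True @ [False] @ concat (map (\<lambda>u. map (\<lambda>v. (u, v) \<in> parcs G) [0..<n]) [0..<n])"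
    using G(1) n by (simp add: encode_graph_def Let_def)
  then have prefix: "unary_prefix x = n" by (simp add: unary_prefix_encode)
  have len: "length x = n * n + n + 1" unfolding x by (simp only: length_append length_matrix) simp
  have "\<not> D 0 0" using D \<open>0 \<in> pverts G\<close> by (simp add: search_order_def)
  note rel = rel_certificate[where D = D and S = "\<lambda>u v. \<rho> u = \<rho> v", OF len _ _ this, folded y_def]
  have "(u, v) \<in> parcs (word_graph n ?w) \<longleftrightarrow> (u, v) \<in> parcs G" for u v
    using rel_0_encode[OF x, of u v y] wellformed'[of u v] n by auto
  then have graph: "word_graph n ?w = G"
    using n by (intro pair_pre_digraph.equality) auto
  have "search_order G 0 (rel n ?w 1)"
    using D search_order_cong[of G "rel n ?w 1" D 0] rel(1) n by simp
  then have "sat n ?w (problem_fm k i) []"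
    unfolding sat_problem_fm[OF \<open>0 < n\<close>] graph
    using G(4,5) rel(2) pair_graph by (auto simp: symbol_at_eq_3 len)
  moreover have "length y \<le> poly [:0, 0, 2:] (length x)"
  proof -
    have "n * n \<le> length x * length x" by (intro mult_le_mono) (simp_all add: len)
    then show ?thesis by (simp add: y_def certificate_def length_matrix algebra_simps)
  qed
  ultimately show "\<exists>y. length y \<le> poly [:0, 0, 2:] (length x) \<and> 0 < unary_prefix x \<and>
      sat (unary_prefix x) (symbol_at x y) (problem_fm k i) []"
    using prefix \<open>0 < n\<close> by auto
next
  assume "\<exists>y. length y \<le> poly [:0, 0, 2:] (length x) \<and> 0 < unary_prefix x \<and>
      sat (unary_prefix x) (symbol_at x y) (problem_fm k i) []"
  then obtain n y where n: "unary_prefix x = n" "0 < n" and sat: "sat n (symbol_at x y) (problem_fm k i) []"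
    by blast
  let ?G = "word_graph n (symbol_at x y)"
  from sat have *: "length x = n * n + n + 1" "pair_graph ?G"
    "search_order ?G 0 (rel n (symbol_at x y) 1)" "family_free (forbidden_graphs i) ?G"
    "\<exists>\<rho>. biclique_coloring k ?G \<rho>"
    unfolding sat_problem_fm[OF n(2)] symbol_at_eq_3 by auto
  have "graph_instance ?G" using *(2) by (auto simp: graph_instance_def)
  moreover have "connected (with_proj ?G)"
    using pair_graph.search_order_imp_connected[OF *(2) _ *(3)] n(2) by simp
  moreover have "encode_graph ?G = x" using encode_graph_word_graph[OF n(1) *(1)] .
  ultimately show "x \<in> biclique_coloring_problem k (forbidden_graphs i)"
    unfolding biclique_coloring_problem_def using *(4,5) by (intro CollectI exI[of _ ?G]) simp
qed

theorem theorem28: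
  fixes k i :: nat
  shows "biclique_coloring_problem k (forbidden_graphs i) \<in> NP"
  using problem_iff by (rule first_order_verifier_NP)

end
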